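(* Let $N\ge 3$ and let $d\mu=\mu(x)\,dx$ be a measure on $\mathbb{R}^N$ with density $\mu$. Write $c_0(s):=\left(\frac{s-2}{2}\right)^2$ for $s\in\mathbb{R}$, and $U_\mu:=\frac14\left|\frac{\nabla\mu}{\mu}\right|^2-\frac12\frac{\Delta\mu}{\mu}$. Assume: (1) $\mu\ge 0$, $\mu^{1/2}\in H^1_{loc}(\mathbb{R}^N)$, $\Delta\mu\in L^1_{loc}(\mathbb{R}^N)$; (2) the constant $c_{0,\mu}:=\liminf_{x\to 0}\left(c_0(N)-|x|^2U_\mu(x)\right)$ is finite; (3) for every $R>0$ the function $U:=U_\mu-\frac{1}{|x|^2}\limsup_{x\to0}|x|^2U_\mu$ is bounded from above in $\mathbb{R}^N\setminus B_R$; (4) there exists $R_0>0$ such that $|x|^2U(x)\le \frac14\frac{1}{|\log|x||^2}$ for all $x\in B_{R_0}$; (5) $\mu\in L^1_{loc}(\mathbb{R}^N)$ and $N_0:=\sup\{\delta\in\mathbb{R}: |x|^{-\delta}\in L^1_{loc}(\mathbb{R}^N,d\mu)\}$ exists (as a real number); (6) $c_{0,\mu}=c_0(N_0)$. Then, for $c\in\mathbb{R}$, the following are equivalent: (a) there exists a constant $C$ such that $$c\int_{\mathbb{R}^N}\frac{\varphi^2}{|x|^2}\,d\mu\le\int_{\mathbb{R}^N}|\nabla\varphi|^2\,d\mu+C\int_{\mathbb{R}^N}\varphi^2\,d\mu\qquad\text{for all }\varphi\in H^1_\mu;$$ (b) $c\le c_0(N_0)$.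
   Context: $B_R$ denotes the open ball of $\mathbb{R}^N$ of radius $R$ centered at $0$. $L^2_\mu:=L^2(\mathbb{R}^N,d\mu)$, and $H^1_\mu$ is the Sobolev space of functions in $L^2_\mu$ whose weak first derivatives belong to $L^2_\mu$; $C_c^\infty(\mathbb{R}^N)$ is dense in $H^1_\mu$ when $\mu^{1/2}\in H^1_{loc}(\mathbb{R}^N)$ (known fact). Functions $\varphi$ are real-valued. *)

theory Defs
  imports "HOL-Analysis.Analysis"
begin

text \<open>
  Elements of Lebesgue and Sobolev spaces are represented by functions on \<open>real ^ 'n\<close>; membership
  depends only on the class modulo null sets.
\<close>

definition L1_loc :: "(real ^ 'n) measure \<Rightarrow> (real ^ 'n \<Rightarrow> 'b :: euclidean_space) \<Rightarrow> bool" where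
  "L1_loc M f \<longleftrightarrow> (\<forall>K. compact K \<longrightarrow> set_integrable M K f)"

definition L2 :: "(real ^ 'n) measure \<Rightarrow> (real ^ 'n \<Rightarrow> 'b :: euclidean_space) \<Rightarrow> bool" where
  "L2 M f \<longleftrightarrow> f \<in> borel_measurable M \<and> integrable M (\<lambda>x. (norm (f x))\<^sup>2)"

definition L2_loc :: "(real ^ 'n) measure \<Rightarrow> (real ^ 'n \<Rightarrow> 'b :: euclidean_space) \<Rightarrow> bool" where
  "L2_loc M f \<longleftrightarrow> f \<in> borel_measurable M \<and>
     (\<forall>K. compact K \<longrightarrow> set_integrable M K (\<lambda>x. (norm (f x))\<^sup>2))"


definition partial_deriv :: "'n \<Rightarrow> (real ^ 'n \<Rightarrow> real) \<Rightarrow> real ^ 'n \<Rightarrow> real" where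
  "partial_deriv i f x = frechet_derivative f (at x) (axis i 1)"

fun Ck :: "nat \<Rightarrow> (real ^ 'n \<Rightarrow> real) \<Rightarrow> bool" where
  "Ck 0 f \<longleftrightarrow> continuous_on UNIV f"
| "Ck (Suc k) f \<longleftrightarrow> f differentiable_on UNIV \<and> (\<forall>i. Ck k (partial_deriv i f))"

definition Cc_infinity :: "(real ^ 'n \<Rightarrow> real) set" where
  "Cc_infinity = {f. (\<forall>k. Ck k f) \<and> compact (closure {x. f x \<noteq> 0})}"

definition has_weak_gradient ::
    "(real ^ 'n \<Rightarrow> real) \<Rightarrow> (real ^ 'n \<Rightarrow> real ^ 'n) \<Rightarrow> bool" where
  "has_weak_gradient u g \<longleftrightarrow> L1_loc lebesgue u \<and> L1_loc lebesgue g \<and>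
     (\<forall>\<eta>\<in>Cc_infinity. \<forall>i.
        (\<integral>x. u x * partial_deriv i \<eta> x \<partial>lebesgue) = - (\<integral>x. g x $ i * \<eta> x \<partial>lebesgue))"

definition has_weak_laplacian :: "(real ^ 'n \<Rightarrow> real) \<Rightarrow> (real ^ 'n \<Rightarrow> real) \<Rightarrow> bool" where
  "has_weak_laplacian u l \<longleftrightarrow> L1_loc lebesgue u \<and> L1_loc lebesgue l \<and>
     (\<forall>\<eta>\<in>Cc_infinity.
        (\<integral>x. u x * (\<Sum>i\<in>UNIV. partial_deriv i (partial_deriv i \<eta>) x) \<partial>lebesgue)
          = (\<integral>x. l x * \<eta> x \<partial>lebesgue))"

text \<open>Representatives of the weak gradient and Laplacian, which are unique almost everywhere.\<close>

definition weak_gradient :: "(real ^ 'n \<Rightarrow> real) \<Rightarrow> real ^ 'n \<Rightarrow> real ^ 'n" where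
  "weak_gradient u = (SOME g. has_weak_gradient u g)"

definition weak_laplacian :: "(real ^ 'n \<Rightarrow> real) \<Rightarrow> real ^ 'n \<Rightarrow> real" where
  "weak_laplacian u = (SOME l. has_weak_laplacian u l)"

definition H1_loc :: "(real ^ 'n \<Rightarrow> real) set" where
  "H1_loc = {u. L2_loc lebesgue u \<and> (\<exists>g. has_weak_gradient u g \<and> L2_loc lebesgue g)}"


definition weighted :: "(real ^ 'n \<Rightarrow> real) \<Rightarrow> (real ^ 'n) measure" where
  "weighted \<mu> = density lebesgue (\<lambda>x. ennreal (\<mu> x))"

text \<open>The weak derivatives are taken with respect to Lebesgue measure; only integrability is weighted.\<close>

definition H1_weighted :: "(real ^ 'n \<Rightarrow> real) \<Rightarrow> (real ^ 'n \<Rightarrow> real) set" where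
  "H1_weighted \<mu> = {u. L2 (weighted \<mu>) u \<and> (\<exists>g. has_weak_gradient u g \<and> L2 (weighted \<mu>) g)}"

definition c0 :: "real \<Rightarrow> real" where
  "c0 s = ((s - 2) / 2)\<^sup>2"

text \<open>
  \<open>U_mu \<mu>\<close> is meaningful only where \<open>\<mu> \<noteq> 0\<close>, and only up to null sets. Hence bounds on it are
  imposed \<open>\<mu>\<close>-almost everywhere, and its limits inferior and superior at the origin are the essential
  ones: a property holds eventually in the filter below iff it holds \<open>\<mu>\<close>-almost everywhere in some
  punctured neighbourhood of \<open>0\<close>.
\<close>

definition U_mu :: "(real ^ 'n \<Rightarrow> real) \<Rightarrow> real ^ 'n \<Rightarrow> real" where
  "U_mu \<mu> x = 1/4 * (norm (weak_gradient \<mu> x /\<^sub>R \<mu> x))\<^sup>2 - 1/2 * (weak_laplacian \<mu> x / \<mu> x)"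

definition ess_at_0 :: "(real ^ 'n \<Rightarrow> real) \<Rightarrow> (real ^ 'n) filter" where
  "ess_at_0 \<mu> = inf (at 0) (ae_filter (weighted \<mu>))"

definition c0_mu :: "(real ^ 'n \<Rightarrow> real) \<Rightarrow> ereal" where
  "c0_mu \<mu> = Liminf (ess_at_0 \<mu>)
     (\<lambda>x :: real ^ 'n. ereal (c0 (real CARD('n)) - (norm x)\<^sup>2 * U_mu \<mu> x))"

text \<open>The limit superior is finite whenever \<open>c0_mu \<mu>\<close> is.\<close>

definition U_rem :: "(real ^ 'n \<Rightarrow> real) \<Rightarrow> real ^ 'n \<Rightarrow> real" where
  "U_rem \<mu> x = U_mu \<mu> x - 1 / (norm x)\<^sup>2 *
     real_of_ereal (Limsup (ess_at_0 \<mu>) (\<lambda>y. ereal ((norm y)\<^sup>2 * U_mu \<mu> y)))"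

definition loc_integrable_exponents :: "(real ^ 'n \<Rightarrow> real) \<Rightarrow> real set" where
  "loc_integrable_exponents \<mu> = {\<delta>. L1_loc (weighted \<mu>) (\<lambda>x. norm x powr (- \<delta>))}"

definition N0 :: "(real ^ 'n \<Rightarrow> real) \<Rightarrow> real" where
  "N0 \<mu> = Sup (loc_integrable_exponents \<mu>)"

text \<open>
  The integral on the left may be infinite, so it is taken in the extended sense. The two on the
  right are finite for \<open>\<phi> \<in> H1_weighted \<mu>\<close>.
\<close>

definition weighted_hardy :: "(real ^ 'n \<Rightarrow> real) \<Rightarrow> real \<Rightarrow> real \<Rightarrow> (real ^ 'n \<Rightarrow> real) \<Rightarrow> bool" where
  "weighted_hardy \<mu> c C \<phi> \<longleftrightarrow>
     ereal c * enn2ereal (\<integral>\<^sup>+x. ennreal ((\<phi> x)\<^sup>2 / (norm x)\<^sup>2) \<partial>weighted \<mu>)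
       \<le> ereal ((\<integral>x. (norm (weak_gradient \<phi> x))\<^sup>2 \<partial>weighted \<mu>) + C * (\<integral>x. (\<phi> x)\<^sup>2 \<partial>weighted \<mu>))"

end

theory Submission
  imports Defs
begin

text \<open>
  Let \<open>v = sqrt \<mu>\<close> and \<open>b = (N - 2) / 2\<close>. For a vector field \<open>A\<close>, expanding
  \<open>\<bar>v grad \<phi> - \<phi> (v A - grad v)\<bar>\<^sup>2 \<ge> 0\<close> and integrating by parts gives
  \<open>\<integral> \<bar>grad \<phi>\<bar>\<^sup>2 d\<mu> \<ge> - \<integral> \<phi>\<^sup>2 (div A + \<bar>A\<bar>\<^sup>2 + U_mu) d\<mu>\<close>. With \<open>A = grad \<Phi> / \<Phi>\<close> and
  \<open>\<Phi> = r powr (- b) * sqrt (- ln r)\<close> near the origin, \<open>- (div A + \<bar>A\<bar>\<^sup>2)\<close> equals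
  \<open>b\<^sup>2 / r\<^sup>2 + 1 / (4 r\<^sup>2 (ln r)\<^sup>2)\<close>; the logarithmic term absorbs the remainder of \<open>U_mu\<close>, and what is left is the
  Hardy inequality with the constant \<open>b\<^sup>2 - limsup r\<^sup>2 U_mu = c0_mu\<close>. The integration by parts is justified without
  the density of test functions: the weight is mollified as well, and by Cauchy-Schwarz its mollifications satisfy
  \<open>\<bar>grad (\<rho> * \<mu>)\<bar>\<^sup>2 \<le> 4 (\<rho> * \<mu>) (\<rho> * \<bar>grad v\<bar>\<^sup>2)\<close>, which dominates the second order terms. The field may be taken
  singular at \<open>0\<close> because \<open>\<mu> / r\<^sup>2\<close> is locally integrable, by the Hardy inequality for \<open>v\<close>.

  Conversely, testing with truncations of \<open>(r\<^sup>2 + \<epsilon>) powr (\<gamma> / 2)\<close>, where \<open>\<gamma>\<close> is slightly below \<open>1 - N0 / 2\<close>, an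
  inequality with a constant above \<open>\<gamma>\<^sup>2\<close> would bound \<open>\<integral> r powr (2 \<gamma> - 2) d\<mu>\<close> near \<open>0\<close>, although
  \<open>2 - 2 \<gamma>\<close> exceeds \<open>N0\<close>.
\<close>

section \<open>Smooth compactly supported functions\<close>

text \<open>Two defects obstruct the integration by parts of the mixed term
  \<open>\<phi> * v * (grad \<phi> \<bullet> grad v)\<close>: the Laplacian of the weight is only
  locally integrable and can be paired with bounded functions alone, and \<open>grad \<phi>\<close>
  is controlled only where \<mu> is not small. Both are cured by multiplying the completed square by
  a factor between 0 and 1 that vanishes with \<mu> and decays for large \<mu>; dominated
  convergence removes the factor at the end. Every rule for weak derivatives rests on one mode of
  convergence: mollifications that converge almost everywhere on a ball below a locally integrable
  majorant. A factor is then allowed if it is bounded or if Cauchy-Schwarz compares it with a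
  mollified square. The coefficient 1/4 in the assumption on the remainder is exactly what the
  square root of the logarithm in \<Phi> yields. This is why the endpoint
  \<open>c = c0 (N0 \<mu>)\<close> is reached and not merely approached. For the converse,
  \<open>c0 (N0 \<mu>) = (1 - N0 \<mu> / 2)\<^sup>2\<close> dictates the power: the leading part of
  the squared gradient of a radial power is the squared exponent times the Hardy term.\<close>

definition exp_cutoff :: "nat \<Rightarrow> real \<Rightarrow> real" where
  "exp_cutoff k t = (if t > 0 then (1 / t) ^ k * exp (- (1 / t)) else 0)"

lemma exp_cutoff_tendsto_0: "(exp_cutoff k \<longlongrightarrow> 0) (at 0)"
proof -
  have "((\<lambda>x::real. x ^ k / exp x) \<longlongrightarrow> 0) at_top"
    by (rule tendsto_power_div_exp_0)
  then have "((\<lambda>t::real. (inverse t) ^ k / exp (inverse t)) \<longlongrightarrow> 0) (at_right 0)"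
    by (rule filterlim_compose) (rule filterlim_inverse_at_top_right)
  then have r: "(exp_cutoff k \<longlongrightarrow> 0) (at_right 0)"
    by (rule Lim_transform_eventually)
      (use eventually_at_right_less[of "0::real"] in \<open>eventually_elim, auto simp: exp_cutoff_def exp_minus field_simps\<close>)
  have l: "(exp_cutoff k \<longlongrightarrow> 0) (at_left 0)"
    by (rule Lim_transform_eventually[OF tendsto_const])
      (auto simp: eventually_at_filter exp_cutoff_def)
  show ?thesis using l r by (simp add: filterlim_at_split)
qed

text \<open>The powers of \<open>1 / t\<close> are carried along because differentiating
  \<open>exp (- (1 / t))\<close> produces them. The span of the family over all \<open>k\<close> is
  therefore closed under differentiation.\<close>

lemma DERIV_exp_cutoff:
  "(exp_cutoff k has_real_derivative exp_cutoff (k + 2) t - real k * exp_cutoff (k + 1) t) (at t)"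
proof (cases t "0 :: real" rule: linorder_cases)
  case less
  have "((\<lambda>t. 0) has_real_derivative 0) (at t)" by simp
  then have "(exp_cutoff k has_real_derivative 0) (at t)"
    by (rule DERIV_cong_ev[THEN iffD1, rotated 3])
      (use less in \<open>auto simp: exp_cutoff_def intro!: eventually_mono[OF eventually_nhds_in_open[of "{..<0}" t]]\<close>)
  then show ?thesis using less by (simp add: exp_cutoff_def)
next
  case equal
  \<comment> \<open>For \<open>h > 0\<close> the difference quotient
    \<open>exp_cutoff k h / h\<close> is \<open>exp_cutoff (k + 1) h\<close>, and both vanish for
    \<open>h < 0\<close>.\<close>
  have "((\<lambda>h. exp_cutoff (k + 1) h) \<longlongrightarrow> 0) (at 0)" by (rule exp_cutoff_tendsto_0)
  then have "((\<lambda>h. (exp_cutoff k (0 + h) - exp_cutoff k 0) / h) \<longlongrightarrow> 0) (at 0)"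
    by (rule Lim_transform_eventually)
      (auto simp: exp_cutoff_def eventually_at_filter field_simps)
  then show ?thesis using equal by (simp add: DERIV_def exp_cutoff_def)
next
  case greater
  have "((\<lambda>t. (1 / t) ^ k * exp (- (1 / t))) has_real_derivative
     (real k * (1 / t) ^ (k - 1) * (- 1 / t\<^sup>2)) * exp (- (1 / t)) + (1 / t) ^ k * (exp (- (1 / t)) * (1 / t\<^sup>2))) (at t)"
    using greater by (auto intro!: derivative_eq_intros simp: power2_eq_square)
  moreover have "real k * (1 / t) ^ (k - 1) * (- 1 / t\<^sup>2) = - real k * (1 / t) ^ (k + 1)"
    using greater by (cases k) (auto simp: power2_eq_square field_simps)
  moreover have "(1 / t) ^ k * (exp (- (1 / t)) * (1 / t\<^sup>2)) = (1 / t) ^ (k + 2) * exp (- (1 / t))"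
    by (simp add: power2_eq_square field_simps)
  ultimately have "((\<lambda>t. (1 / t) ^ k * exp (- (1 / t))) has_real_derivative
      exp_cutoff (k + 2) t - real k * exp_cutoff (k + 1) t) (at t)"
    using greater by (metis (no_types, lifting) add.commute exp_cutoff_def mult.assoc mult_minus_left uminus_add_conv_diff)
  then show ?thesis
    by (rule DERIV_cong_ev[THEN iffD1, rotated 3])
      (use greater in \<open>auto simp: exp_cutoff_def intro!: eventually_mono[OF eventually_nhds_in_open[of "{0<..}" t]]\<close>)
qed

text \<open>A syntactic class that contains its own partial derivatives. \<open>Cc_infinity\<close>
  asks for iterated partial derivatives of every order, and closure turns this into an induction on
  the order that computes none of them. Subtraction is not a constructor and appears as
  multiplication by -1.\<close>

inductive elem_smooth :: "(real ^ 'n \<Rightarrow> real) \<Rightarrow> bool" where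
  const: "elem_smooth (\<lambda>x. c)"
| coord: "elem_smooth (\<lambda>x. x $ i)"
| add: "elem_smooth f \<Longrightarrow> elem_smooth g \<Longrightarrow> elem_smooth (\<lambda>x. f x + g x)"
| mult: "elem_smooth f \<Longrightarrow> elem_smooth g \<Longrightarrow> elem_smooth (\<lambda>x. f x * g x)"
| cutoff: "elem_smooth f \<Longrightarrow> elem_smooth (\<lambda>x. exp_cutoff k (f x))"

lemma elem_smooth_has_derivative:
  "elem_smooth f \<Longrightarrow> \<exists>f'. (\<forall>x. (f has_derivative f' x) (at x)) \<and> (\<forall>i. elem_smooth (\<lambda>x. f' x (axis i 1)))"
proof (induction rule: elem_smooth.induct)
  case (const c)
  show ?case by (rule exI[of _ "\<lambda>x h. 0"]) (auto intro: elem_smooth.intros)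
next
  case (coord i)
  show ?case
    by (rule exI[of _ "\<lambda>x h. h $ i"])
      (auto intro: elem_smooth.intros bounded_linear.has_derivative[OF bounded_linear_vec_nth has_derivative_ident])
next
  case (add f g)
  then obtain f' g' where
    "\<forall>x. (f has_derivative f' x) (at x)" "\<forall>i. elem_smooth (\<lambda>x. f' x (axis i 1))"
    "\<forall>x. (g has_derivative g' x) (at x)" "\<forall>i. elem_smooth (\<lambda>x. g' x (axis i 1))" by blast
  then show ?case
    by (intro exI[of _ "\<lambda>x h. f' x h + g' x h"]) (auto intro!: elem_smooth.intros has_derivative_add)
next
  case (mult f g)
  then obtain f' g' where
    "\<forall>x. (f has_derivative f' x) (at x)" "\<forall>i. elem_smooth (\<lambda>x. f' x (axis i 1))"
    "\<forall>x. (g has_derivative g' x) (at x)" "\<forall>i. elem_smooth (\<lambda>x. g' x (axis i 1))" by blast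
  then show ?case using mult
    by (intro exI[of _ "\<lambda>x h. f x * g' x h + f' x h * g x"]) (auto intro!: elem_smooth.intros has_derivative_mult)
next
  case (cutoff f k)
  then obtain f' where f':
    "\<forall>x. (f has_derivative f' x) (at x)" "\<forall>i. elem_smooth (\<lambda>x. f' x (axis i 1))" by blast
  let ?d = "\<lambda>x. exp_cutoff (k + 2) (f x) + - real k * exp_cutoff (k + 1) (f x)"
  have "((\<lambda>x. exp_cutoff k (f x)) has_derivative (\<lambda>h. ?d x * f' x h)) (at x)" for x
    using DERIV_compose_FDERIV[where g = f and x = x and s = UNIV and g' = "f' x", OF DERIV_exp_cutoff[of k "f x"]] f'(1)
    by (simp add: mult.commute)
  moreover have "elem_smooth (\<lambda>x. ?d x * f' x (axis i 1))" for i
    using cutoff(1) f'(2) by (intro elem_smooth.intros) auto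
  ultimately show ?case by (intro exI[of _ "\<lambda>x h. ?d x * f' x h"]) auto
qed

lemma elem_smooth_Ck: "elem_smooth f \<Longrightarrow> Ck k f"
proof (induction k arbitrary: f)
  case 0
  then obtain f' where "\<forall>x. (f has_derivative f' x) (at x)"
    using elem_smooth_has_derivative by blast
  then show ?case by (auto intro!: continuous_at_imp_continuous_on has_derivative_continuous)
next
  case (Suc k)
  then obtain f' where f': "\<forall>x. (f has_derivative f' x) (at x)" "\<forall>i. elem_smooth (\<lambda>x. f' x (axis i 1))"
    using elem_smooth_has_derivative by blast
  have "frechet_derivative f (at x) = f' x" for x
    using f'(1) by (intro frechet_derivative_at[symmetric]) simp
  then have "partial_deriv i f = (\<lambda>x. f' x (axis i 1))" for i
    by (simp add: partial_deriv_def fun_eq_iff)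
  then show ?case using f' Suc.IH by (auto simp: differentiable_on_def differentiable_def)
qed

text \<open>The argument of the cutoff is a polynomial in the coordinates, which keeps the function
  in \<open>elem_smooth\<close>; the norm itself is not differentiable at 0.\<close>

definition bump :: "real \<Rightarrow> real ^ 'n \<Rightarrow> real" where
  "bump r x = exp_cutoff 0 (r\<^sup>2 - (norm x)\<^sup>2)"

lemma bump_nonneg: "bump r x \<ge> 0"
  by (simp add: bump_def exp_cutoff_def)

lemma bump_pos: "r > 0 \<Longrightarrow> norm x < r \<Longrightarrow> bump r x > 0"
  by (simp add: bump_def exp_cutoff_def power_strict_mono)

lemma bump_eq_0: "r \<ge> 0 \<Longrightarrow> norm x \<ge> r \<Longrightarrow> bump r x = 0"
  using power_mono[of r "norm x" 2] by (simp add: bump_def exp_cutoff_def not_less)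

lemma norm_sq_vec: "(norm (x :: real ^ 'n))\<^sup>2 = (\<Sum>i\<in>UNIV. (x $ i)\<^sup>2)"
  by (simp add: norm_vec_def L2_set_def sum_nonneg)

lemma elem_smooth_sum: "finite I \<Longrightarrow> (\<And>i. i \<in> I \<Longrightarrow> elem_smooth (f i)) \<Longrightarrow> elem_smooth (\<lambda>x. \<Sum>i\<in>I. f i x)"
  by (induction I rule: finite_induct) (auto intro: elem_smooth.intros)

lemma elem_smooth_bump: "elem_smooth (\<lambda>y. bump r (x - y))"
proof -
  have "elem_smooth (\<lambda>y. exp_cutoff 0 (r\<^sup>2 + (-1) * (\<Sum>i\<in>UNIV. (x $ i + (-1) * y $ i) * (x $ i + (-1) * y $ i))))"
    by (intro elem_smooth.intros elem_smooth_sum) auto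
  then show ?thesis by (simp add: bump_def norm_sq_vec power2_eq_square[symmetric])
qed

lemma elem_smooth_bump0: "elem_smooth (bump r)"
  using elem_smooth_bump[of r 0] by (simp add: bump_def[abs_def])

lemma compact_support_ball:
  assumes "\<And>y. norm y > R \<Longrightarrow> f y = (0 :: real)"
  shows "compact (closure {y :: real ^ 'n. f y \<noteq> 0})"
proof -
  have "{y. f y \<noteq> 0} \<subseteq> cball 0 R" using assms by (force simp: not_less)
  then show ?thesis using bounded_subset bounded_cball by (auto simp: compact_closure)
qed

section \<open>Directional derivatives\<close>

lemma borel_measurable_lebesgue_continuous:
  fixes f :: "real ^ 'n \<Rightarrow> 'b :: euclidean_space"
  shows "continuous_on UNIV f \<Longrightarrow> f \<in> borel_measurable lebesgue"
  by (intro measurable_completion) (simp add: borel_measurable_continuous_onI)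

lemma integral_lebesgue_eq_lborel:
  fixes f :: "real ^ 'n \<Rightarrow> 'b :: euclidean_space"
  shows "continuous_on UNIV f \<Longrightarrow> integral\<^sup>L lebesgue f = integral\<^sup>L lborel f"
  by (intro integral_completion) (simp add: borel_measurable_continuous_onI)

lemma integral_translate:
  fixes f :: "real ^ 'n \<Rightarrow> real"
  assumes c: "continuous_on UNIV f"
  shows "(\<integral>x. f (x + a) \<partial>lebesgue) = (\<integral>x. f x \<partial>lebesgue)"
proof -
  have ca: "continuous_on UNIV (\<lambda>x. f (x + a))"
    by (intro continuous_on_compose2[OF c] continuous_intros) auto
  have "(\<integral>x. f x \<partial>lborel) = (\<integral>x. f x \<partial>distr lborel borel ((+) a))" by (simp add: lborel_distr_plus)
  also have "\<dots> = (\<integral>x. f (a + x) \<partial>lborel)"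
    by (rule integral_distr) (auto intro: borel_measurable_continuous_onI[OF c])
  finally show ?thesis
    by (simp add: integral_lebesgue_eq_lborel[OF ca] integral_lebesgue_eq_lborel[OF c] add.commute)
qed

section \<open>Functions locally integrable with respect to Lebesgue measure\<close>

lemma L1_loc_measurable: "L1_loc lebesgue f \<Longrightarrow> f \<in> borel_measurable lebesgue"
proof -
  assume "L1_loc lebesgue f"
  then have m: "(\<lambda>x. indicator (cball 0 (real n)) x *\<^sub>R f x) \<in> borel_measurable lebesgue" for n
    unfolding L1_loc_def set_integrable_def using compact_cball borel_measurable_integrable by blast
  have "(\<lambda>n. indicator (cball 0 (real n)) x *\<^sub>R f x) \<longlonglongrightarrow> f x" for x
  proof (rule tendsto_eventually)
    obtain N :: nat where "norm x \<le> N" using real_arch_simple by blast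
    then show "\<forall>\<^sub>F n in sequentially. indicator (cball 0 (real n)) x *\<^sub>R f x = f x"
      by (auto simp: eventually_sequentially intro!: exI[of _ N])
  qed
  then show ?thesis by (intro borel_measurable_LIMSEQ_metric[OF m])
qed

lemma L1_loc_cball: "L1_loc lebesgue f \<Longrightarrow> integrable lebesgue (\<lambda>x. indicator (cball 0 R) x *\<^sub>R f x)"
  by (auto simp: L1_loc_def set_integrable_def)

lemma bounded_cball_pos:
  fixes S :: "'a :: real_normed_vector set"
  assumes "bounded S"
  obtains R where "R > 0" "S \<subseteq> cball 0 R"
proof -
  obtain R where "R > 0" "S \<subseteq> ball 0 R" using bounded_subset_ballD[OF assms] by blast
  then show thesis by (intro that[of R]) (auto dest: subsetD)
qed

lemma L1_locI:
  fixes f :: "real ^ 'n \<Rightarrow> 'b :: euclidean_space"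
  assumes "\<And>R. R > 0 \<Longrightarrow> integrable lebesgue (\<lambda>x. indicator (cball 0 R) x *\<^sub>R f x)"
  shows "L1_loc lebesgue f"
  unfolding L1_loc_def
proof (intro allI impI)
  fix K :: "(real ^ 'n) set" assume K: "compact K"
  then obtain R where R: "R > 0" "K \<subseteq> cball 0 R"
    using bounded_cball_pos[OF compact_imp_bounded] by blast
  have "set_integrable lebesgue (cball 0 R) f" using assms[OF R(1)] by (simp add: set_integrable_def)
  then show "set_integrable lebesgue K f"
    by (rule set_integrable_subset) (use K R in \<open>auto intro: lmeasurable_compact fmeasurableD\<close>)
qed

lemma L1_loc_bound:
  fixes f :: "real ^ 'n \<Rightarrow> 'b :: euclidean_space" and g :: "real ^ 'n \<Rightarrow> 'c :: euclidean_space"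
  assumes "L1_loc lebesgue g" "f \<in> borel_measurable lebesgue" "AE x in lebesgue. norm (f x) \<le> norm (g x)"
  shows "L1_loc lebesgue f"
proof (rule L1_locI)
  fix R :: real assume "R > 0"
  show "integrable lebesgue (\<lambda>x. indicator (cball 0 R) x *\<^sub>R f x)"
  proof (rule Bochner_Integration.integrable_bound[OF L1_loc_cball[OF assms(1), of R]])
    show "(\<lambda>x. indicator (cball 0 R) x *\<^sub>R f x) \<in> borel_measurable lebesgue"
      by (intro borel_measurable_scaleR borel_measurable_indicator assms(2)) simp
    show "AE x in lebesgue. norm (indicator (cball 0 R) x *\<^sub>R f x) \<le> norm (indicator (cball 0 R) x *\<^sub>R g x)"
      using assms(3) by (auto simp: indicator_def elim: eventually_mono)
  qed
qed

lemma L1_loc_continuous: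
  fixes f :: "real ^ 'n \<Rightarrow> 'b :: euclidean_space"
  assumes "continuous_on UNIV f"
  shows "L1_loc lebesgue f"
proof (rule L1_locI)
  fix R :: real assume "R > 0"
  have "integrable lborel (\<lambda>x. indicator (cball 0 R) x *\<^sub>R f x)"
    by (intro borel_integrable_compact) (auto intro: continuous_on_subset[OF assms])
  then show "integrable lebesgue (\<lambda>x. indicator (cball 0 R) x *\<^sub>R f x)"
    using integrable_completion[of "\<lambda>x. indicator (cball 0 R) x *\<^sub>R f x" lborel]
    by (metis borel_measurable_integrable)
qed

lemma L1_loc_mult_integrable:
  fixes f g :: "real ^ 'n \<Rightarrow> real"
  assumes f: "L1_loc lebesgue f" and g: "g \<in> borel_measurable lebesgue"
    and b: "\<And>x. norm x \<le> R \<Longrightarrow> \<bar>g x\<bar> \<le> B" and s: "\<And>x. norm x > R \<Longrightarrow> g x = 0"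
  shows "integrable lebesgue (\<lambda>x. g x * f x)"
proof (rule Bochner_Integration.integrable_bound)
  show "integrable lebesgue (\<lambda>x. B * (indicator (cball 0 R) x *\<^sub>R f x))"
    using L1_loc_cball[OF f] by (intro integrable_mult_right)
  show "(\<lambda>x. g x * f x) \<in> borel_measurable lebesgue"
    using g L1_loc_measurable[OF f] by (rule borel_measurable_times)
  have "\<bar>g x\<bar> * \<bar>f x\<bar> \<le> \<bar>B\<bar> * \<bar>f x\<bar>" if "norm x \<le> R" for x
    using b[OF that] by (intro mult_right_mono) auto
  then show "AE x in lebesgue. norm (g x * f x) \<le> norm (B * (indicator (cball 0 R) x *\<^sub>R f x))"
    using s by (auto simp: abs_mult not_le indicator_def intro!: AE_I2)
qed

lemma continuous_cball_bound:
  fixes f :: "real ^ 'n \<Rightarrow> real"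
  assumes "continuous_on UNIV f"
  obtains B where "B \<ge> 0" "\<And>x. norm x \<le> R \<Longrightarrow> \<bar>f x\<bar> \<le> B"
proof -
  have "compact (f ` cball 0 R)"
    by (intro compact_continuous_image continuous_on_subset[OF assms]) auto
  then obtain B where "\<forall>y\<in>f ` cball 0 R. norm y \<le> B" using compact_imp_bounded bounded_iff by metis
  then show thesis by (intro that[of "max B 0"]) force+
qed

lemma integrable_continuous_support:
  fixes f :: "real ^ 'n \<Rightarrow> real"
  assumes "continuous_on UNIV f" "\<And>x. norm x > R \<Longrightarrow> f x = 0"
  shows "integrable lebesgue f"
proof -
  obtain B where "\<And>x. norm x \<le> R \<Longrightarrow> \<bar>f x\<bar> \<le> B" using continuous_cball_bound[OF assms(1)] by metis
  then have "integrable lebesgue (\<lambda>x. f x * 1)"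
    using assms borel_measurable_lebesgue_continuous[OF assms(1)]
    by (intro L1_loc_mult_integrable[where R = R and B = B] L1_loc_continuous) auto
  then show ?thesis by simp
qed

definition has_partial :: "'n \<Rightarrow> (real ^ 'n \<Rightarrow> real) \<Rightarrow> (real ^ 'n \<Rightarrow> real) \<Rightarrow> bool" where
  "has_partial i f f' \<longleftrightarrow> (\<forall>x. ((\<lambda>t. f (x + t *\<^sub>R axis i 1)) has_real_derivative f' x) (at 0))"

lemma has_partialD:
  assumes "has_partial i f f'"
  shows "((\<lambda>t. f (x + t *\<^sub>R axis i 1)) has_real_derivative f' (x + t *\<^sub>R axis i 1)) (at t)"
proof -
  have "((\<lambda>s. f (x + (s + t) *\<^sub>R axis i 1)) has_real_derivative f' (x + t *\<^sub>R axis i 1)) (at 0)"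
    using assms[unfolded has_partial_def, rule_format, of "x + t *\<^sub>R axis i 1"]
    by (simp add: scaleR_left_distrib add_ac)
  then show ?thesis using DERIV_shift[of "\<lambda>t. f (x + t *\<^sub>R axis i 1)" _ 0 t] by simp
qed

lemma has_partial_lipschitz:
  assumes "has_partial i f f'" "\<And>s. \<bar>s\<bar> \<le> \<bar>t\<bar> \<Longrightarrow> \<bar>f' (x + s *\<^sub>R axis i 1)\<bar> \<le> B"
  shows "\<bar>f (x + t *\<^sub>R axis i 1) - f x\<bar> \<le> B * \<bar>t\<bar>"
proof -
  have "norm (f (x + t *\<^sub>R axis i 1) - f (x + 0 *\<^sub>R axis i 1)) \<le> B * norm (t - 0)"
    by (rule field_differentiable_bound[of "{-\<bar>t\<bar>..\<bar>t\<bar>}" "\<lambda>t. f (x + t *\<^sub>R axis i 1)"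
          "\<lambda>t. f' (x + t *\<^sub>R axis i 1)"])
      (use assms(2) in \<open>auto intro!: has_field_derivative_at_within[OF has_partialD[OF assms(1)]]\<close>)
  then show ?thesis by simp
qed

lemma has_partial_support:
  assumes "has_partial i f f'" "\<And>x. norm x > R \<Longrightarrow> f x = 0" "norm x > R"
  shows "f' x = 0"
proof -
  have o: "open ((\<lambda>t. norm (x + t *\<^sub>R axis i 1)) -` {R<..})"
    by (intro open_vimage continuous_intros open_greaterThan)
  have "\<forall>\<^sub>F t in nhds 0. f (x + t *\<^sub>R axis i 1) = 0"
    using eventually_nhds_in_open[OF o, of 0] assms(2,3) by (auto elim: eventually_mono)
  then have "((\<lambda>t. f (x + t *\<^sub>R axis i 1)) has_real_derivative 0) (at 0)"
    by (subst DERIV_cong_ev[OF refl _ refl, where g = "\<lambda>t. 0"]) simp_all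
  moreover have "((\<lambda>t. f (x + t *\<^sub>R axis i 1)) has_real_derivative f' x) (at 0)"
    using assms(1) by (simp add: has_partial_def)
  ultimately show ?thesis by (rule DERIV_unique[symmetric])
qed

lemma has_partial_mult:
  assumes "has_partial i f f'" "has_partial i g g'"
  shows "has_partial i (\<lambda>x. f x * g x) (\<lambda>x. f' x * g x + f x * g' x)"
  using assms unfolding has_partial_def by (auto intro!: derivative_eq_intros)

lemma has_partial_compose:
  assumes "has_partial i f f'" "\<And>x. (T has_real_derivative T' (f x)) (at (f x))"
  shows "has_partial i (\<lambda>x. T (f x)) (\<lambda>x. T' (f x) * f' x)"
  unfolding has_partial_def
proof
  fix x
  show "((\<lambda>t. T (f (x + t *\<^sub>R axis i 1))) has_real_derivative T' (f x) * f' x) (at 0)"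
    using DERIV_chain2[of T "T' (f x)" "\<lambda>t. f (x + t *\<^sub>R axis i 1)" 0 "f' x" UNIV] assms
    by (simp add: has_partial_def)
qed

text \<open>Translation invariance replaces the fundamental theorem of calculus: every difference
  quotient of \<open>f\<close> in direction \<open>i\<close> integrates to 0, and the quotients
  converge to \<open>f'\<close> while bounded by \<open>B\<close> on a fixed ball.\<close>

lemma has_partial_integral_0:
  fixes f :: "real ^ 'n \<Rightarrow> real"
  assumes p: "has_partial i f f'" and c: "continuous_on UNIV f" "continuous_on UNIV f'"
    and s: "\<And>x. norm x > R \<Longrightarrow> f x = 0"
  shows "integral\<^sup>L lebesgue f' = 0"
proof -
  have s': "f' x = 0" if "norm x > R" for x using has_partial_support[OF p s that] .
  obtain B where B: "B \<ge> 0" "\<And>x. norm x \<le> R \<Longrightarrow> \<bar>f' x\<bar> \<le> B" using continuous_cball_bound[OF c(2)] by metis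
  then have B': "\<bar>f' x\<bar> \<le> B" for x using s'[of x] by (cases "norm x \<le> R") auto
  \<comment> \<open>Increments of length at most 1 keep all quotients supported in the ball of
    radius \<open>R + 1\<close>.\<close>
  define h where "h n = 1 / (real n + 1)" for n
  have h: "h n > 0" "h n \<le> 1" for n by (auto simp: h_def)
  have h0: "h \<longlonglongrightarrow> 0" using LIMSEQ_inverse_real_of_nat unfolding h_def by (simp add: inverse_eq_divide add.commute)
  define d where "d n x = (f (x + h n *\<^sub>R axis i 1) - f x) / h n" for n x
  have cf: "continuous_on UNIV (\<lambda>x. f (x + a))" for a
    by (intro continuous_on_compose2[OF c(1)] continuous_intros) auto
  have cd: "continuous_on UNIV (d n)" for n
    unfolding d_def using h(1)[of n] by (intro continuous_intros cf c(1)) auto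
  have sh: "f (x + a) = 0" if "norm x > R + norm a" for x a
    using that norm_triangle_ineq2[of x "-a"] by (intro s) auto
  have I: "integral\<^sup>L lebesgue (d n) = 0" for n
  proof -
    have "integrable lebesgue (\<lambda>x. f (x + h n *\<^sub>R axis i 1))"
      by (rule integrable_continuous_support[OF cf sh])
    moreover have "integrable lebesgue f" by (rule integrable_continuous_support[OF c(1) s])
    ultimately show ?thesis unfolding d_def by (simp add: integral_translate[OF c(1)])
  qed
  have "(\<lambda>n. integral\<^sup>L lebesgue (d n)) \<longlonglongrightarrow> integral\<^sup>L lebesgue f'"
  proof (rule integral_dominated_convergence)
    show "integrable lebesgue (\<lambda>x :: real ^ 'n. B * indicator (cball 0 (R + 1)) x)"
      using L1_loc_cball[OF L1_loc_continuous, of "\<lambda>x :: real ^ 'n. B" "R + 1"]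
      by (simp add: mult.commute)
    show "AE x in lebesgue. (\<lambda>n. d n x) \<longlonglongrightarrow> f' x"
    proof (rule AE_I2)
      fix x
      have "((\<lambda>t. (f (x + t *\<^sub>R axis i 1) - f x) / t) \<longlongrightarrow> f' x) (at 0)"
        using p by (simp add: has_partial_def DERIV_def)
      moreover have "filterlim h (at 0) sequentially"
        using h0 h(1) by (auto simp: filterlim_at intro!: always_eventually) (metis less_irrefl)
      ultimately show "(\<lambda>n. d n x) \<longlonglongrightarrow> f' x" unfolding d_def by (rule filterlim_compose)
    qed
    show "AE x in lebesgue. norm (d n x) \<le> B * indicator (cball 0 (R + 1)) x" for n
    proof (rule AE_I2)
      fix x
      have 1: "\<bar>f (x + h n *\<^sub>R axis i 1) - f x\<bar> \<le> B * \<bar>h n\<bar>" by (rule has_partial_lipschitz[OF p B'])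
      have 2: "d n x = 0" if "norm x > R + 1"
        using that sh[of "h n *\<^sub>R axis i 1" x] s[of x] h[of n] by (simp add: d_def norm_axis_1)
      show "norm (d n x) \<le> B * indicator (cball 0 (R + 1)) x"
        using 1 2 h(1)[of n] by (cases "norm x \<le> R + 1") (auto simp: d_def field_simps)
    qed
  qed (use cd c(2) in \<open>auto intro: borel_measurable_lebesgue_continuous\<close>)
  then show ?thesis using I LIMSEQ_unique[OF tendsto_const[of 0]] by simp
qed

lemma has_partial_of_Cc_infinity:
  assumes "\<eta> \<in> Cc_infinity"
  shows "has_partial i \<eta> (partial_deriv i \<eta>)"
proof -
  have "Ck 1 \<eta>" using assms by (auto simp: Cc_infinity_def)
  then have "\<eta> differentiable (at x)" for x by (simp add: differentiable_on_def)
  then have D: "(\<eta> has_derivative frechet_derivative \<eta> (at x)) (at x)" for x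
    using frechet_derivative_works by blast
  show ?thesis unfolding has_partial_def
  proof
    fix x
    have "((\<lambda>t. \<eta> (x + t *\<^sub>R axis i 1)) has_derivative (\<lambda>t. frechet_derivative \<eta> (at x) (t *\<^sub>R axis i 1))) (at 0)"
      by (rule has_derivative_compose[where g = \<eta> and f = "\<lambda>t. x + t *\<^sub>R axis i 1"])
        (auto intro!: derivative_eq_intros simp: D)
    then show "((\<lambda>t. \<eta> (x + t *\<^sub>R axis i 1)) has_real_derivative partial_deriv i \<eta> x) (at 0)"
      using has_derivative_bounded_linear[OF D]
      by (simp add: has_field_derivative_def partial_deriv_def linear_cmul bounded_linear.linear mult_commute_abs)
  qed
qed

lemma Cc_infinity_continuous:
  assumes "\<eta> \<in> Cc_infinity"
  shows "continuous_on UNIV \<eta>" "continuous_on UNIV (partial_deriv i \<eta>)"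
proof -
  have "Ck 0 \<eta>" "Ck 1 \<eta>" using assms unfolding Cc_infinity_def by blast+
  then show "continuous_on UNIV \<eta>" "continuous_on UNIV (partial_deriv i \<eta>)" by auto
qed

lemma Cc_infinity_support:
  assumes "\<eta> \<in> Cc_infinity"
  obtains R where "R > 0" "\<And>x. norm x > R \<Longrightarrow> \<eta> x = 0" "\<And>i x. norm x > R \<Longrightarrow> partial_deriv i \<eta> x = 0"
proof -
  have "bounded {x. \<eta> x \<noteq> 0}" using assms by (auto simp: Cc_infinity_def)
  then obtain R where "R > 0" and R: "{x. \<eta> x \<noteq> 0} \<subseteq> cball 0 R" by (rule bounded_cball_pos)
  then have 0: "\<eta> x = 0" if "norm x > R" for x using that by force
  have "partial_deriv i \<eta> x = 0" if "norm x > R" for i x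
    by (rule has_partial_support[OF has_partial_of_Cc_infinity[OF assms] 0 that])
  with 0 \<open>R > 0\<close> show thesis by (intro that[of R]) auto
qed

lemma Cc_infinity_partial: "\<eta> \<in> Cc_infinity \<Longrightarrow> partial_deriv i \<eta> \<in> Cc_infinity"
proof -
  assume e: "\<eta> \<in> Cc_infinity"
  then have "Ck (Suc k) \<eta>" for k unfolding Cc_infinity_def by blast
  then have "Ck k (partial_deriv i \<eta>)" for k by simp
  moreover obtain R where R: "\<And>x. norm x > R \<Longrightarrow> partial_deriv i \<eta> x = 0" using Cc_infinity_support[OF e] by metis
  moreover have "compact (closure {x. partial_deriv i \<eta> x \<noteq> 0})" by (rule compact_support_ball[OF R])
  ultimately show ?thesis by (simp add: Cc_infinity_def)
qed

section \<open>Mollification\<close>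

text \<open>Continuity and compact support suffice for convolution with a locally integrable
  function, and the notion covers mollifiers as well as their first and second partial
  derivatives.\<close>

definition kernel :: "real \<Rightarrow> (real ^ 'n \<Rightarrow> real) \<Rightarrow> bool" where
  "kernel r k \<longleftrightarrow> continuous_on UNIV k \<and> (\<forall>x. norm x > r \<longrightarrow> k x = 0)"

definition conv :: "(real ^ 'n \<Rightarrow> real) \<Rightarrow> (real ^ 'n \<Rightarrow> real) \<Rightarrow> real ^ 'n \<Rightarrow> real" where
  "conv k f x = (\<integral>y. k (x - y) * f y \<partial>lebesgue)"

lemma kernel_bound:
  assumes "kernel r k"
  obtains B where "B \<ge> 0" "\<And>x. \<bar>k x\<bar> \<le> B"
proof -
  obtain B where B: "B \<ge> 0" "\<And>x. norm x \<le> r \<Longrightarrow> \<bar>k x\<bar> \<le> B"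
    using continuous_cball_bound[of k r] assms by (auto simp: kernel_def)
  have "\<bar>k x\<bar> \<le> B" for x using B assms by (cases "norm x \<le> r") (auto simp: kernel_def)
  with B(1) show thesis by (rule that)
qed

lemma kernel_shift_continuous: "kernel r k \<Longrightarrow> continuous_on UNIV (\<lambda>y. k (x - y))"
  unfolding kernel_def by (auto intro!: continuous_on_compose2[of UNIV k] continuous_intros)

lemma kernel_shift_measurable: "kernel r k \<Longrightarrow> (\<lambda>y. k (x - y)) \<in> borel_measurable lebesgue"
  by (intro borel_measurable_lebesgue_continuous kernel_shift_continuous)

lemma kernel_shift_support: "kernel r k \<Longrightarrow> norm y > norm x + r \<Longrightarrow> k (x - y) = 0"
  using norm_triangle_ineq2[of y x] by (auto simp: kernel_def norm_minus_commute[of x y])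

lemma conv_integrable:
  assumes "kernel r k" "L1_loc lebesgue f"
  shows "integrable lebesgue (\<lambda>y. k (x - y) * f y)"
proof -
  obtain B where B: "B \<ge> 0" "\<And>x. \<bar>k x\<bar> \<le> B" using kernel_bound[OF assms(1)] by metis
  show ?thesis
    by (rule L1_loc_mult_integrable[OF assms(2) kernel_shift_measurable[OF assms(1)], where R = "norm x + r" and B = B])
      (use B kernel_shift_support[OF assms(1)] in auto)
qed

lemma conv_measurable_integrand:
  assumes "kernel r k" "L1_loc lebesgue f"
  shows "(\<lambda>y. k (x - y) * f y) \<in> borel_measurable lebesgue"
  using conv_integrable[OF assms] by auto

lemma conv_cong_AE:
  assumes "kernel r k" "f \<in> borel_measurable lebesgue" "g \<in> borel_measurable lebesgue" "AE x in lebesgue. f x = g x"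
  shows "conv k f = conv k g"
proof
  fix x
  show "conv k f x = conv k g x" unfolding conv_def
    using assms(4) by (intro integral_cong_AE borel_measurable_times kernel_shift_measurable[OF assms(1)] assms) auto
qed

lemma conv_diff:
  assumes "kernel r k" "L1_loc lebesgue f" "L1_loc lebesgue g"
  shows "conv k (\<lambda>y. f y - g y) x = conv k f x - conv k g x"
  unfolding conv_def using conv_integrable[OF assms(1,2)] conv_integrable[OF assms(1,3)]
  by (simp add: right_diff_distrib)

lemma conv_local:
  assumes "kernel r k" "\<And>y. norm y \<le> norm x + r \<Longrightarrow> f y = g y"
  shows "conv k f x = conv k g x"
proof -
  have "k (x - y) * f y = k (x - y) * g y" for y
    using assms(2)[of y] kernel_shift_support[OF assms(1), of x y] by (cases "norm y \<le> norm x + r") auto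
  then show ?thesis unfolding conv_def by (simp only:)
qed

lemma conv_support:
  assumes "kernel r k" "\<And>y. norm y > R \<Longrightarrow> f y = 0" "norm x > R + r"
  shows "conv k f x = 0"
proof -
  have "k (x - y) * f y = 0" for y
    using assms norm_triangle_ineq[of "x - y" y] by (auto simp: kernel_def) (smt (verit))
  then show ?thesis unfolding conv_def by (simp only: Bochner_Integration.integral_zero)
qed

lemma conv_continuous:
  fixes k f :: "real ^ 'n \<Rightarrow> real"
  assumes k: "kernel r k" and f: "L1_loc lebesgue f"
  shows "continuous_on UNIV (conv k f)"
proof (rule continuous_on_sequentiallyI)
  fix u :: "nat \<Rightarrow> real ^ 'n" and a assume u: "u \<longlonglongrightarrow> a"
  obtain B where B: "B \<ge> 0" "\<And>x. \<bar>k x\<bar> \<le> B" using kernel_bound[OF k] by metis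
  have "Bseq u" using u by (meson convergentI convergent_imp_Bseq)
  then obtain M where M: "\<And>n. norm (u n) \<le> M" by (auto simp: Bseq_def)
  have kc: "continuous_on UNIV k" using k by (simp add: kernel_def)
  show "(\<lambda>n. conv k f (u n)) \<longlonglongrightarrow> conv k f a" unfolding conv_def
  proof (rule integral_dominated_convergence)
    show "integrable lebesgue (\<lambda>y. B * norm (indicator (cball 0 (M + r)) y *\<^sub>R f y))"
      by (intro integrable_mult_right integrable_norm L1_loc_cball[OF f])
    show "AE y in lebesgue. (\<lambda>n. k (u n - y) * f y) \<longlonglongrightarrow> k (a - y) * f y"
      by (intro AE_I2 tendsto_mult_right continuous_on_tendsto_compose[OF kc] tendsto_diff u tendsto_const) auto
    show "AE y in lebesgue. norm (k (u n - y) * f y) \<le> B * norm (indicator (cball 0 (M + r)) y *\<^sub>R f y)" for n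
      using B kernel_shift_support[OF k, of "u n"] M[of n]
      by (intro AE_I2) (force simp: abs_mult indicator_def intro!: mult_right_mono)
  qed (auto intro: conv_measurable_integrand[OF k f])
qed

text \<open>The derivative falls on the kernel. By the mean value bound the difference quotients of
  \<open>k\<close> never exceed the supremum of \<open>k'\<close>, and for a bounded sequence of
  increments they live in one ball, so a multiple of \<open>f\<close> cut off to that ball
  dominates.\<close>

lemma conv_has_partial:
  assumes k: "kernel r k" and k': "kernel r k'" and f: "L1_loc lebesgue f" and p: "has_partial i k k'"
  shows "has_partial i (conv k f) (conv k' f)"
  unfolding has_partial_def DERIV_def
proof
  fix x
  obtain B where B: "B \<ge> 0" "\<And>x. \<bar>k' x\<bar> \<le> B" using kernel_bound[OF k'] by metis
  have "((\<lambda>h. (conv k f (x + h *\<^sub>R axis i 1) - conv k f x) / h) \<longlongrightarrow> conv k' f x) (at 0)"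
    unfolding tendsto_at_iff_sequentially comp_def
  proof (intro allI impI)
    fix X :: "nat \<Rightarrow> real" assume X0: "\<forall>n. X n \<in> UNIV - {0}" and X: "X \<longlonglongrightarrow> 0"
    have "Bseq X" using X by (meson convergentI convergent_imp_Bseq)
    then obtain M where M: "\<And>n. norm (X n) \<le> M" by (auto simp: Bseq_def)
    define d where "d n y = (k (x + X n *\<^sub>R axis i 1 - y) - k (x - y)) / X n" for n y
    have eq: "(conv k f (x + X n *\<^sub>R axis i 1) - conv k f x) / X n = (\<integral>y. d n y * f y \<partial>lebesgue)" for n
      unfolding conv_def d_def using conv_integrable[OF k f, of "x + X n *\<^sub>R axis i 1"] conv_integrable[OF k f, of x]
      by (simp add: diff_divide_distrib left_diff_distrib)
    have db: "\<bar>d n y\<bar> \<le> B" for n y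
      using has_partial_lipschitz[OF p B(2), of "x - y" "X n"] X0
      by (simp add: d_def algebra_simps divide_le_eq)
    have ds: "d n y = 0" if "norm y > norm x + M + r" for n y
    proof -
      have "norm (x + X n *\<^sub>R axis i 1) \<le> norm x + M"
        using norm_triangle_ineq[of x "X n *\<^sub>R axis i 1"] M[of n] by (simp add: norm_axis_1)
      moreover have "0 \<le> M" using M[of n] by (meson norm_ge_zero order_trans)
      ultimately show ?thesis using that
        by (simp add: d_def kernel_shift_support[OF k])
    qed
    have "(\<lambda>n. \<integral>y. d n y * f y \<partial>lebesgue) \<longlonglongrightarrow> (\<integral>y. k' (x - y) * f y \<partial>lebesgue)"
    proof (rule integral_dominated_convergence)
      show "integrable lebesgue (\<lambda>y. B * norm (indicator (cball 0 (norm x + M + r)) y *\<^sub>R f y))"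
        by (intro integrable_mult_right integrable_norm L1_loc_cball[OF f])
      show "AE y in lebesgue. (\<lambda>n. d n y * f y) \<longlonglongrightarrow> k' (x - y) * f y"
      proof (intro AE_I2 tendsto_mult_right)
        fix y
        have "((\<lambda>t. (k (x - y + t *\<^sub>R axis i 1) - k (x - y)) / t) \<longlongrightarrow> k' (x - y)) (at 0)"
          using p by (simp add: has_partial_def DERIV_def)
        moreover have "filterlim X (at 0) sequentially"
          using X X0 by (auto simp: filterlim_at)
        ultimately have "(\<lambda>n. (k (x - y + X n *\<^sub>R axis i 1) - k (x - y)) / X n) \<longlonglongrightarrow> k' (x - y)"
          by (rule filterlim_compose)
        then show "(\<lambda>n. d n y) \<longlonglongrightarrow> k' (x - y)" by (simp add: d_def algebra_simps)
      qed
      show "AE y in lebesgue. norm (d n y * f y) \<le> B * norm (indicator (cball 0 (norm x + M + r)) y *\<^sub>R f y)" for n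
        using db ds[of _ n]
        by (intro AE_I2) (force simp: abs_mult indicator_def not_le intro!: mult_right_mono)
      show "(\<lambda>y. d n y * f y) \<in> borel_measurable lebesgue" for n unfolding d_def
        by (intro borel_measurable_times borel_measurable_divide borel_measurable_diff
            kernel_shift_measurable[OF k] L1_loc_measurable[OF f] borel_measurable_const)
    qed (auto intro: conv_measurable_integrand[OF k' f])
    then show "(\<lambda>n. (conv k f (x + X n *\<^sub>R axis i 1) - conv k f x) / X n) \<longlonglongrightarrow> conv k' f x"
      unfolding eq by (simp add: conv_def)
  qed
  then show "((\<lambda>h. (conv k f (x + (0 + h) *\<^sub>R axis i 1) - conv k f (x + 0 *\<^sub>R axis i 1)) / h) \<longlongrightarrow> conv k' f x) (at 0)"
    by simp
qed

section \<open>Mollifiers of radius \<open>1 / (n + 1)\<close> and unit mass\<close>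

lemma bump_kernel: "r > 0 \<Longrightarrow> kernel r (bump r)"
  using elem_smooth_Ck[OF elem_smooth_bump0, of 0] by (simp add: kernel_def bump_eq_0)

lemma bump_integral_pos:
  assumes "r > 0"
  shows "integral\<^sup>L lebesgue (bump r :: real ^ 'n \<Rightarrow> real) > 0"
proof (rule ccontr)
  let ?b = "bump r :: real ^ 'n \<Rightarrow> real"
  have i: "integrable lebesgue ?b"
    using bump_kernel[OF assms] by (intro integrable_continuous_support[where R = r]) (auto simp: kernel_def)
  assume "\<not> integral\<^sup>L lebesgue ?b > 0"
  moreover have "integral\<^sup>L lebesgue ?b \<ge> 0" by (simp add: bump_nonneg)
  ultimately have "integral\<^sup>L lebesgue ?b = 0" by linarith
  then have "AE x in lebesgue. ?b x = 0"
    using integral_nonneg_eq_0_iff_AE[OF i] by (simp add: bump_nonneg)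
  then have "AE x in lebesgue. x \<notin> (ball 0 r :: (real ^ 'n) set)"
    by (rule AE_mp) (auto intro!: AE_I2 dest: bump_pos[OF assms])
  then have "ball 0 r \<in> null_sets (lebesgue :: (real ^ 'n) measure)" by (subst AE_iff_null_sets) auto
  then have "negligible (ball 0 r :: (real ^ 'n) set)" by (simp add: negligible_iff_null_sets)
  moreover have "\<not> negligible (ball 0 r :: (real ^ 'n) set)"
    using assms by (intro open_not_negligible) auto
  ultimately show False by simp
qed

definition mollifier :: "nat \<Rightarrow> real ^ 'n \<Rightarrow> real" where
  "mollifier n x = bump (1 / (real n + 1)) x / integral\<^sup>L lebesgue (bump (1 / (real n + 1)) :: real ^ 'n \<Rightarrow> real)"

definition moll :: "nat \<Rightarrow> (real ^ 'n \<Rightarrow> real) \<Rightarrow> real ^ 'n \<Rightarrow> real" where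
  "moll n = conv (mollifier n)"

lemma mollifier_nonneg: "mollifier n x \<ge> 0"
  by (simp add: mollifier_def bump_nonneg)

lemma mollifier_minus: "mollifier n (- x) = mollifier n x"
  by (simp add: mollifier_def bump_def)

lemma mollifier_kernel: "kernel (1 / (real n + 1)) (mollifier n)"
  using bump_kernel[of "1 / (real n + 1)"] unfolding kernel_def mollifier_def
  by (auto intro!: continuous_intros simp: bump_integral_pos less_imp_neq[symmetric])

lemma mollifier_continuous: "continuous_on UNIV (mollifier n)"
  using mollifier_kernel kernel_def by blast

lemma mollifier_integral:
  fixes x :: "real ^ 'n"
  shows "(\<integral>y. mollifier n (x - y) \<partial>lebesgue) = 1"
proof -
  have m: "mollifier n (x - y) = mollifier n (y + (- x))" for y
    using mollifier_minus[of n "x - y"] by simp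
  have "(\<integral>y. mollifier n (x - y) \<partial>lebesgue) = integral\<^sup>L lebesgue (mollifier n :: real ^ 'n \<Rightarrow> real)"
    unfolding m by (rule integral_translate[OF mollifier_continuous])
  also have "\<dots> = 1"
    using bump_integral_pos[of "1 / (real n + 1)", where 'n = 'n] by (simp add: mollifier_def[abs_def])
  finally show ?thesis .
qed

lemma mollifier_Cc_infinity:
  fixes x :: "real ^ 'n"
  shows "(\<lambda>y. mollifier n (x - y)) \<in> Cc_infinity"
proof -
  let ?r = "1 / (real n + 1)"
  let ?c = "1 / integral\<^sup>L lebesgue (bump ?r :: real ^ 'n \<Rightarrow> real)"
  have "elem_smooth (\<lambda>y. bump ?r (x - y) * ?c)" by (intro elem_smooth.intros elem_smooth_bump)
  moreover have "(\<lambda>y. mollifier n (x - y)) = (\<lambda>y. bump ?r (x - y) * ?c)" by (simp add: mollifier_def fun_eq_iff)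
  ultimately have "Ck k (\<lambda>y. mollifier n (x - y))" for k by (simp add: elem_smooth_Ck)
  moreover have "compact (closure {y. mollifier n (x - y) \<noteq> 0})"
    by (rule compact_support_ball[where R = "norm x + ?r"]) (rule kernel_shift_support[OF mollifier_kernel])
  ultimately show ?thesis by (simp add: Cc_infinity_def del: compact_closure)
qed

lemma moll_abs_le:
  assumes "L1_loc lebesgue f" "L1_loc lebesgue g" "\<And>x. \<bar>f x\<bar> \<le> g x"
  shows "\<bar>moll n f x\<bar> \<le> moll n g x"
  unfolding moll_def conv_def
proof (rule order_trans[OF integral_abs_bound integral_mono])
  show "integrable lebesgue (\<lambda>y. \<bar>mollifier n (x - y) * f y\<bar>)"
    using conv_integrable[OF mollifier_kernel assms(1)] by (rule integrable_abs)
  show "integrable lebesgue (\<lambda>y. mollifier n (x - y) * g y)"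
    by (rule conv_integrable[OF mollifier_kernel assms(2)])
  show "\<bar>mollifier n (x - y) * f y\<bar> \<le> mollifier n (x - y) * g y" for y
    by (simp add: abs_mult mollifier_nonneg assms(3) mult_left_mono)
qed

lemma moll_nonneg: "(\<And>x. f x \<ge> 0) \<Longrightarrow> moll n f x \<ge> 0"
  unfolding moll_def conv_def by (simp add: mollifier_nonneg)

lemma moll_const: "moll n (\<lambda>_. c) x = c"
  by (simp add: moll_def conv_def mollifier_integral)

lemma discriminant_le:
  assumes "\<And>t. A * t\<^sup>2 + 2 * P * t + B \<ge> (0 :: real)" "A \<ge> 0"
  shows "P\<^sup>2 \<le> A * B"
proof (cases "A = 0")
  case True
  have "P = 0"
  proof (rule ccontr)
    assume "P \<noteq> 0"
    \<comment> \<open>At this point the affine function \<open>2 * P * t + B\<close> has the value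
      -1.\<close>
    then show False using assms(1)[of "- (B + 1) / (2 * P)"] True by simp
  qed
  then show ?thesis using True by simp
next
  case False
  then have "A > 0" using assms(2) by simp
  then have "A * (A * (- P / A)\<^sup>2 + 2 * P * (- P / A) + B) \<ge> 0" using assms(1)[of "- P / A"] by simp
  then show ?thesis using \<open>A > 0\<close> by (simp add: power2_eq_square field_simps)
qed

text \<open>The mollification of \<open>(t * f + g)\<^sup>2\<close> is a quadratic polynomial in
  \<open>t\<close> without negative values, because the mollifier is nonnegative. For
  \<open>g = 1\<close> the unit mass turns this into Jensen's inequality: the square of a
  mollification is at most the mollification of the square.\<close>

lemma moll_Cauchy_Schwarz:
  assumes f: "L1_loc lebesgue (\<lambda>x. (f x)\<^sup>2)" and g: "L1_loc lebesgue (\<lambda>x. (g x)\<^sup>2)" and fg: "L1_loc lebesgue (\<lambda>x. f x * g x)"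
  shows "(moll n (\<lambda>x. f x * g x) x)\<^sup>2 \<le> moll n (\<lambda>x. (f x)\<^sup>2) x * moll n (\<lambda>x. (g x)\<^sup>2) x"
proof (rule discriminant_le)
  fix t
  note i = conv_integrable[OF mollifier_kernel f] conv_integrable[OF mollifier_kernel g] conv_integrable[OF mollifier_kernel fg]
  have "0 \<le> (\<integral>y. mollifier n (x - y) * (t * f y + g y)\<^sup>2 \<partial>lebesgue)"
    by (simp add: mollifier_nonneg)
  also have "\<dots> = (\<integral>y. t\<^sup>2 * (mollifier n (x - y) * (f y)\<^sup>2) + 2 * t * (mollifier n (x - y) * (f y * g y))
      + mollifier n (x - y) * (g y)\<^sup>2 \<partial>lebesgue)"
    by (intro Bochner_Integration.integral_cong) (auto simp: power2_eq_square algebra_simps)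
  also have "\<dots> = moll n (\<lambda>x. (f x)\<^sup>2) x * t\<^sup>2 + 2 * moll n (\<lambda>x. f x * g x) x * t + moll n (\<lambda>x. (g x)\<^sup>2) x"
    unfolding moll_def conv_def using i by simp
  finally show "0 \<le> \<dots>" .
qed (simp add: moll_nonneg)

lemma L1_loc_integrable:
  fixes f :: "real ^ 'n \<Rightarrow> 'b :: euclidean_space"
  shows "integrable lebesgue f \<Longrightarrow> L1_loc lebesgue f"
  by (intro L1_locI integrable_mult_indicator) auto

text \<open>Young's inequality for a kernel of unit mass, by Tonelli applied to
  \<open>mollifier n (x - y) * \<bar>h y\<bar>\<close>.\<close>

lemma moll_L1_le:
  fixes g :: "real ^ 'n \<Rightarrow> real"
  assumes g: "integrable lebesgue g"
  shows "integrable lebesgue (moll n g)" "(\<integral>x. \<bar>moll n g x\<bar> \<partial>lebesgue) \<le> (\<integral>x. \<bar>g x\<bar> \<partial>lebesgue)"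
proof -
  \<comment> \<open>Tonelli on \<open>lborel\<close> needs a Borel integrand, hence a Borel
    representative; the convolution does not see the null set on which it differs from
    \<open>g\<close>.\<close>
  obtain h where h[measurable]: "h \<in> borel_measurable lborel" and "AE x in lborel. g x = h x"
    using completion_ex_borel_measurable_real[OF borel_measurable_integrable[OF g]] by blast
  then have ae: "AE x in lebesgue. g x = h x" by (auto intro: AE_completion)
  have hL: "h \<in> borel_measurable lebesgue" using h by (rule measurable_completion)
  have hi: "integrable lebesgue h" using integrable_cong_AE[OF _ hL ae] g by auto
  note Lh = L1_loc_integrable[OF hi]
  have eq: "moll n g = moll n h" unfolding moll_def
    by (rule conv_cong_AE[OF mollifier_kernel borel_measurable_integrable[OF g] hL ae])
  have [measurable]: "mollifier n \<in> borel_measurable (borel :: (real ^ 'n) measure)"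
    by (intro borel_measurable_continuous_onI mollifier_continuous)
  have m1: "(\<integral>\<^sup>+x. ennreal (mollifier n (x - y)) \<partial>lborel) = 1" for y :: "real ^ 'n"
  proof -
    have "(\<integral>\<^sup>+x. ennreal (mollifier n (x - y)) \<partial>lborel) = (\<integral>\<^sup>+x. ennreal (mollifier n (y - x) * 1) \<partial>lebesgue)"
      using mollifier_minus[of n "y - _"] by (simp add: nn_integral_completion)
    also have "\<dots> = ennreal (\<integral>x. mollifier n (y - x) * 1 \<partial>lebesgue)"
      by (intro nn_integral_eq_integral conv_integrable[OF mollifier_kernel] L1_loc_continuous) (auto simp: mollifier_nonneg)
    finally show ?thesis by (simp add: mollifier_integral)
  qed
  have "(\<integral>\<^sup>+x. ennreal \<bar>moll n h x\<bar> \<partial>lebesgue) = (\<integral>\<^sup>+x. ennreal \<bar>moll n h x\<bar> \<partial>lborel)"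
    by (rule nn_integral_completion)
  also have "\<dots> \<le> (\<integral>\<^sup>+x. (\<integral>\<^sup>+y. ennreal (mollifier n (x - y)) * ennreal \<bar>h y\<bar> \<partial>lborel) \<partial>lborel)"
  proof (rule nn_integral_mono)
    fix x
    have "ennreal \<bar>moll n h x\<bar> \<le> (\<integral>\<^sup>+y. norm (mollifier n (x - y) * h y) \<partial>lebesgue)"
      unfolding moll_def conv_def real_norm_def[symmetric]
      by (rule integral_norm_bound_ennreal) (rule conv_integrable[OF mollifier_kernel Lh])
    then show "ennreal \<bar>moll n h x\<bar> \<le> (\<integral>\<^sup>+y. ennreal (mollifier n (x - y)) * ennreal \<bar>h y\<bar> \<partial>lborel)"
      by (simp add: nn_integral_completion abs_mult mollifier_nonneg ennreal_mult)
  qed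
  also have "\<dots> = (\<integral>\<^sup>+y. (\<integral>\<^sup>+x. ennreal (mollifier n (x - y)) * ennreal \<bar>h y\<bar> \<partial>lborel) \<partial>lborel)"
    by (intro lborel_pair.Fubini'[symmetric]) measurable
  also have "\<dots> = (\<integral>\<^sup>+y. ennreal \<bar>h y\<bar> \<partial>lborel)"
    by (simp add: nn_integral_multc m1)
  also have "\<dots> = (\<integral>\<^sup>+y. ennreal \<bar>h y\<bar> \<partial>lebesgue)" by (rule nn_integral_completion[symmetric])
  also have "\<dots> = ennreal (\<integral>y. \<bar>h y\<bar> \<partial>lebesgue)"
    using hi by (intro nn_integral_eq_integral) auto
  finally have *: "(\<integral>\<^sup>+x. ennreal \<bar>moll n h x\<bar> \<partial>lebesgue) \<le> ennreal (\<integral>y. \<bar>h y\<bar> \<partial>lebesgue)" .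
  have "continuous_on UNIV (moll n h)" unfolding moll_def by (rule conv_continuous[OF mollifier_kernel Lh])
  then have int: "integrable lebesgue (moll n h)"
    using * by (intro integrableI_bounded borel_measurable_lebesgue_continuous)
      (auto simp: le_less_trans ennreal_less_top)
  then show "integrable lebesgue (moll n g)" by (simp add: eq)
  have "ennreal (\<integral>x. \<bar>moll n h x\<bar> \<partial>lebesgue) \<le> ennreal (\<integral>y. \<bar>h y\<bar> \<partial>lebesgue)"
    using * int by (subst nn_integral_eq_integral[symmetric]) auto
  then have "(\<integral>x. \<bar>moll n h x\<bar> \<partial>lebesgue) \<le> (\<integral>y. \<bar>h y\<bar> \<partial>lebesgue)"
    by (subst (asm) ennreal_le_iff) auto
  also have "\<dots> = (\<integral>y. \<bar>g y\<bar> \<partial>lebesgue)"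
    using ae hL g by (intro integral_cong_AE) auto
  finally show "(\<integral>x. \<bar>moll n g x\<bar> \<partial>lebesgue) \<le> (\<integral>x. \<bar>g x\<bar> \<partial>lebesgue)" by (simp add: eq)
qed

text \<open>\<open>measurable_on\<close> supplies continuous functions converging to
  \<open>f\<close> off a negligible set. Clamping their values to the interval from
  \<open>- M\<close> to \<open>M\<close> and multiplying by a cutoff that is 1 on the ball of radius
  \<open>M\<close> puts them below one integrable bound, so that pointwise convergence becomes
  convergence of integrals.\<close>

lemma L1_approx_bounded:
  fixes f :: "real ^ 'n \<Rightarrow> real"
  assumes m: "f \<in> borel_measurable lebesgue" and b: "\<And>x. \<bar>f x\<bar> \<le> M" and s: "\<And>x. norm x > M \<Longrightarrow> f x = 0" and e: "e > 0"
  shows "\<exists>h R. continuous_on UNIV h \<and> (\<forall>x. norm x > R \<longrightarrow> h x = 0) \<and> (\<integral>x. \<bar>f x - h x\<bar> \<partial>lebesgue) < e"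
proof -
  have "f measurable_on UNIV"
    using m by (intro lebesgue_measurable_imp_measurable_on) auto
  then obtain N g where N: "negligible N" and g: "\<And>n. continuous_on UNIV (g n)"
    and lim: "\<And>x. x \<notin> N \<Longrightarrow> (\<lambda>n. g n x) \<longlonglongrightarrow> f x" by (auto simp: measurable_on_def)
  define k where "k x = max 0 (min 1 (M + 1 - norm x))" for x :: "real ^ 'n"
  define h where "h n x = max (- M) (min M (g n x)) * k x" for n x
  have M: "M \<ge> 0" using b[of 0] by linarith
  have hc: "continuous_on UNIV (h n)" for n unfolding h_def k_def by (intro continuous_intros g)
  have k: "0 \<le> k x" "k x \<le> 1" "norm x > M + 1 \<Longrightarrow> k x = 0" "norm x \<le> M \<Longrightarrow> k x = 1" for x
    by (auto simp: k_def)
  have hb: "\<bar>h n x\<bar> \<le> M * indicator (cball 0 (M + 1)) x" for n x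
  proof (cases "norm x \<le> M + 1")
    case True
    have "\<bar>max (- M) (min M (g n x))\<bar> * \<bar>k x\<bar> \<le> M * 1" using k M by (intro mult_mono) auto
    then show ?thesis using True by (simp add: h_def abs_mult)
  qed (use k(3)[of x] in \<open>auto simp: h_def\<close>)
  have ml: "h n \<in> borel_measurable lebesgue" for n using hc by (rule borel_measurable_lebesgue_continuous)
  have "(\<lambda>n. \<integral>x. \<bar>f x - h n x\<bar> \<partial>lebesgue) \<longlonglongrightarrow> (\<integral>x. 0 \<partial>(lebesgue :: (real ^ 'n) measure))"
  proof (rule integral_dominated_convergence)
    show "integrable lebesgue (\<lambda>x :: real ^ 'n. 2 * M * indicator (cball 0 (M + 1)) x)"
      using L1_loc_cball[OF L1_loc_continuous, of "\<lambda>x :: real ^ 'n. 2 * M" "M + 1"]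
      by (simp add: mult.commute)
    have "AE x in lebesgue. x \<notin> N"
      using N by (auto simp: negligible_iff_null_sets intro: AE_not_in)
    then show "AE x in lebesgue. (\<lambda>n. \<bar>f x - h n x\<bar>) \<longlonglongrightarrow> 0"
    proof eventually_elim
      case (elim x)
      have "(\<lambda>n. \<bar>f x - h n x\<bar>) \<longlonglongrightarrow> \<bar>f x - max (- M) (min M (f x)) * k x\<bar>"
        unfolding h_def by (intro tendsto_intros lim elim)
      moreover have "max (- M) (min M (f x)) * k x = f x"
        using b[of x] k(4)[of x] s[of x] M by (cases "norm x \<le> M") auto
      ultimately show ?case by simp
    qed
    show "AE x in lebesgue. norm \<bar>f x - h n x\<bar> \<le> 2 * M * indicator (cball 0 (M + 1)) x" for n
    proof (rule AE_I2)
      fix x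
      have "\<bar>f x\<bar> \<le> M * indicator (cball 0 (M + 1)) x" using b[of x] s[of x] by (cases "norm x \<le> M + 1") auto
      then show "norm \<bar>f x - h n x\<bar> \<le> 2 * M * indicator (cball 0 (M + 1)) x" using hb[of n x] by auto
    qed
  qed (use m ml in auto)
  then have "\<forall>\<^sub>F n in sequentially. (\<integral>x. \<bar>f x - h n x\<bar> \<partial>lebesgue) < e"
    using e by (intro order_tendstoD) auto
  then obtain n where "(\<integral>x. \<bar>f x - h n x\<bar> \<partial>lebesgue) < e" by (auto simp: eventually_sequentially)
  moreover have "h n x = 0" if "norm x > M + 1" for x using k(3)[OF that] by (simp add: h_def)
  ultimately show ?thesis using hc by blast
qed

text \<open>Truncating values and support at the same level \<open>n\<close> reduces to the bounded
  case.\<close>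

lemma L1_approx:
  fixes f :: "real ^ 'n \<Rightarrow> real"
  assumes f: "integrable lebesgue f" and e: "e > 0"
  shows "\<exists>h R. continuous_on UNIV h \<and> (\<forall>x. norm x > R \<longrightarrow> h x = 0) \<and> (\<integral>x. \<bar>f x - h x\<bar> \<partial>lebesgue) < e"
proof -
  define F where "F n x = indicator (cball 0 (real n)) x * max (- real n) (min (real n) (f x))" for n x
  have fm: "f \<in> borel_measurable lebesgue" using f by auto
  have Fm: "F n \<in> borel_measurable lebesgue" for n unfolding F_def
    by (intro borel_measurable_times borel_measurable_max borel_measurable_min borel_measurable_const fm borel_measurable_indicator) auto
  have Fb: "\<bar>F n x\<bar> \<le> \<bar>f x\<bar>" for n x by (auto simp: F_def indicator_def)
  have Fi: "integrable lebesgue (F n)" for n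
    by (rule Bochner_Integration.integrable_bound[OF f Fm]) (use Fb in auto)
  have "(\<lambda>n. \<integral>x. \<bar>f x - F n x\<bar> \<partial>lebesgue) \<longlonglongrightarrow> (\<integral>x. 0 \<partial>(lebesgue :: (real ^ 'n) measure))"
  proof (rule integral_dominated_convergence)
    show "integrable lebesgue (\<lambda>x. 2 * \<bar>f x\<bar>)" using f by auto
    show "AE x in lebesgue. (\<lambda>n. \<bar>f x - F n x\<bar>) \<longlonglongrightarrow> 0"
    proof (intro AE_I2 tendsto_eventually)
      fix x
      obtain m :: nat where m: "norm x \<le> m" "\<bar>f x\<bar> \<le> m"
        using real_arch_simple[of "max (norm x) \<bar>f x\<bar>"] by auto
      have "\<bar>f x - F n x\<bar> = 0" if "n \<ge> m" for n
      proof -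
        have "real m \<le> real n" using that by simp
        then have "norm x \<le> n" "\<bar>f x\<bar> \<le> n" using m by linarith+
        then show ?thesis by (auto simp: F_def)
      qed
      then show "\<forall>\<^sub>F n in sequentially. \<bar>f x - F n x\<bar> = 0" by (auto simp: eventually_sequentially)
    qed
    show "AE x in lebesgue. norm \<bar>f x - F n x\<bar> \<le> 2 * \<bar>f x\<bar>" for n
      using Fb by (intro AE_I2) (smt (verit) real_norm_def)
  qed (use Fm fm in auto)
  then have "\<forall>\<^sub>F n in sequentially. (\<integral>x. \<bar>f x - F n x\<bar> \<partial>lebesgue) < e / 2"
    using e by (intro order_tendstoD) auto
  then obtain n where n: "(\<integral>x. \<bar>f x - F n x\<bar> \<partial>lebesgue) < e / 2" by (auto simp: eventually_sequentially)
  obtain h R where h: "continuous_on UNIV h" "\<forall>x. norm x > R \<longrightarrow> h x = 0" "(\<integral>x. \<bar>F n x - h x\<bar> \<partial>lebesgue) < e / 2"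
  proof -
    have "\<exists>h R. continuous_on UNIV h \<and> (\<forall>x. norm x > R \<longrightarrow> h x = 0) \<and> (\<integral>x. \<bar>F n x - h x\<bar> \<partial>lebesgue) < e / 2"
      by (rule L1_approx_bounded[OF Fm, where M = "real n"]) (use e in \<open>auto simp: F_def indicator_def\<close>)
    then show thesis using that by blast
  qed
  have hi: "integrable lebesgue h" by (rule integrable_continuous_support[OF h(1)]) (use h(2) in auto)
  have "(\<integral>x. \<bar>f x - h x\<bar> \<partial>lebesgue) \<le> (\<integral>x. \<bar>f x - F n x\<bar> + \<bar>F n x - h x\<bar> \<partial>lebesgue)"
    using f Fi hi by (intro integral_mono) auto
  also have "\<dots> = (\<integral>x. \<bar>f x - F n x\<bar> \<partial>lebesgue) + (\<integral>x. \<bar>F n x - h x\<bar> \<partial>lebesgue)"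
    using f Fi hi by (intro Bochner_Integration.integral_add) auto
  finally show ?thesis using n h by (intro exI[of _ h] exI[of _ R]) auto
qed

lemma moll_tendsto_continuous:
  fixes h :: "real ^ 'n \<Rightarrow> real"
  assumes h: "continuous_on UNIV h"
  shows "(\<lambda>n. moll n h x) \<longlonglongrightarrow> h x"
proof (rule LIMSEQ_I)
  fix e :: real assume "e > 0"
  then obtain d where d: "d > 0" "\<And>y. dist y x < d \<Longrightarrow> dist (h y) (h x) < e / 2"
    using h unfolding continuous_on_iff by (meson UNIV_I half_gt_zero)
  obtain N where N: "1 / (real N + 1) < d"
    using nat_approx_posE[OF d(1)] by (metis of_nat_Suc add.commute)
  note Lh = L1_loc_continuous[OF h]
  have "\<bar>moll n h x - h x\<bar> \<le> e / 2" if "n \<ge> N" for n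
  proof -
    have "1 / (real n + 1) \<le> 1 / (real N + 1)" using that by (intro divide_left_mono) auto
    then have nd: "1 / (real n + 1) < d" using N by simp
    have i1: "integrable lebesgue (\<lambda>y. mollifier n (x - y) * c)" for c
      by (intro conv_integrable[OF mollifier_kernel] L1_loc_continuous) auto
    have "moll n h x - h x = moll n (\<lambda>y. h y - h x) x"
      using conv_diff[OF mollifier_kernel Lh L1_loc_continuous, of "\<lambda>_. h x" n x] moll_const[of n "h x" x]
      by (simp add: moll_def)
    also have "\<bar>\<dots>\<bar> \<le> (\<integral>y. mollifier n (x - y) * (e / 2) \<partial>lebesgue)"
      unfolding moll_def conv_def
    proof (rule order_trans[OF integral_abs_bound integral_mono])
      show "integrable lebesgue (\<lambda>y. \<bar>mollifier n (x - y) * (h y - h x)\<bar>)"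
        by (intro integrable_abs conv_integrable[OF mollifier_kernel] L1_loc_continuous continuous_intros h)
      show "\<bar>mollifier n (x - y) * (h y - h x)\<bar> \<le> mollifier n (x - y) * (e / 2)" for y
      proof (cases "norm (x - y) > 1 / (real n + 1)")
        case True
        then have "mollifier n (x - y) = 0" using mollifier_kernel kernel_def by blast
        then show ?thesis by simp
      next
        case False
        then have "\<bar>h y - h x\<bar> < e / 2" using d(2)[of y] nd by (auto simp: dist_norm norm_minus_commute)
        then show ?thesis unfolding abs_mult abs_of_nonneg[OF mollifier_nonneg]
          by (intro mult_left_mono mollifier_nonneg less_imp_le)
      qed
    qed (rule i1)
    also have "\<dots> = e / 2" using moll_const[of n "e / 2" x] by (simp add: moll_def conv_def)
    finally show ?thesis by simp
  qed
  then show "\<exists>N. \<forall>n\<ge>N. norm (moll n h x - h x) < e" using \<open>e > 0\<close>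
    by (intro exI[of _ N]) force
qed

text \<open>Mollification contracts the L^1 norm, so convergence on a dense class is enough. For
  continuous \<open>h\<close> with compact support it is pointwise convergence below a fixed bound
  on the ball of radius \<open>R + 1\<close>.\<close>

lemma moll_tendsto_L1:
  fixes f :: "real ^ 'n \<Rightarrow> real"
  assumes f: "integrable lebesgue f"
  shows "(\<lambda>n. \<integral>x. \<bar>moll n f x - f x\<bar> \<partial>lebesgue) \<longlonglongrightarrow> 0"
proof (rule LIMSEQ_I)
  fix e :: real assume e: "e > 0"
  obtain h R where h: "continuous_on UNIV h" "\<And>x. norm x > R \<Longrightarrow> h x = 0" "(\<integral>x. \<bar>f x - h x\<bar> \<partial>lebesgue) < e / 3"
    using L1_approx[OF f, of "e / 3"] e by auto
  have hi: "integrable lebesgue h" by (rule integrable_continuous_support[OF h(1,2)])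
  obtain B where B: "B \<ge> 0" "\<And>x. norm x \<le> R \<Longrightarrow> \<bar>h x\<bar> \<le> B" using continuous_cball_bound[OF h(1)] by metis
  then have hB: "\<bar>h x\<bar> \<le> B" for x using h(2)[of x] by (cases "norm x \<le> R") auto
  have mc: "continuous_on UNIV (moll n h)" for n unfolding moll_def
    by (rule conv_continuous[OF mollifier_kernel L1_loc_continuous[OF h(1)]])
  have "(\<lambda>n. \<integral>x. \<bar>moll n h x - h x\<bar> \<partial>lebesgue) \<longlonglongrightarrow> (\<integral>x. 0 \<partial>(lebesgue :: (real ^ 'n) measure))"
  proof (rule integral_dominated_convergence)
    show "integrable lebesgue (\<lambda>x :: real ^ 'n. 2 * B * indicator (cball 0 (R + 1)) x)"
      using L1_loc_cball[OF L1_loc_continuous, of "\<lambda>x :: real ^ 'n. 2 * B" "R + 1"]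
      by (simp add: mult.commute)
    show "AE x in lebesgue. (\<lambda>n. \<bar>moll n h x - h x\<bar>) \<longlonglongrightarrow> 0"
      using moll_tendsto_continuous[OF h(1)] by (intro AE_I2 tendsto_rabs_zero LIM_zero)
    show "AE x in lebesgue. norm \<bar>moll n h x - h x\<bar> \<le> 2 * B * indicator (cball 0 (R + 1)) x" for n
    proof (rule AE_I2)
      fix x
      have "\<bar>moll n h x\<bar> \<le> moll n (\<lambda>_. B) x"
        by (rule moll_abs_le) (auto intro: L1_loc_continuous h(1) hB)
      moreover have "moll n h x = 0" "h x = 0" if "norm x > R + 1"
      proof -
        have "1 / (real n + 1) \<le> 1" by simp
        then have "norm x > R + 1 / (real n + 1)" using that by linarith
        then show "moll n h x = 0" unfolding moll_def
          by (intro conv_support[OF mollifier_kernel h(2)])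
        show "h x = 0" using that h(2) by simp
      qed
      ultimately show "norm \<bar>moll n h x - h x\<bar> \<le> 2 * B * indicator (cball 0 (R + 1)) x"
        using hB[of x] moll_const[of n B x] by (cases "norm x \<le> R + 1") auto
    qed
  qed (use mc h(1) in \<open>auto intro!: borel_measurable_lebesgue_continuous continuous_intros\<close>)
  then have "\<forall>\<^sub>F n in sequentially. (\<integral>x. \<bar>moll n h x - h x\<bar> \<partial>lebesgue) < e / 3"
    using e by (intro order_tendstoD) auto
  then obtain N where N: "\<And>n. n \<ge> N \<Longrightarrow> (\<integral>x. \<bar>moll n h x - h x\<bar> \<partial>lebesgue) < e / 3"
    by (auto simp: eventually_sequentially)
  have "(\<integral>x. \<bar>moll n f x - f x\<bar> \<partial>lebesgue) < e" if "n \<ge> N" for n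
  proof -
    have fh: "integrable lebesgue (\<lambda>x. f x - h x)" using f hi by auto
    note m = moll_L1_le(1)[OF f, of n] moll_L1_le(1)[OF hi, of n] moll_L1_le(1)[OF fh, of n]
    have d: "moll n (\<lambda>x. f x - h x) x = moll n f x - moll n h x" for x
      unfolding moll_def by (intro conv_diff[OF mollifier_kernel] L1_loc_integrable f hi)
    have "(\<integral>x. \<bar>moll n f x - f x\<bar> \<partial>lebesgue) \<le>
        (\<integral>x. \<bar>moll n (\<lambda>x. f x - h x) x\<bar> + \<bar>moll n h x - h x\<bar> + \<bar>f x - h x\<bar> \<partial>lebesgue)"
      using f hi m fh by (intro integral_mono) (auto simp: d)
    also have "\<dots> = (\<integral>x. \<bar>moll n (\<lambda>x. f x - h x) x\<bar> \<partial>lebesgue) + (\<integral>x. \<bar>moll n h x - h x\<bar> \<partial>lebesgue)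
        + (\<integral>x. \<bar>f x - h x\<bar> \<partial>lebesgue)"
      using f hi m fh by simp
    also have "\<dots> < e" using N[OF that] h(3) moll_L1_le(2)[OF fh, of n] by linarith
    finally show ?thesis .
  qed
  then show "\<exists>N. \<forall>n\<ge>N. norm ((\<integral>x. \<bar>moll n f x - f x\<bar> \<partial>lebesgue) - 0) < e"
    by (intro exI[of _ N]) auto
qed

section \<open>Dominated convergence of mollifications\<close>

text \<open>The hypotheses of dominated convergence on a ball, bundled. Unlike convergence in L^1,
  this mode is stable under continuous functions, bounded convergent factors and comparison, which
  is how nonlinear expressions in mollifications are treated.\<close>

definition dom_lim :: "real \<Rightarrow> (nat \<Rightarrow> real ^ 'n \<Rightarrow> real) \<Rightarrow> (real ^ 'n \<Rightarrow> real) \<Rightarrow> bool" where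
  "dom_lim R F f \<longleftrightarrow> (AE x in lebesgue. norm x \<le> R \<longrightarrow> (\<lambda>n. F n x) \<longlonglongrightarrow> f x) \<and>
     (\<exists>G. L1_loc lebesgue G \<and> (AE x in lebesgue. \<forall>n. norm x \<le> R \<longrightarrow> \<bar>F n x\<bar> \<le> G x))"

lemma L1_loc_add:
  fixes f g :: "real ^ 'n \<Rightarrow> 'b :: euclidean_space"
  assumes "L1_loc lebesgue f" "L1_loc lebesgue g"
  shows "L1_loc lebesgue (\<lambda>x. f x + g x)"
  by (rule L1_locI) (auto simp: scaleR_right_distrib intro!: integrable_add L1_loc_cball assms)

lemma L1_loc_cmult:
  fixes f :: "real ^ 'n \<Rightarrow> real"
  assumes "L1_loc lebesgue f"
  shows "L1_loc lebesgue (\<lambda>x. c * f x)"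
proof (rule L1_locI)
  fix R :: real assume "R > 0"
  have "integrable lebesgue (\<lambda>x. c * (indicator (cball 0 R) x *\<^sub>R f x))"
    by (intro integrable_mult_right L1_loc_cball assms)
  then show "integrable lebesgue (\<lambda>x. indicator (cball 0 R) x *\<^sub>R (c * f x))" by (simp add: mult_ac)
qed

lemma L1_loc_abs:
  fixes f :: "real ^ 'n \<Rightarrow> real"
  assumes "L1_loc lebesgue f"
  shows "L1_loc lebesgue (\<lambda>x. \<bar>f x\<bar>)"
  by (rule L1_loc_bound[OF assms]) (auto intro: borel_measurable_abs L1_loc_measurable assms)

lemma borel_measurable_vecI:
  fixes g :: "'a \<Rightarrow> real ^ 'm"
  assumes "\<And>i. (\<lambda>x. g x $ i) \<in> borel_measurable M"
  shows "g \<in> borel_measurable M"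
proof (rule borel_measurable_euclidean_space[THEN iffD2], rule ballI)
  fix b :: "real ^ 'm" assume "b \<in> Basis"
  then obtain i where "b = axis i 1" by (auto simp: Basis_vec_def)
  then show "(\<lambda>x. g x \<bullet> b) \<in> borel_measurable M" using assms by (simp add: inner_axis)
qed

lemma borel_measurable_nth:
  fixes g :: "'a \<Rightarrow> real ^ 'm"
  assumes "g \<in> borel_measurable M"
  shows "(\<lambda>x. g x $ i) \<in> borel_measurable M"
  using assms by (rule measurable_compose) (intro borel_measurable_continuous_onI continuous_intros)

lemma L1_loc_nth:
  fixes g :: "real ^ 'n \<Rightarrow> real ^ 'm"
  assumes "L1_loc lebesgue g"
  shows "L1_loc lebesgue (\<lambda>x. g x $ i)"
proof (rule L1_loc_bound[OF assms])
  show "(\<lambda>x. g x $ i) \<in> borel_measurable lebesgue"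
    by (intro borel_measurable_nth L1_loc_measurable assms)
  show "AE x in lebesgue. norm (g x $ i) \<le> norm (g x)"
    by (intro AE_I2) (simp add: component_le_norm_cart)
qed

lemma L1_loc_vecI:
  fixes g :: "real ^ 'n \<Rightarrow> real ^ 'm"
  assumes "\<And>i. L1_loc lebesgue (\<lambda>x. g x $ i)"
  shows "L1_loc lebesgue g"
proof (rule L1_loc_bound)
  have "L1_loc lebesgue (\<lambda>x. \<Sum>i\<in>I. \<bar>g x $ i\<bar>)" if "finite I" for I
    using that
  proof (induction I rule: finite_induct)
    case empty
    show ?case by (simp add: L1_loc_continuous)
  next
    case (insert i I)
    then show ?case by (simp add: L1_loc_add L1_loc_abs assms)
  qed
  then show "L1_loc lebesgue (\<lambda>x. \<Sum>i\<in>UNIV. \<bar>g x $ i\<bar>)" by simp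
  show "g \<in> borel_measurable lebesgue" by (intro borel_measurable_vecI L1_loc_measurable assms)
  show "AE x in lebesgue. norm (g x) \<le> norm (\<Sum>i\<in>UNIV. \<bar>g x $ i\<bar>)"
    by (intro AE_I2) (simp add: norm_le_l1_cart sum_nonneg)
qed

text \<open>The indices \<open>r n\<close> are chosen so that the L^1 errors sum to less than
  \<open>(1/2) ^ n\<close>. The series of the errors is then integrable and almost everywhere
  finite, which gives pointwise convergence and, added to \<open>\<bar>f\<bar>\<close>, the
  majorant. Finitely many functions are handled at once because products and comparisons need a
  common choice of indices.\<close>

lemma moll_approx:
  fixes F :: "(real ^ 'n \<Rightarrow> real) set"
  assumes F: "finite F" and L: "\<And>f. f \<in> F \<Longrightarrow> L1_loc lebesgue f"
  shows "\<exists>r :: nat \<Rightarrow> nat. \<forall>f\<in>F. dom_lim R (\<lambda>n. moll (r n) f) f"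
proof -
  \<comment> \<open>A mollification of radius at most 1, evaluated in the ball of radius
    \<open>R\<close>, sees only the ball of radius \<open>R + 1\<close>; the function cut off there
    is integrable on the whole space.\<close>
  define c where "c f x = indicator (cball 0 (R + 1)) x *\<^sub>R f x" for f :: "real ^ 'n \<Rightarrow> real" and x
  have ci: "integrable lebesgue (c f)" if "f \<in> F" for f
    unfolding c_def by (rule L1_loc_cball[OF L[OF that]])
  have "(\<lambda>n. \<Sum>f\<in>F. \<integral>x. \<bar>moll n (c f) x - c f x\<bar> \<partial>lebesgue) \<longlonglongrightarrow> (\<Sum>f\<in>F. 0)"
    by (intro tendsto_sum moll_tendsto_L1 ci)
  then have "\<exists>m. (\<Sum>f\<in>F. \<integral>x. \<bar>moll m (c f) x - c f x\<bar> \<partial>lebesgue) < (1/2) ^ n" for n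
  proof -
    assume "(\<lambda>n. \<Sum>f\<in>F. \<integral>x. \<bar>moll n (c f) x - c f x\<bar> \<partial>lebesgue) \<longlonglongrightarrow> (\<Sum>f\<in>F. 0)"
    then have "\<forall>\<^sub>F m in sequentially. (\<Sum>f\<in>F. \<integral>x. \<bar>moll m (c f) x - c f x\<bar> \<partial>lebesgue) < (1/2) ^ n"
      by (rule order_tendstoD) simp
    then show ?thesis using eventually_happens trivial_limit_sequentially by blast
  qed
  then have "\<forall>n. \<exists>m. (\<Sum>f\<in>F. \<integral>x. \<bar>moll m (c f) x - c f x\<bar> \<partial>lebesgue) < (1/2) ^ n" by (rule allI)
  from choice[OF this] obtain r
    where r: "\<And>n. (\<Sum>f\<in>F. \<integral>x. \<bar>moll (r n) (c f) x - c f x\<bar> \<partial>lebesgue) < (1/2) ^ n" by blast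
  have "dom_lim R (\<lambda>n. moll (r n) f) f" if f: "f \<in> F" for f
  proof -
    define d where "d n x = \<bar>moll (r n) (c f) x - c f x\<bar>" for n x
    have di: "integrable lebesgue (d n)" for n
      unfolding d_def using ci[OF f] moll_L1_le(1)[OF ci[OF f]] by auto
    have dI: "(\<integral>x. d n x \<partial>lebesgue) \<le> (1/2) ^ n" for n
    proof -
      have "(\<integral>x. d n x \<partial>lebesgue) \<le> (\<Sum>f\<in>F. \<integral>x. \<bar>moll (r n) (c f) x - c f x\<bar> \<partial>lebesgue)"
        unfolding d_def by (rule member_le_sum[OF f _ F]) simp
      then show ?thesis using r[of n] by linarith
    qed
    have d0: "d n x \<ge> 0" for n x by (simp add: d_def)
    have "(\<integral>\<^sup>+x. (\<Sum>n. ennreal (d n x)) \<partial>lebesgue) = (\<Sum>n. \<integral>\<^sup>+x. ennreal (d n x) \<partial>lebesgue)"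
      using di by (intro nn_integral_suminf) auto
    also have "\<dots> = (\<Sum>n. ennreal (\<integral>x. d n x \<partial>lebesgue))"
      using di d0 by (intro suminf_cong nn_integral_eq_integral) auto
    also have "\<dots> \<le> (\<Sum>n. ennreal ((1/2) ^ n))"
      using dI by (intro suminf_le ennreal_leI) auto
    also have "\<dots> = ennreal (\<Sum>n. (1/2) ^ n)"
      by (intro suminf_ennreal2) (auto intro: summable_geometric)
    also have "\<dots> < \<infinity>" by simp
    finally have fin: "(\<integral>\<^sup>+x. (\<Sum>n. ennreal (d n x)) \<partial>lebesgue) \<noteq> \<infinity>" by simp
    have "AE x in lebesgue. (\<Sum>n. ennreal (d n x)) \<noteq> \<infinity>"
      using di by (intro nn_integral_PInf_AE fin) auto
    then have sm: "AE x in lebesgue. summable (\<lambda>n. d n x)"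
      by eventually_elim (auto intro!: summable_suminf_not_top simp: d0)
    have "summable (\<lambda>n. \<integral>x. norm (d n x) \<partial>lebesgue)"
      by (rule summable_comparison_test'[OF summable_geometric[of "1/2 :: real"], of 0])
        (use dI d0 in auto)
    then have si: "integrable lebesgue (\<lambda>x. \<Sum>n. d n x)"
      using sm d0 di by (intro integrable_suminf) auto
    have loc: "moll (r n) f x = moll (r n) (c f) x" if "norm x \<le> R" for n x
      unfolding moll_def
    proof (rule conv_local[OF mollifier_kernel])
      fix y :: "real ^ 'n" assume "norm y \<le> norm x + 1 / (real (r n) + 1)"
      moreover have "1 / (real (r n) + 1) \<le> 1" by simp
      ultimately have "norm y \<le> R + 1" using that by linarith
      then show "f y = c f y" by (simp add: c_def)
    qed
    have cf: "c f x = f x" if "norm x \<le> R" for x using that by (simp add: c_def)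
    show ?thesis unfolding dom_lim_def
    proof (intro conjI exI[of _ "\<lambda>x. \<bar>f x\<bar> + (\<Sum>n. d n x)"])
      show "AE x in lebesgue. norm x \<le> R \<longrightarrow> (\<lambda>n. moll (r n) f x) \<longlonglongrightarrow> f x"
        using sm
      proof eventually_elim
        case (elim x)
        show ?case
        proof
          assume x: "norm x \<le> R"
          have "(\<lambda>n. d n x) \<longlonglongrightarrow> 0" using elim by (rule summable_LIMSEQ_zero)
          then show "(\<lambda>n. moll (r n) f x) \<longlonglongrightarrow> f x"
            unfolding d_def using loc[OF x] cf[OF x] by (simp add: LIM_zero_iff tendsto_rabs_zero_iff)
        qed
      qed
      show "L1_loc lebesgue (\<lambda>x. \<bar>f x\<bar> + (\<Sum>n. d n x))"
        by (intro L1_loc_add L1_loc_abs L L1_loc_integrable si f)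
      show "AE x in lebesgue. \<forall>n. norm x \<le> R \<longrightarrow> \<bar>moll (r n) f x\<bar> \<le> \<bar>f x\<bar> + (\<Sum>n. d n x)"
        using sm
      proof eventually_elim
        case (elim x)
        show ?case
        proof (intro allI impI)
          fix n assume x: "norm x \<le> R"
          have "d n x \<le> (\<Sum>n. d n x)" using sum_le_suminf[OF elim, of "{n}"] d0 by auto
          moreover have "\<bar>moll (r n) f x\<bar> \<le> \<bar>f x\<bar> + d n x"
            unfolding d_def loc[OF x] cf[OF x] by linarith
          ultimately show "\<bar>moll (r n) f x\<bar> \<le> \<bar>f x\<bar> + (\<Sum>n. d n x)" by linarith
        qed
      qed
    qed
  qed
  then show ?thesis by blast
qed

lemma dom_lim_integral:
  assumes d: "dom_lim R F f" and m: "\<And>n. F n \<in> borel_measurable lebesgue" "f \<in> borel_measurable lebesgue"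
    and e: "\<eta> \<in> borel_measurable lebesgue" and b: "\<And>x. norm x \<le> R \<Longrightarrow> \<bar>\<eta> x\<bar> \<le> B" and s: "\<And>x. norm x > R \<Longrightarrow> \<eta> x = 0"
  shows "(\<lambda>n. \<integral>x. F n x * \<eta> x \<partial>lebesgue) \<longlonglongrightarrow> (\<integral>x. f x * \<eta> x \<partial>lebesgue)"
    and "integrable lebesgue (\<lambda>x. F n x * \<eta> x)" and "integrable lebesgue (\<lambda>x. f x * \<eta> x)"
proof -
  obtain G where G: "L1_loc lebesgue G" "AE x in lebesgue. \<forall>n. norm x \<le> R \<longrightarrow> \<bar>F n x\<bar> \<le> G x"
    and l: "AE x in lebesgue. norm x \<le> R \<longrightarrow> (\<lambda>n. F n x) \<longlonglongrightarrow> f x"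
    using d by (auto simp: dom_lim_def)
  have i: "integrable lebesgue (\<lambda>x. \<bar>\<eta> x\<bar> * G x)"
    by (rule L1_loc_mult_integrable[OF G(1), where R = R and B = B]) (use e b s in auto)
  have bd: "AE x in lebesgue. \<forall>n. norm (F n x * \<eta> x) \<le> \<bar>\<eta> x\<bar> * G x"
    using G(2)
  proof eventually_elim
    case (elim x)
    show ?case
    proof
      fix n
      show "norm (F n x * \<eta> x) \<le> \<bar>\<eta> x\<bar> * G x"
        using elim s[of x] mult_right_mono[of "\<bar>F n x\<bar>" "G x" "\<bar>\<eta> x\<bar>"]
        by (cases "norm x \<le> R") (auto simp: abs_mult mult.commute)
    qed
  qed
  have lm: "AE x in lebesgue. (\<lambda>n. F n x * \<eta> x) \<longlonglongrightarrow> f x * \<eta> x"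
    using l
  proof eventually_elim
    case (elim x)
    then show ?case using s[of x] by (cases "norm x \<le> R") (auto intro: tendsto_mult_right)
  qed
  show "(\<lambda>n. \<integral>x. F n x * \<eta> x \<partial>lebesgue) \<longlonglongrightarrow> (\<integral>x. f x * \<eta> x \<partial>lebesgue)"
    by (rule integral_dominated_convergence[OF _ _ i lm]) (use m e bd in \<open>auto elim: eventually_mono\<close>)
  have "AE x in lebesgue. norm (F n x * \<eta> x) \<le> norm (\<bar>\<eta> x\<bar> * G x)"
    using bd
  proof eventually_elim
    case (elim x)
    then have "norm (F n x * \<eta> x) \<le> \<bar>\<eta> x\<bar> * G x" by blast
    also have "\<dots> \<le> norm (\<bar>\<eta> x\<bar> * G x)" by simp
    finally show ?case .
  qed
  then show "integrable lebesgue (\<lambda>x. F n x * \<eta> x)"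
    by (intro Bochner_Integration.integrable_bound[OF i] borel_measurable_times m e)
  show "integrable lebesgue (\<lambda>x. f x * \<eta> x)"
    by (rule integrable_dominated_convergence[OF _ _ i lm]) (use m e bd in \<open>auto elim: eventually_mono\<close>)
qed

text \<open>Serves the nonlinear expressions: their pointwise limit is known separately, and
  comparison with a family that already has a majorant supplies the domination.\<close>

lemma dom_lim_bound:
  assumes H: "dom_lim R H h" and l: "AE x in lebesgue. norm x \<le> R \<longrightarrow> (\<lambda>n. F n x) \<longlonglongrightarrow> f x"
    and b: "\<And>n x. \<bar>F n x\<bar> \<le> A + C * \<bar>H n x\<bar>" and C: "C \<ge> 0"
  shows "dom_lim R F f"
proof -
  obtain G where G: "L1_loc lebesgue G" "AE x in lebesgue. \<forall>n. norm x \<le> R \<longrightarrow> \<bar>H n x\<bar> \<le> G x"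
    using H by (auto simp: dom_lim_def)
  show ?thesis unfolding dom_lim_def
  proof (intro conjI l exI[of _ "\<lambda>x. A + C * G x"])
    show "L1_loc lebesgue (\<lambda>x. A + C * G x)" by (intro L1_loc_add L1_loc_cmult G(1) L1_loc_continuous) simp
    show "AE x in lebesgue. \<forall>n. norm x \<le> R \<longrightarrow> \<bar>F n x\<bar> \<le> A + C * G x"
      using G(2)
    proof eventually_elim
      case (elim x)
      show ?case
      proof (intro allI impI)
        fix n assume "norm x \<le> R"
        then have "C * \<bar>H n x\<bar> \<le> C * G x" using elim C by (auto intro: mult_left_mono)
        then show "\<bar>F n x\<bar> \<le> A + C * G x" using b[of n x] by linarith
      qed
    qed
  qed
qed

lemma dom_lim_ptw: "dom_lim R F f \<Longrightarrow> AE x in lebesgue. norm x \<le> R \<longrightarrow> (\<lambda>n. F n x) \<longlonglongrightarrow> f x"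
  by (simp add: dom_lim_def)

lemma dom_lim_add:
  assumes "dom_lim R F f" "dom_lim R G g"
  shows "dom_lim R (\<lambda>n x. F n x + G n x) (\<lambda>x. f x + g x)"
proof -
  obtain A B where A: "L1_loc lebesgue A" "AE x in lebesgue. \<forall>n. norm x \<le> R \<longrightarrow> \<bar>F n x\<bar> \<le> A x"
    and B: "L1_loc lebesgue B" "AE x in lebesgue. \<forall>n. norm x \<le> R \<longrightarrow> \<bar>G n x\<bar> \<le> B x"
    using assms by (auto simp: dom_lim_def)
  show ?thesis unfolding dom_lim_def
  proof (intro conjI exI[of _ "\<lambda>x. A x + B x"] L1_loc_add A(1) B(1))
    show "AE x in lebesgue. norm x \<le> R \<longrightarrow> (\<lambda>n. F n x + G n x) \<longlonglongrightarrow> f x + g x"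
      using dom_lim_ptw[OF assms(1)] dom_lim_ptw[OF assms(2)]
      by eventually_elim (auto intro: tendsto_add)
    show "AE x in lebesgue. \<forall>n. norm x \<le> R \<longrightarrow> \<bar>F n x + G n x\<bar> \<le> A x + B x"
      using A(2) B(2) by eventually_elim (metis abs_triangle_ineq add_mono order_trans)
  qed
qed

lemma dom_lim_sum:
  assumes "finite I" "\<And>i. i \<in> I \<Longrightarrow> dom_lim R (F i) (f i)"
  shows "dom_lim R (\<lambda>n x. \<Sum>i\<in>I. F i n x) (\<lambda>x. \<Sum>i\<in>I. f i x)"
  using assms
proof (induction I rule: finite_induct)
  case empty
  show ?case by (auto simp: dom_lim_def intro!: exI[of _ "\<lambda>_. 0"] L1_loc_continuous)
next
  case (insert i I)
  then show ?case by (simp add: dom_lim_add)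
qed

lemma dom_lim_mult_bounded:
  assumes F: "dom_lim R F f" and l: "AE x in lebesgue. norm x \<le> R \<longrightarrow> (\<lambda>n. b n x) \<longlonglongrightarrow> c x"
    and b: "\<And>n x. \<bar>b n x\<bar> \<le> C"
  shows "dom_lim R (\<lambda>n x. b n x * F n x) (\<lambda>x. c x * f x)"
proof (rule dom_lim_bound[OF F, where A = 0 and C = C])
  show "AE x in lebesgue. norm x \<le> R \<longrightarrow> (\<lambda>n. b n x * F n x) \<longlonglongrightarrow> c x * f x"
    using dom_lim_ptw[OF F] l by eventually_elim (auto intro: tendsto_mult)
  show "\<bar>b n x * F n x\<bar> \<le> 0 + C * \<bar>F n x\<bar>" for n x
    using b[of n x] by (auto simp: abs_mult intro: mult_right_mono)
  show "C \<ge> 0" using b[of 0 0] by linarith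
qed

section \<open>Calculus of weak gradients\<close>

lemma has_partial_unique: "has_partial i f f' \<Longrightarrow> has_partial i f f'' \<Longrightarrow> f' = f''"
  unfolding has_partial_def by (intro ext) (blast intro: DERIV_unique)

lemma has_partial_reflect:
  assumes "has_partial i k k'"
  shows "has_partial i (\<lambda>y. k (x - y)) (\<lambda>y. - k' (x - y))"
  unfolding has_partial_def
proof
  fix y
  have "((\<lambda>t. k (x - y + (- t) *\<^sub>R axis i 1)) has_real_derivative k' (x - y) * (- 1)) (at 0)"
    using assms[unfolded has_partial_def, rule_format, of "x - y"]
    by (intro DERIV_chain2[where f = "\<lambda>t. k (x - y + t *\<^sub>R axis i 1)"]) (auto intro!: derivative_eq_intros)
  then show "((\<lambda>t. k (x - (y + t *\<^sub>R axis i 1))) has_real_derivative - k' (x - y)) (at 0)"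
    by (simp add: algebra_simps)
qed

lemma has_partial_uminus: "has_partial i f f' \<Longrightarrow> has_partial i (\<lambda>x. - f x) (\<lambda>x. - f' x)"
  unfolding has_partial_def by (auto intro!: derivative_eq_intros)

lemma mollifier_in_Cc_infinity: "mollifier n \<in> Cc_infinity"
  using mollifier_Cc_infinity[of n 0] by (simp add: mollifier_minus)

abbreviation dmollifier :: "'n \<Rightarrow> nat \<Rightarrow> real ^ 'n \<Rightarrow> real" where
  "dmollifier i n \<equiv> partial_deriv i (mollifier n)"

lemma kernel_partial_deriv:
  assumes "k \<in> Cc_infinity" "kernel r k"
  shows "kernel r (partial_deriv i k)"
  using assms(2) Cc_infinity_continuous(2)[OF assms(1)]
    has_partial_support[OF has_partial_of_Cc_infinity[OF assms(1)], of r]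
  by (auto simp: kernel_def)

lemmas dmollifier_kernel = kernel_partial_deriv[OF mollifier_in_Cc_infinity mollifier_kernel]
lemmas ddmollifier_kernel = kernel_partial_deriv[OF Cc_infinity_partial[OF mollifier_in_Cc_infinity] dmollifier_kernel]

lemma partial_deriv_mollifier_shift: "partial_deriv i (\<lambda>y. mollifier n (x - y)) = (\<lambda>y. - dmollifier i n (x - y))"
  by (rule has_partial_unique[OF has_partial_of_Cc_infinity[OF mollifier_Cc_infinity]])
    (rule has_partial_reflect[OF has_partial_of_Cc_infinity[OF mollifier_in_Cc_infinity]])

text \<open>The translated mollifier is itself a test function. Reflecting its argument changes the
  sign of the derivative, which cancels the sign in the weak formulation.\<close>

lemma conv_dmollifier_weak_gradient:
  assumes "has_weak_gradient u g"
  shows "conv (dmollifier i n) u = moll n (\<lambda>y. g y $ i)"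
proof
  fix x
  have "(\<integral>y. u y * partial_deriv i (\<lambda>y. mollifier n (x - y)) y \<partial>lebesgue) = - (\<integral>y. g y $ i * mollifier n (x - y) \<partial>lebesgue)"
    using assms mollifier_Cc_infinity unfolding has_weak_gradient_def by blast
  then show "conv (dmollifier i n) u x = moll n (\<lambda>y. g y $ i) x"
    by (simp add: partial_deriv_mollifier_shift moll_def conv_def mult.commute)
qed

definition C1_with :: "(real ^ 'n \<Rightarrow> real) \<Rightarrow> ('n \<Rightarrow> real ^ 'n \<Rightarrow> real) \<Rightarrow> bool" where
  "C1_with f D \<longleftrightarrow> continuous_on UNIV f \<and> (\<forall>i. has_partial i f (D i) \<and> continuous_on UNIV (D i))"

lemma C1_with_Cc_infinity: "\<eta> \<in> Cc_infinity \<Longrightarrow> C1_with \<eta> (\<lambda>i. partial_deriv i \<eta>)"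
  by (simp add: C1_with_def Cc_infinity_continuous has_partial_of_Cc_infinity)

lemma C1_with_conv:
  assumes "k \<in> Cc_infinity" "kernel r k" "L1_loc lebesgue u"
  shows "C1_with (conv k u) (\<lambda>i. conv (partial_deriv i k) u)"
  unfolding C1_with_def
  by (intro conjI allI conv_continuous[OF _ assms(3)] conv_has_partial[OF _ _ assms(3)]
      has_partial_of_Cc_infinity kernel_partial_deriv assms(1)) (rule assms(2) kernel_partial_deriv assms)+

lemma C1_with_moll:
  assumes "has_weak_gradient u g"
  shows "C1_with (moll n u) (\<lambda>i. moll n (\<lambda>y. g y $ i))"
  using C1_with_conv[OF mollifier_in_Cc_infinity mollifier_kernel, of u n] assms
  by (simp add: conv_dmollifier_weak_gradient[OF assms] moll_def has_weak_gradient_def)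

lemma C1_with_mult:
  "C1_with f D \<Longrightarrow> C1_with g E \<Longrightarrow> C1_with (\<lambda>x. f x * g x) (\<lambda>i x. D i x * g x + f x * E i x)"
  unfolding C1_with_def by (auto intro!: continuous_intros has_partial_mult)

lemma C1_with_compose:
  assumes "C1_with f D" "\<And>x. f x \<in> S" "\<And>s. s \<in> S \<Longrightarrow> (T has_real_derivative T' s) (at s)" "continuous_on S T'"
  shows "C1_with (\<lambda>x. T (f x)) (\<lambda>i x. T' (f x) * D i x)"
proof -
  have "continuous_on S T" using assms(3) by (meson DERIV_continuous_on has_field_derivative_at_within)
  then show ?thesis using assms unfolding C1_with_def
    by (auto intro!: continuous_intros has_partial_compose continuous_on_compose2[of S T UNIV f] continuous_on_compose2[of S T' UNIV f])
qed

lemma C1_with_integral: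
  assumes "C1_with f D" "\<And>x. norm x > R \<Longrightarrow> f x = 0"
  shows "integral\<^sup>L lebesgue (D i) = 0"
  using assms by (intro has_partial_integral_0[of i f "D i" R]) (auto simp: C1_with_def)

lemma C1_with_support:
  "C1_with f D \<Longrightarrow> (\<And>x. norm x > R \<Longrightarrow> f x = 0) \<Longrightarrow> norm x > R \<Longrightarrow> D i x = 0"
  using has_partial_support[of i f "D i" R x] by (auto simp: C1_with_def)

lemma C1_with_ibp:
  assumes f: "C1_with f D" and g: "C1_with g E" and s: "\<And>x. norm x > R \<Longrightarrow> g x = 0"
  shows "(\<integral>x. f x * E i x \<partial>lebesgue) = - (\<integral>x. D i x * g x \<partial>lebesgue)"
proof -
  have "(\<integral>x. D i x * g x + f x * E i x \<partial>lebesgue) = 0"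
    using C1_with_integral[OF C1_with_mult[OF f g], of R i] s by simp
  moreover have "integrable lebesgue (\<lambda>x. D i x * g x)"
    using f g s by (intro integrable_continuous_support[where R = R] continuous_intros) (auto simp: C1_with_def)
  moreover have "integrable lebesgue (\<lambda>x. f x * E i x)"
    using f g C1_with_support[OF g s]
    by (intro integrable_continuous_support[where R = R] continuous_intros) (auto simp: C1_with_def)
  ultimately show ?thesis by simp
qed

lemma C1_with_measurable: "C1_with f D \<Longrightarrow> f \<in> borel_measurable lebesgue" "C1_with f D \<Longrightarrow> D i \<in> borel_measurable lebesgue"
  by (auto simp: C1_with_def intro: borel_measurable_lebesgue_continuous)

lemma L1_loc_of_dom_lim:
  assumes m: "f \<in> borel_measurable lebesgue" and d: "\<And>R. \<exists>F. dom_lim R F f"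
  shows "L1_loc lebesgue f"
proof (rule L1_locI)
  fix R :: real
  obtain F G where G: "L1_loc lebesgue G" "AE x in lebesgue. \<forall>n. norm x \<le> R \<longrightarrow> \<bar>F n x\<bar> \<le> G x"
    and l: "AE x in lebesgue. norm x \<le> R \<longrightarrow> (\<lambda>n. F n x) \<longlonglongrightarrow> f x" for n :: nat
    using d[of R] by (auto simp: dom_lim_def)
  have "AE x in lebesgue. norm (indicator (cball 0 R) x *\<^sub>R f x) \<le> norm (indicator (cball 0 R) x *\<^sub>R G x)"
    using G(2) l
  proof eventually_elim
    case (elim x)
    show ?case
    proof (cases "norm x \<le> R")
      case True
      then have "(\<lambda>n. \<bar>F n x\<bar>) \<longlonglongrightarrow> \<bar>f x\<bar>" "\<And>n. \<bar>F n x\<bar> \<le> G x" using elim by (auto intro: tendsto_rabs)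
      then have "\<bar>f x\<bar> \<le> G x" by (meson LIMSEQ_le_const2)
      then show ?thesis using True by auto
    qed simp
  qed
  then show "integrable lebesgue (\<lambda>x. indicator (cball 0 R) x *\<^sub>R f x)"
    by (intro Bochner_Integration.integrable_bound[OF L1_loc_cball[OF G(1), of R]] borel_measurable_scaleR
        borel_measurable_indicator m) auto
qed

text \<open>Classical integration by parts passes to the limit. The approximating functions may
  depend on \<open>R\<close>, since each test function lives in one ball; the majorants also yield
  the local integrability of \<open>u\<close> and \<open>g\<close>.\<close>

lemma has_weak_gradientI_dom_lim:
  fixes u :: "real ^ 'n \<Rightarrow> real"
  assumes m: "u \<in> borel_measurable lebesgue" "\<And>i. (\<lambda>x. g x $ i) \<in> borel_measurable lebesgue"
    and a: "\<And>R. \<exists>U D. (\<forall>n. C1_with (U n) (D n)) \<and> dom_lim R U u \<and> (\<forall>i. dom_lim R (\<lambda>n. D n i) (\<lambda>x. g x $ i))"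
  shows "has_weak_gradient u g"
  unfolding has_weak_gradient_def
proof (intro conjI ballI allI)
  show "L1_loc lebesgue u" using a by (intro L1_loc_of_dom_lim m(1)) blast
  show "L1_loc lebesgue g" using a by (intro L1_loc_vecI L1_loc_of_dom_lim m(2)) blast
  fix \<eta> :: "real ^ 'n \<Rightarrow> real" and i assume e: "\<eta> \<in> Cc_infinity"
  obtain R where R: "\<And>x. norm x > R \<Longrightarrow> \<eta> x = 0" "\<And>i x. norm x > R \<Longrightarrow> partial_deriv i \<eta> x = 0"
    using Cc_infinity_support[OF e] by metis
  obtain U D where C: "\<And>n. C1_with (U n) (D n)" and U: "dom_lim R U u" and D: "\<And>i. dom_lim R (\<lambda>n. D n i) (\<lambda>x. g x $ i)"
    using a[of R] by blast
  note c = Cc_infinity_continuous(1)[OF e] Cc_infinity_continuous(2)[OF e, of i]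
  obtain B1 where B1: "\<And>x. norm x \<le> R \<Longrightarrow> \<bar>\<eta> x\<bar> \<le> B1" using continuous_cball_bound[OF c(1)] by metis
  obtain B2 where B2: "\<And>x. norm x \<le> R \<Longrightarrow> \<bar>partial_deriv i \<eta> x\<bar> \<le> B2" using continuous_cball_bound[OF c(2)] by metis
  have "(\<lambda>n. \<integral>x. U n x * partial_deriv i \<eta> x \<partial>lebesgue) \<longlonglongrightarrow> (\<integral>x. u x * partial_deriv i \<eta> x \<partial>lebesgue)"
    by (rule dom_lim_integral(1)[OF U C1_with_measurable(1)[OF C] m(1) borel_measurable_lebesgue_continuous[OF c(2)] B2 R(2)])
  moreover have "(\<lambda>n. - (\<integral>x. D n i x * \<eta> x \<partial>lebesgue)) \<longlonglongrightarrow> - (\<integral>x. g x $ i * \<eta> x \<partial>lebesgue)"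
    by (intro tendsto_minus dom_lim_integral(1)[OF D C1_with_measurable(2)[OF C] m(2) borel_measurable_lebesgue_continuous[OF c(1)] B1 R(1)])
  moreover have "(\<integral>x. U n x * partial_deriv i \<eta> x \<partial>lebesgue) = - (\<integral>x. D n i x * \<eta> x \<partial>lebesgue)" for n
    by (rule C1_with_ibp[OF C C1_with_Cc_infinity[OF e] R(1)])
  ultimately show "(\<integral>x. u x * partial_deriv i \<eta> x \<partial>lebesgue) = - (\<integral>x. g x $ i * \<eta> x \<partial>lebesgue)"
    using LIMSEQ_unique by simp
qed

lemma dom_lim_const:
  assumes "L1_loc lebesgue f"
  shows "dom_lim R (\<lambda>n. f) f"
  unfolding dom_lim_def using L1_loc_abs[OF assms] by auto

lemma has_weak_gradient_C1:
  assumes "C1_with f D"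
  shows "has_weak_gradient f (\<lambda>x. \<chi> i. D i x)"
proof (rule has_weak_gradientI_dom_lim)
  show "\<exists>U E. (\<forall>n. C1_with (U n) (E n)) \<and> dom_lim R U f \<and> (\<forall>i. dom_lim R (\<lambda>n. E n i) (\<lambda>x. (\<chi> i. D i x) $ i))" for R
    using assms by (intro exI[of _ "\<lambda>_. f"] exI[of _ "\<lambda>_. D"]) (auto simp: C1_with_def intro!: dom_lim_const L1_loc_continuous)
qed (use C1_with_measurable[OF assms] in auto)

lemma has_weak_gradient_L1_loc:
  assumes "has_weak_gradient u g"
  shows "L1_loc lebesgue u" "L1_loc lebesgue g" "L1_loc lebesgue (\<lambda>x. g x $ i)"
    "u \<in> borel_measurable lebesgue" "g \<in> borel_measurable lebesgue" "(\<lambda>x. g x $ i) \<in> borel_measurable lebesgue"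
  using assms L1_loc_nth[of g i] L1_loc_measurable unfolding has_weak_gradient_def by auto

lemma moll_measurable: "L1_loc lebesgue f \<Longrightarrow> moll n f \<in> borel_measurable lebesgue"
  unfolding moll_def by (intro borel_measurable_lebesgue_continuous conv_continuous[OF mollifier_kernel])

lemma weak_gradient_approx:
  fixes u :: "real ^ 'n \<Rightarrow> real" and F :: "(real ^ 'n \<Rightarrow> real) set"
  assumes u: "has_weak_gradient u g" and F: "finite F" "\<And>f. f \<in> F \<Longrightarrow> L1_loc lebesgue f"
  obtains r :: "nat \<Rightarrow> nat" where "dom_lim R (\<lambda>n. moll (r n) u) u"
    "\<And>i. dom_lim R (\<lambda>n. moll (r n) (\<lambda>x. g x $ i)) (\<lambda>x. g x $ i)"
    "\<And>f. f \<in> F \<Longrightarrow> dom_lim R (\<lambda>n. moll (r n) f) f"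
proof -
  have "\<exists>r :: nat \<Rightarrow> nat. \<forall>f \<in> insert u (range (\<lambda>i x. g x $ i)) \<union> F. dom_lim R (\<lambda>n. moll (r n) f) f"
    by (rule moll_approx) (use has_weak_gradient_L1_loc[OF u] F in auto)
  then show thesis using that by auto
qed

text \<open>The mollified components agree, as both are the convolution of \<open>u\<close> with the
  derivative of the mollifier. Letting the radius tend to 0 gives equality almost everywhere on each
  ball.\<close>

lemma has_weak_gradient_unique:
  fixes u :: "real ^ 'n \<Rightarrow> real"
  assumes g: "has_weak_gradient u g" and h: "has_weak_gradient u h"
  shows "AE x in lebesgue. g x = h x"
proof -
  have eq: "moll n (\<lambda>y. g y $ i) = moll n (\<lambda>y. h y $ i)" for n i
    using conv_dmollifier_weak_gradient[OF g, of i n] conv_dmollifier_weak_gradient[OF h, of i n] by simp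
  have "AE x in lebesgue. norm x \<le> R \<longrightarrow> g x $ i = h x $ i" for R i
  proof -
    obtain r :: "nat \<Rightarrow> nat" where r: "\<And>i. dom_lim R (\<lambda>n. moll (r n) (\<lambda>x. g x $ i)) (\<lambda>x. g x $ i)"
      "\<And>f. f \<in> range (\<lambda>i x. h x $ i) \<Longrightarrow> dom_lim R (\<lambda>n. moll (r n) f) f"
      by (rule weak_gradient_approx[OF g, of "range (\<lambda>i x. h x $ i)" R]) (use has_weak_gradient_L1_loc[OF h] in auto)
    have "dom_lim R (\<lambda>n. moll (r n) (\<lambda>x. h x $ i)) (\<lambda>x. h x $ i)" by (rule r(2)) auto
    from dom_lim_ptw[OF r(1)[of i]] dom_lim_ptw[OF this] show ?thesis
      by eventually_elim (auto simp: eq intro: LIMSEQ_unique)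
  qed
  then have "AE x in lebesgue. \<forall>i. \<forall>n::nat. norm x \<le> real n \<longrightarrow> g x $ i = h x $ i"
    unfolding AE_all_countable by blast
  then show ?thesis
  proof eventually_elim
    case (elim x)
    then show ?case using real_arch_simple[of "norm x"] by (auto simp: vec_eq_iff)
  qed
qed

lemma weak_gradient_unique:
  assumes "has_weak_gradient u g"
  shows "has_weak_gradient u (weak_gradient u)" "AE x in lebesgue. weak_gradient u x = g x"
proof -
  show 1: "has_weak_gradient u (weak_gradient u)" unfolding weak_gradient_def by (rule someI[of "has_weak_gradient u", OF assms])
  show "AE x in lebesgue. weak_gradient u x = g x" by (rule has_weak_gradient_unique[OF 1 assms])
qed

section \<open>Chain, product and square rules for weak gradients\<close>

lemma continuous_on_real_compose_measurable:
  assumes "continuous_on UNIV (T :: real \<Rightarrow> real)" "u \<in> borel_measurable M"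
  shows "(\<lambda>x. T (u x)) \<in> borel_measurable M"
  using assms(2) by (rule measurable_compose) (intro borel_measurable_continuous_onI assms(1))

lemma has_weak_gradient_compose:
  fixes u :: "real ^ 'n \<Rightarrow> real"
  assumes u: "has_weak_gradient u g" and T: "\<And>s. (T has_real_derivative T' s) (at s)"
    and c: "continuous_on UNIV T'" and b: "\<And>s. \<bar>T' s\<bar> \<le> B"
  shows "has_weak_gradient (\<lambda>x. T (u x)) (\<lambda>x. T' (u x) *\<^sub>R g x)"
proof (rule has_weak_gradientI_dom_lim)
  note m = has_weak_gradient_L1_loc[OF u]
  have cT: "continuous_on UNIV T" using T by (meson DERIV_continuous_on has_field_derivative_at_within)
  show "(\<lambda>x. T (u x)) \<in> borel_measurable lebesgue" by (rule continuous_on_real_compose_measurable[OF cT m(4)])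
  show "(\<lambda>x. (T' (u x) *\<^sub>R g x) $ i) \<in> borel_measurable lebesgue" for i
    using continuous_on_real_compose_measurable[OF c m(4)] m(6)[of i] by simp
  fix R
  obtain r :: "nat \<Rightarrow> nat" where r: "dom_lim R (\<lambda>n. moll (r n) u) u"
    "\<And>i. dom_lim R (\<lambda>n. moll (r n) (\<lambda>x. g x $ i)) (\<lambda>x. g x $ i)"
    by (rule weak_gradient_approx[OF u, of "{}" R]) auto
  have p: "AE x in lebesgue. norm x \<le> R \<longrightarrow> (\<lambda>n. S (moll (r n) u x)) \<longlonglongrightarrow> S (u x)"
    if "continuous_on UNIV S" for S :: "real \<Rightarrow> real"
    using dom_lim_ptw[OF r(1)] by eventually_elim (use that continuous_on_tendsto_compose in fastforce)
  have lip: "\<bar>T s\<bar> \<le> \<bar>T 0\<bar> + B * \<bar>s\<bar>" for s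
  proof -
    have "norm (T s - T 0) \<le> B * norm (s - 0)"
      by (rule field_differentiable_bound[of UNIV T T']) (use T b in auto)
    then show ?thesis by simp
  qed
  show "\<exists>U D. (\<forall>n. C1_with (U n) (D n)) \<and> dom_lim R U (\<lambda>x. T (u x)) \<and> (\<forall>i. dom_lim R (\<lambda>n. D n i) (\<lambda>x. (T' (u x) *\<^sub>R g x) $ i))"
  proof (intro exI conjI allI)
    show "C1_with (\<lambda>x. T (moll (r n) u x)) (\<lambda>i x. T' (moll (r n) u x) * moll (r n) (\<lambda>x. g x $ i) x)" for n
      by (rule C1_with_compose[OF C1_with_moll[OF u], where S = UNIV]) (use T c in auto)
    show "dom_lim R (\<lambda>n x. T (moll (r n) u x)) (\<lambda>x. T (u x))"
      by (rule dom_lim_bound[OF r(1) p[OF cT] lip]) (use b[of 0] in linarith)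
    show "dom_lim R (\<lambda>n x. T' (moll (r n) u x) * moll (r n) (\<lambda>x. g x $ i) x) (\<lambda>x. (T' (u x) *\<^sub>R g x) $ i)" for i
      using dom_lim_mult_bounded[OF r(2) p[OF c] b] by simp
  qed
qed

text \<open>The bounds on \<open>u\<close> and \<open>p\<close> pass to their mollifications, so in
  every product one factor is bounded and convergent while the other has a majorant.\<close>

lemma has_weak_gradient_mult:
  fixes u p :: "real ^ 'n \<Rightarrow> real"
  assumes u: "has_weak_gradient u g" and p: "has_weak_gradient p h"
    and b: "\<And>x. \<bar>u x\<bar> \<le> A" "\<And>x. \<bar>p x\<bar> \<le> B"
  shows "has_weak_gradient (\<lambda>x. u x * p x) (\<lambda>x. p x *\<^sub>R g x + u x *\<^sub>R h x)"
proof (rule has_weak_gradientI_dom_lim)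
  note m = has_weak_gradient_L1_loc[OF u] has_weak_gradient_L1_loc[OF p]
  show "(\<lambda>x. u x * p x) \<in> borel_measurable lebesgue" using m by auto
  show "(\<lambda>x. (p x *\<^sub>R g x + u x *\<^sub>R h x) $ i) \<in> borel_measurable lebesgue" for i
    using m(4,10) m(6)[of i] m(12)[of i] by simp
  fix R
  obtain r :: "nat \<Rightarrow> nat" where r: "dom_lim R (\<lambda>n. moll (r n) u) u"
    "\<And>i. dom_lim R (\<lambda>n. moll (r n) (\<lambda>x. g x $ i)) (\<lambda>x. g x $ i)"
    "\<And>f. f \<in> insert p (range (\<lambda>i x. h x $ i)) \<Longrightarrow> dom_lim R (\<lambda>n. moll (r n) f) f"
    by (rule weak_gradient_approx[OF u, of "insert p (range (\<lambda>i x. h x $ i))" R]) (use m in auto)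
  have rp: "dom_lim R (\<lambda>n. moll (r n) p) p" by (rule r(3)) auto
  have rh: "dom_lim R (\<lambda>n. moll (r n) (\<lambda>x. h x $ i)) (\<lambda>x. h x $ i)" for i by (rule r(3)) auto
  have bu: "\<bar>moll n u x\<bar> \<le> A" for n x
    using moll_abs_le[OF m(1) L1_loc_continuous, of "\<lambda>_. A" n x] b(1) by (simp add: moll_const)
  have bp: "\<bar>moll n p x\<bar> \<le> B" for n x
    using moll_abs_le[OF m(7) L1_loc_continuous, of "\<lambda>_. B" n x] b(2) by (simp add: moll_const)
  show "\<exists>U D. (\<forall>n. C1_with (U n) (D n)) \<and> dom_lim R U (\<lambda>x. u x * p x) \<and>
      (\<forall>i. dom_lim R (\<lambda>n. D n i) (\<lambda>x. (p x *\<^sub>R g x + u x *\<^sub>R h x) $ i))"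
  proof (intro exI conjI allI)
    show "C1_with (\<lambda>x. moll (r n) u x * moll (r n) p x)
      (\<lambda>i x. moll (r n) (\<lambda>x. g x $ i) x * moll (r n) p x + moll (r n) u x * moll (r n) (\<lambda>x. h x $ i) x)" for n
      by (rule C1_with_mult[OF C1_with_moll[OF u] C1_with_moll[OF p]])
    show "dom_lim R (\<lambda>n x. moll (r n) u x * moll (r n) p x) (\<lambda>x. u x * p x)"
      by (rule dom_lim_mult_bounded[OF rp dom_lim_ptw[OF r(1)] bu])
    show "dom_lim R (\<lambda>n x. moll (r n) (\<lambda>x. g x $ i) x * moll (r n) p x + moll (r n) u x * moll (r n) (\<lambda>x. h x $ i) x)
        (\<lambda>x. (p x *\<^sub>R g x + u x *\<^sub>R h x) $ i)" for i
      using dom_lim_add[OF dom_lim_mult_bounded[OF r(2) dom_lim_ptw[OF rp] bp] dom_lim_mult_bounded[OF rh dom_lim_ptw[OF r(1)] bu]]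
      by (simp add: mult.commute)
  qed
qed

text \<open>Neither factor is bounded here. By Jensen, squares of mollifications are at most
  mollified squares, so all products are controlled by the mollifications of
  \<open>(v x)\<^sup>2\<close> and \<open>(w x $ i)\<^sup>2\<close>, which have majorants because
  these squares are locally integrable.\<close>

lemma has_weak_gradient_square:
  fixes v :: "real ^ 'n \<Rightarrow> real"
  assumes v: "has_weak_gradient v w" and v2: "L1_loc lebesgue (\<lambda>x. (v x)\<^sup>2)" and w2: "L1_loc lebesgue (\<lambda>x. (norm (w x))\<^sup>2)"
  shows "has_weak_gradient (\<lambda>x. (v x)\<^sup>2) (\<lambda>x. (2 * v x) *\<^sub>R w x)"
proof (rule has_weak_gradientI_dom_lim)
  note m = has_weak_gradient_L1_loc[OF v]
  show "(\<lambda>x. (v x)\<^sup>2) \<in> borel_measurable lebesgue" using m(4) by (rule borel_measurable_power)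
  show "(\<lambda>x. ((2 * v x) *\<^sub>R w x) $ i) \<in> borel_measurable lebesgue" for i
    using m(4) m(6)[of i] by simp
  have wi2: "L1_loc lebesgue (\<lambda>x. (w x $ i)\<^sup>2)" for i
    by (rule L1_loc_bound[OF w2])
      (auto intro!: borel_measurable_power m(6) AE_I2 power_mono component_le_norm_cart simp: abs_le_square_iff[symmetric])
  have cs: "(moll n f x)\<^sup>2 \<le> moll n (\<lambda>x. (f x)\<^sup>2) x" if "L1_loc lebesgue f" "L1_loc lebesgue (\<lambda>x. (f x)\<^sup>2)" for n f and x :: "real ^ 'n"
    using moll_Cauchy_Schwarz[OF that(2), of "\<lambda>_. 1" n x] that(1) by (simp add: L1_loc_continuous moll_const)
  fix R
  obtain r :: "nat \<Rightarrow> nat" where r: "dom_lim R (\<lambda>n. moll (r n) v) v"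
    "\<And>i. dom_lim R (\<lambda>n. moll (r n) (\<lambda>x. w x $ i)) (\<lambda>x. w x $ i)"
    "\<And>f. f \<in> insert (\<lambda>x. (v x)\<^sup>2) (range (\<lambda>i x. (w x $ i)\<^sup>2)) \<Longrightarrow> dom_lim R (\<lambda>n. moll (r n) f) f"
    by (rule weak_gradient_approx[OF v, of "insert (\<lambda>x. (v x)\<^sup>2) (range (\<lambda>i x. (w x $ i)\<^sup>2))" R]) (use wi2 v2 in auto)
  have rv: "dom_lim R (\<lambda>n. moll (r n) (\<lambda>x. (v x)\<^sup>2)) (\<lambda>x. (v x)\<^sup>2)" by (rule r(3)) auto
  have rw: "dom_lim R (\<lambda>n. moll (r n) (\<lambda>x. (w x $ i)\<^sup>2)) (\<lambda>x. (w x $ i)\<^sup>2)" for i by (rule r(3)) auto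
  show "\<exists>U D. (\<forall>n. C1_with (U n) (D n)) \<and> dom_lim R U (\<lambda>x. (v x)\<^sup>2) \<and>
      (\<forall>i. dom_lim R (\<lambda>n. D n i) (\<lambda>x. ((2 * v x) *\<^sub>R w x) $ i))"
  proof (intro exI conjI allI)
    show "C1_with (\<lambda>x. moll (r n) v x * moll (r n) v x)
      (\<lambda>i x. moll (r n) (\<lambda>x. w x $ i) x * moll (r n) v x + moll (r n) v x * moll (r n) (\<lambda>x. w x $ i) x)" for n
      by (rule C1_with_mult[OF C1_with_moll[OF v] C1_with_moll[OF v]])
    show "dom_lim R (\<lambda>n x. moll (r n) v x * moll (r n) v x) (\<lambda>x. (v x)\<^sup>2)"
    proof (rule dom_lim_bound[OF rv, where A = 0 and C = 1])
      show "AE x in lebesgue. norm x \<le> R \<longrightarrow> (\<lambda>n. moll (r n) v x * moll (r n) v x) \<longlonglongrightarrow> (v x)\<^sup>2"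
        using dom_lim_ptw[OF r(1)] by eventually_elim (auto simp: power2_eq_square intro: tendsto_mult)
      show "\<bar>moll (r n) v x * moll (r n) v x\<bar> \<le> 0 + 1 * \<bar>moll (r n) (\<lambda>x. (v x)\<^sup>2) x\<bar>" for n x
        using cs[OF m(1) v2, of "r n" x] by (simp add: power2_eq_square)
    qed simp
    show "dom_lim R (\<lambda>n x. moll (r n) (\<lambda>x. w x $ i) x * moll (r n) v x + moll (r n) v x * moll (r n) (\<lambda>x. w x $ i) x)
        (\<lambda>x. ((2 * v x) *\<^sub>R w x) $ i)" for i
    proof (rule dom_lim_bound[OF dom_lim_add[OF rv rw[of i]], where A = 0 and C = 1])
      show "AE x in lebesgue. norm x \<le> R \<longrightarrow> (\<lambda>n. moll (r n) (\<lambda>x. w x $ i) x * moll (r n) v x + moll (r n) v x * moll (r n) (\<lambda>x. w x $ i) x) \<longlonglongrightarrow> ((2 * v x) *\<^sub>R w x) $ i"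
        using dom_lim_ptw[OF r(1)] dom_lim_ptw[OF r(2)[of i]]
      proof eventually_elim
        case (elim x)
        show ?case
        proof
          assume "norm x \<le> R"
          then have "(\<lambda>n. moll (r n) (\<lambda>x. w x $ i) x * moll (r n) v x + moll (r n) v x * moll (r n) (\<lambda>x. w x $ i) x)
             \<longlonglongrightarrow> w x $ i * v x + v x * w x $ i" using elim by (intro tendsto_intros) auto
          then show "(\<lambda>n. moll (r n) (\<lambda>x. w x $ i) x * moll (r n) v x + moll (r n) v x * moll (r n) (\<lambda>x. w x $ i) x)
             \<longlonglongrightarrow> ((2 * v x) *\<^sub>R w x) $ i" by (simp add: mult_ac)
        qed
      qed
      show "\<bar>moll (r n) (\<lambda>x. w x $ i) x * moll (r n) v x + moll (r n) v x * moll (r n) (\<lambda>x. w x $ i) x\<bar>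
        \<le> 0 + 1 * \<bar>moll (r n) (\<lambda>x. (v x)\<^sup>2) x + moll (r n) (\<lambda>x. (w x $ i)\<^sup>2) x\<bar>" for n x
      proof -
        have "\<bar>a * b + b * a\<bar> \<le> b\<^sup>2 + a\<^sup>2" for a b :: real
          using zero_le_power2[of "a - b"] zero_le_power2[of "a + b"]
          by (simp add: abs_le_iff power2_eq_square algebra_simps)
        then show ?thesis using cs[OF m(1) v2, of "r n" x] cs[OF m(3)[of i] wi2[of i], of "r n" x] by (smt (verit))
      qed
    qed simp
  qed
qed

text \<open>Enlarges the test functions from smooth ones to those of class C^1, to which the cutoffs
  below belong. It is \<open>u\<close> that gets mollified, and classical integration by parts asks
  no more of \<xi>.\<close>

lemma weak_gradient_test:
  fixes u :: "real ^ 'n \<Rightarrow> real"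
  assumes u: "has_weak_gradient u g" and x: "C1_with \<xi> X" and s: "\<And>x. norm x > R \<Longrightarrow> \<xi> x = 0"
  shows "(\<integral>x. u x * X i x \<partial>lebesgue) = - (\<integral>x. g x $ i * \<xi> x \<partial>lebesgue)"
proof -
  note m = has_weak_gradient_L1_loc[OF u]
  obtain r :: "nat \<Rightarrow> nat" where r: "dom_lim R (\<lambda>n. moll (r n) u) u"
    "\<And>i. dom_lim R (\<lambda>n. moll (r n) (\<lambda>x. g x $ i)) (\<lambda>x. g x $ i)"
    by (rule weak_gradient_approx[OF u, of "{}" R]) auto
  have c: "continuous_on UNIV \<xi>" "continuous_on UNIV (X i)" using x by (auto simp: C1_with_def)
  obtain B1 where B1: "\<And>x. norm x \<le> R \<Longrightarrow> \<bar>\<xi> x\<bar> \<le> B1" using continuous_cball_bound[OF c(1)] by metis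
  obtain B2 where B2: "\<And>x. norm x \<le> R \<Longrightarrow> \<bar>X i x\<bar> \<le> B2" using continuous_cball_bound[OF c(2)] by metis
  have "(\<lambda>n. \<integral>x. moll (r n) u x * X i x \<partial>lebesgue) \<longlonglongrightarrow> (\<integral>x. u x * X i x \<partial>lebesgue)"
    by (rule dom_lim_integral(1)[OF r(1) moll_measurable[OF m(1)] m(4) borel_measurable_lebesgue_continuous[OF c(2)] B2 C1_with_support[OF x s]])
  moreover have "(\<lambda>n. - (\<integral>x. moll (r n) (\<lambda>x. g x $ i) x * \<xi> x \<partial>lebesgue)) \<longlonglongrightarrow> - (\<integral>x. g x $ i * \<xi> x \<partial>lebesgue)"
    by (intro tendsto_minus dom_lim_integral(1)[OF r(2) moll_measurable[OF m(3)] m(6) borel_measurable_lebesgue_continuous[OF c(1)] B1 s])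
  moreover have "(\<integral>x. moll (r n) u x * X i x \<partial>lebesgue) = - (\<integral>x. moll (r n) (\<lambda>x. g x $ i) x * \<xi> x \<partial>lebesgue)" for n
    by (rule C1_with_ibp[OF C1_with_moll[OF u] x s])
  ultimately show ?thesis using LIMSEQ_unique by simp
qed

section \<open>Radial cutoff functions of class C^1\<close>

lemma DERIV_max_sq: "((\<lambda>t. (max 0 t)\<^sup>2) has_real_derivative 2 * max 0 t) (at t)" for t :: real
proof (cases t "0 :: real" rule: linorder_cases)
  case less
  have "((\<lambda>t. 0) has_real_derivative 0) (at t)" by simp
  then have "((\<lambda>t. (max 0 t)\<^sup>2) has_real_derivative 0) (at t)"
    by (rule DERIV_cong_ev[THEN iffD1, rotated 3])
      (use less in \<open>auto intro!: eventually_mono[OF eventually_nhds_in_open[of "{..<0}" t]]\<close>)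
  then show ?thesis using less by simp
next
  case equal
  have "((\<lambda>h. max 0 h) \<longlongrightarrow> max 0 0) (at (0::real))" by (intro tendsto_intros)
  then have "((\<lambda>h. ((max 0 (0 + h))\<^sup>2 - (max 0 0)\<^sup>2) / h) \<longlongrightarrow> 0) (at (0::real))"
    by (auto intro: Lim_transform_eventually simp: eventually_at_filter power2_eq_square max_def)
  then show ?thesis using equal by (simp add: DERIV_def)
next
  case greater
  have "((\<lambda>t. t\<^sup>2) has_real_derivative 2 * t) (at t)" by (auto intro!: derivative_eq_intros)
  then have "((\<lambda>t. (max 0 t)\<^sup>2) has_real_derivative 2 * t) (at t)"
    by (rule DERIV_cong_ev[THEN iffD1, rotated 3])
      (use greater in \<open>auto intro!: eventually_mono[OF eventually_nhds_in_open[of "{0<..}" t]]\<close>)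
  then show ?thesis using greater by simp
qed

lemma C1_with_norm_sq: "C1_with (\<lambda>x :: real ^ 'n. (norm x)\<^sup>2) (\<lambda>i x. 2 * x $ i)"
proof -
  have "((\<lambda>t. (norm (x + t *\<^sub>R axis i 1))\<^sup>2) has_real_derivative 2 * x $ i) (at 0)" for x :: "real ^ 'n" and i
  proof -
    have eq: "(norm (x + t *\<^sub>R axis i 1))\<^sup>2 = (norm x)\<^sup>2 + 2 * t * x $ i + t\<^sup>2" for t
      unfolding power2_norm_eq_inner
      by (simp add: inner_add_left inner_add_right inner_axis inner_commute[of "axis i 1" x] power2_eq_square inner_axis_axis algebra_simps)
    show ?thesis unfolding eq by (auto intro!: derivative_eq_intros)
  qed
  then show ?thesis unfolding C1_with_def has_partial_def by (auto intro!: continuous_intros)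
qed

lemma C1_with_nth: "C1_with (\<lambda>x :: real ^ 'n. x $ j) (\<lambda>i x. if i = j then 1 else 0)"
  unfolding C1_with_def has_partial_def by (auto intro!: continuous_intros derivative_eq_intros simp: axis_def)

text \<open>Squaring a positive part makes it C^1, and this is done twice. As a function of
  \<open>s\<close>, later the squared norm, the cutoff is 1 for \<open>s \<le> R\<^sup>2\<close> and
  0 for \<open>s \<ge> R\<^sup>2 + 1\<close>.\<close>

definition radial_cutoff :: "real \<Rightarrow> real \<Rightarrow> real" where
  "radial_cutoff R s = (max 0 (1 - (max 0 (s - R\<^sup>2))\<^sup>2))\<^sup>2"

definition radial_cutoff' :: "real \<Rightarrow> real \<Rightarrow> real" where
  "radial_cutoff' R s = - (2 * max 0 (1 - (max 0 (s - R\<^sup>2))\<^sup>2) * (2 * max 0 (s - R\<^sup>2)))"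

lemma DERIV_radial_cutoff: "(radial_cutoff R has_real_derivative radial_cutoff' R s) (at s)"
proof -
  have "((\<lambda>s. 1 - (max 0 (s - R\<^sup>2))\<^sup>2) has_real_derivative - (2 * max 0 (s - R\<^sup>2))) (at s)"
  proof -
    have "((\<lambda>s. s - R\<^sup>2) has_real_derivative 1) (at s)" by (auto intro!: derivative_eq_intros)
    from DERIV_diff[OF DERIV_const[of 1] DERIV_chain2[OF DERIV_max_sq this]] show ?thesis by simp
  qed
  from DERIV_chain2[OF DERIV_max_sq this] show ?thesis
    unfolding radial_cutoff_def[abs_def] radial_cutoff'_def by simp
qed

lemma radial_cutoff_bounds:
  "0 \<le> radial_cutoff R s" "radial_cutoff R s \<le> 1" "\<bar>radial_cutoff' R s\<bar> \<le> 4"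
proof -
  let ?a = "max 0 (s - R\<^sup>2)" and ?b = "max 0 (1 - (max 0 (s - R\<^sup>2))\<^sup>2)"
  have b: "0 \<le> ?b" "?b \<le> 1" by auto
  show "0 \<le> radial_cutoff R s" by (simp add: radial_cutoff_def)
  show "radial_cutoff R s \<le> 1" unfolding radial_cutoff_def using b by (rule power_le_one)
  have "?b * ?a \<le> 1"
  proof (cases "?a \<le> 1")
    case True
    then show ?thesis using b by (intro mult_le_one) auto
  next
    case False
    then have "?a\<^sup>2 \<ge> 1" by (simp add: one_le_power)
    then have "?b = 0" by simp
    then show ?thesis by simp
  qed
  moreover have "0 \<le> ?b * ?a" using b by simp
  moreover have "radial_cutoff' R s = - (4 * (?b * ?a))" unfolding radial_cutoff'_def by simp
  ultimately show "\<bar>radial_cutoff' R s\<bar> \<le> 4" by linarith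
qed

definition ball_cutoff :: "real \<Rightarrow> real ^ 'n \<Rightarrow> real" where
  "ball_cutoff R x = radial_cutoff R ((norm x)\<^sup>2)"

lemma ball_cutoff_bounds: "0 \<le> ball_cutoff R x" "ball_cutoff R x \<le> 1"
  by (simp_all add: ball_cutoff_def radial_cutoff_bounds)

lemma C1_with_ball_cutoff: "C1_with (ball_cutoff R) (\<lambda>i x. radial_cutoff' R ((norm x)\<^sup>2) * (2 * x $ i))"
proof -
  have "continuous_on UNIV (radial_cutoff' R)"
    unfolding radial_cutoff'_def by (intro continuous_intros)
  from C1_with_compose[OF C1_with_norm_sq UNIV_I DERIV_radial_cutoff this]
  show ?thesis by (simp add: ball_cutoff_def[abs_def])
qed

lemma ball_cutoff_eq_1: "R \<ge> 0 \<Longrightarrow> norm x \<le> R \<Longrightarrow> ball_cutoff R x = 1" "R \<ge> 0 \<Longrightarrow> norm x \<le> R \<Longrightarrow> radial_cutoff' R ((norm x)\<^sup>2) = 0"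
  using power_mono[of "norm x" R 2] by (auto simp: ball_cutoff_def radial_cutoff_def radial_cutoff'_def)

lemma ball_cutoff_eq_0: 
  assumes "R \<ge> 0" "norm x > R + 1"
  shows "ball_cutoff R x = 0"
proof -
  have "(norm x)\<^sup>2 \<ge> (R + 1)\<^sup>2" using assms by (intro power_mono) auto
  then have "(norm x)\<^sup>2 - R\<^sup>2 \<ge> 1" using assms(1) by (simp add: power2_eq_square algebra_simps)
  then have "max 0 ((norm x)\<^sup>2 - R\<^sup>2) \<ge> 1" by simp
  then have "(max 0 ((norm x)\<^sup>2 - R\<^sup>2))\<^sup>2 \<ge> 1" by (rule one_le_power)
  then show ?thesis by (simp add: ball_cutoff_def radial_cutoff_def)
qed

text \<open>Compact support is moved from the test function to \<open>u\<close>: a cutoff equal to 1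
  on the support of \<open>u\<close> makes any C^1 function admissible.\<close>

lemma weak_gradient_test_compact:
  fixes u :: "real ^ 'n \<Rightarrow> real"
  assumes u: "has_weak_gradient u g" and x: "C1_with \<xi> X" and R: "R \<ge> 0"
    and s: "\<And>x. norm x > R \<Longrightarrow> u x = 0" "\<And>x. norm x > R \<Longrightarrow> g x = 0"
  shows "(\<integral>x. u x * X i x \<partial>lebesgue) = - (\<integral>x. g x $ i * \<xi> x \<partial>lebesgue)"
proof -
  have "(\<integral>x. u x * (X i x * ball_cutoff R x + \<xi> x * (radial_cutoff' R ((norm x)\<^sup>2) * (2 * x $ i))) \<partial>lebesgue)
     = - (\<integral>x. g x $ i * (\<xi> x * ball_cutoff R x) \<partial>lebesgue)"
    by (rule weak_gradient_test[OF u C1_with_mult[OF x C1_with_ball_cutoff], of "R + 1"]) (simp add: ball_cutoff_eq_0 R)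
  moreover have "u x * (X i x * ball_cutoff R x + \<xi> x * (radial_cutoff' R ((norm x)\<^sup>2) * (2 * x $ i))) = u x * X i x" for x
    using s(1)[of x] ball_cutoff_eq_1[OF R, of x] by (cases "norm x \<le> R") auto
  moreover have "g x $ i * (\<xi> x * ball_cutoff R x) = g x $ i * \<xi> x" for x
    using s(2)[of x] ball_cutoff_eq_1[OF R, of x] by (cases "norm x \<le> R") auto
  ultimately show ?thesis by simp
qed

section \<open>Integration by parts against the weak Laplacian of the weight\<close>

lemma conv_ddmollifier_laplacian:
  assumes "has_weak_laplacian u l"
  shows "(\<Sum>i\<in>UNIV. conv (partial_deriv i (dmollifier i n)) u x) = moll n l x"
proof -
  have L: "L1_loc lebesgue u" using assms by (simp add: has_weak_laplacian_def)
  have dd: "partial_deriv i (partial_deriv i (\<lambda>y. mollifier n (x - y))) = (\<lambda>y. partial_deriv i (dmollifier i n) (x - y))" for i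
  proof (rule has_partial_unique[OF has_partial_of_Cc_infinity[OF Cc_infinity_partial[OF mollifier_Cc_infinity]]])
    show "has_partial i (partial_deriv i (\<lambda>y. mollifier n (x - y))) (\<lambda>y. partial_deriv i (dmollifier i n) (x - y))"
      unfolding partial_deriv_mollifier_shift
      using has_partial_uminus[OF has_partial_reflect[OF has_partial_of_Cc_infinity[OF Cc_infinity_partial[OF mollifier_in_Cc_infinity]]]]
      by simp
  qed
  have "(\<integral>y. u y * (\<Sum>i\<in>UNIV. partial_deriv i (partial_deriv i (\<lambda>y. mollifier n (x - y))) y) \<partial>lebesgue)
      = (\<integral>y. l y * mollifier n (x - y) \<partial>lebesgue)"
    using assms mollifier_Cc_infinity unfolding has_weak_laplacian_def by blast
  moreover have "(\<integral>y. u y * (\<Sum>i\<in>UNIV. partial_deriv i (partial_deriv i (\<lambda>y. mollifier n (x - y))) y) \<partial>lebesgue)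
     = (\<Sum>i\<in>UNIV. \<integral>y. partial_deriv i (dmollifier i n) (x - y) * u y \<partial>lebesgue)"
    unfolding dd using conv_integrable[OF ddmollifier_kernel L]
    by (subst Bochner_Integration.integral_sum[symmetric]) (auto simp: sum_distrib_left mult.commute)
  ultimately show ?thesis by (simp add: moll_def conv_def mult.commute)
qed

lemma moll_cmult: "moll n (\<lambda>x. c * f x) x = c * moll n f x"
  unfolding moll_def conv_def by (simp add: mult.left_commute[of _ c])

lemma L1_loc_nth_sq:
  fixes w :: "real ^ 'n \<Rightarrow> real ^ 'm"
  assumes "w \<in> borel_measurable lebesgue" and w2: "L1_loc lebesgue (\<lambda>x. (norm (w x))\<^sup>2)"
  shows "L1_loc lebesgue (\<lambda>x. (w x $ i)\<^sup>2)"
  by (rule L1_loc_bound[OF w2])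
    (auto intro!: borel_measurable_power borel_measurable_nth assms(1) AE_I2 power_mono component_le_norm_cart
      simp: abs_le_square_iff[symmetric])

lemma AE_ptw_compose:
  assumes l: "AE x in lebesgue. norm x \<le> R \<longrightarrow> (\<lambda>n. F n x) \<longlonglongrightarrow> f x"
    and c: "continuous_on S h" and S: "\<And>n x. F n x \<in> S" "\<And>x. f x \<in> S"
  shows "AE x in lebesgue. norm x \<le> R \<longrightarrow> (\<lambda>n. h (F n x)) \<longlonglongrightarrow> h (f x)"
  using l by eventually_elim (auto intro!: continuous_on_tendsto_compose[OF c] simp: S)

text \<open>The weak form of \<open>div (h \<mu> grad \<mu>) = h \<mu> * l + h' \<mu> * |grad
  \<mu>|^2\<close>, where \<open>\<mu> = v\<^sup>2\<close> and \<open>grad \<mu> = 2 v w\<close>. It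
  is classical for the mollified weight. In the limit the bound on \<open>h\<close> handles the
  Laplacian, while the bound on \<open>s * h' s\<close> absorbs the factor \<mu> in the
  Cauchy-Schwarz estimate of the squared gradient.\<close>

lemma weak_laplacian_compose:
  fixes v :: "real ^ 'n \<Rightarrow> real" and w :: "real ^ 'n \<Rightarrow> real ^ 'n"
  assumes u: "has_weak_gradient (\<lambda>x. (v x)\<^sup>2) (\<lambda>x. (2 * v x) *\<^sub>R w x)" and l: "has_weak_laplacian (\<lambda>x. (v x)\<^sup>2) l"
    and w: "w \<in> borel_measurable lebesgue" "L1_loc lebesgue (\<lambda>x. (norm (w x))\<^sup>2)"
    and h: "\<And>s. s \<ge> 0 \<Longrightarrow> (h has_real_derivative h' s) (at s)" "continuous_on {0..} h'"
    and b: "\<And>s. s \<ge> 0 \<Longrightarrow> \<bar>h s\<bar> \<le> B" "\<And>s. s \<ge> 0 \<Longrightarrow> \<bar>s * h' s\<bar> \<le> B"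
    and e: "C1_with \<eta> E" and s: "\<And>x. norm x > R \<Longrightarrow> \<eta> x = 0"
  shows "(\<integral>x. (\<Sum>i\<in>UNIV. E i x * (h ((v x)\<^sup>2) * (2 * v x * w x $ i))) \<partial>lebesgue) =
    - (\<integral>x. \<eta> x * (h ((v x)\<^sup>2) * l x + h' ((v x)\<^sup>2) * (4 * (v x)\<^sup>2 * (norm (w x))\<^sup>2)) \<partial>lebesgue)"
proof -
  let ?\<mu> = "\<lambda>x. (v x)\<^sup>2"
  let ?q = "\<lambda>i x. 2 * v x * w x $ i"
  note m = has_weak_gradient_L1_loc[OF u]
  have ml: "L1_loc lebesgue l" using l by (simp add: has_weak_laplacian_def)
  have wi: "L1_loc lebesgue (\<lambda>x. (w x $ i)\<^sup>2)" for i by (rule L1_loc_nth_sq[OF w])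
  have mq: "L1_loc lebesgue (?q i)" for i using m(3)[of i] by simp
  obtain r :: "nat \<Rightarrow> nat" where r: "dom_lim R (\<lambda>n. moll (r n) ?\<mu>) ?\<mu>"
    "\<And>i. dom_lim R (\<lambda>n. moll (r n) (\<lambda>x. ((2 * v x) *\<^sub>R w x) $ i)) (\<lambda>x. ((2 * v x) *\<^sub>R w x) $ i)"
    "\<And>f. f \<in> insert l (range (\<lambda>i x. (w x $ i)\<^sup>2)) \<Longrightarrow> dom_lim R (\<lambda>n. moll (r n) f) f"
    by (rule weak_gradient_approx[OF u, of "insert l (range (\<lambda>i x. (w x $ i)\<^sup>2))" R]) (use ml wi in auto)
  have rq: "dom_lim R (\<lambda>n. moll (r n) (?q i)) (?q i)" for i using r(2)[of i] by simp
  have rl: "dom_lim R (\<lambda>n. moll (r n) l) l" by (rule r(3)) auto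
  have rw: "dom_lim R (\<lambda>n. moll (r n) (\<lambda>x. (w x $ i)\<^sup>2)) (\<lambda>x. (w x $ i)\<^sup>2)" for i by (rule r(3)) auto
  define M where "M n = moll (r n) ?\<mu>" for n
  define D where "D n i = moll (r n) (?q i)" for n i
  define DD where "DD n i j = conv (partial_deriv j (dmollifier i (r n))) ?\<mu>" for n i j
  have M0: "M n x \<ge> 0" for n x unfolding M_def by (rule moll_nonneg) simp
  have CM: "C1_with (M n) (D n)" for n using C1_with_moll[OF u, of "r n"] by (simp add: M_def D_def[abs_def])
  have D_eq: "D n i = conv (dmollifier i (r n)) ?\<mu>" for n i
    using conv_dmollifier_weak_gradient[OF u, of i "r n"] by (simp add: D_def)
  have CD: "C1_with (D n i) (DD n i)" for n i
    unfolding D_eq DD_def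
    by (rule C1_with_conv[OF Cc_infinity_partial[OF mollifier_in_Cc_infinity] dmollifier_kernel m(1)])
  have LD: "(\<Sum>i\<in>UNIV. DD n i i x) = moll (r n) l x" for n x
    unfolding DD_def by (rule conv_ddmollifier_laplacian[OF l])
  have hc: "continuous_on {0..} h" using h(1) by (meson DERIV_continuous_on atLeast_iff has_field_derivative_at_within)
  have ChM: "C1_with (\<lambda>x. h (M n x)) (\<lambda>i x. h' (M n x) * D n i x)" for n
    by (rule C1_with_compose[OF CM, where S = "{0..}"]) (use M0 h in auto)
  have cont: "continuous_on UNIV \<eta>" "\<And>i. continuous_on UNIV (E i)" "\<And>n. continuous_on UNIV (M n)"
    "\<And>n i. continuous_on UNIV (D n i)" "\<And>n i j. continuous_on UNIV (DD n i j)"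
    using e CM CD by (auto simp: C1_with_def)
  have conth: "continuous_on UNIV (\<lambda>x. h (M n x))" "continuous_on UNIV (\<lambda>x. h' (M n x))" for n
    using M0 by (auto intro!: continuous_on_compose2[OF hc] continuous_on_compose2[OF h(2)] cont)
  have sE: "E i x = 0" if "norm x > R" for i x by (rule C1_with_support[OF e s that])
  \<comment> \<open>The divergence of \<open>h (M n)\<close> times the gradient of
    \<open>M n\<close>, with the pure second derivatives already summed to the mollified
    Laplacian.\<close>
  define P where "P n x = h' (M n x) * (\<Sum>i\<in>UNIV. (D n i x)\<^sup>2) + h (M n x) * moll (r n) l x" for n x
  have step: "(\<Sum>i\<in>UNIV. \<integral>x. (h (M n x) * D n i x) * E i x \<partial>lebesgue) = - (\<integral>x. P n x * \<eta> x \<partial>lebesgue)" for n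
  proof -
    have ibp: "(\<integral>x. h (M n x) * D n i x * E i x \<partial>lebesgue) =
        - (\<integral>x. (h' (M n x) * D n i x * D n i x + h (M n x) * DD n i i x) * \<eta> x \<partial>lebesgue)" for i
      by (rule C1_with_ibp[OF C1_with_mult[OF ChM CD] e s])
    have int: "integrable lebesgue (\<lambda>x. (h' (M n x) * D n i x * D n i x + h (M n x) * DD n i i x) * \<eta> x)" for i
      using s by (intro integrable_continuous_support[where R = R] continuous_intros cont conth) auto
    have "(\<Sum>i\<in>UNIV. \<integral>x. h (M n x) * D n i x * E i x \<partial>lebesgue) =
        - (\<integral>x. (\<Sum>i\<in>UNIV. (h' (M n x) * D n i x * D n i x + h (M n x) * DD n i i x) * \<eta> x) \<partial>lebesgue)"
      unfolding ibp using int by (simp add: sum_negf)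
    also have "(\<lambda>x. \<Sum>i\<in>UNIV. (h' (M n x) * D n i x * D n i x + h (M n x) * DD n i i x) * \<eta> x) = (\<lambda>x. P n x * \<eta> x)"
      unfolding P_def LD[symmetric]
      by (simp add: fun_eq_iff sum_distrib_left sum_distrib_right sum.distrib power2_eq_square algebra_simps)
    finally show ?thesis .
  qed
  obtain B1 where B1: "\<And>x. norm x \<le> R \<Longrightarrow> \<bar>\<eta> x\<bar> \<le> B1" using continuous_cball_bound[OF cont(1)] by metis
  have "\<exists>K. \<forall>x. norm x \<le> R \<longrightarrow> \<bar>E i x\<bar> \<le> K" for i using continuous_cball_bound[OF cont(2)[of i]] by metis
  then obtain B2 where B2: "\<And>i x. norm x \<le> R \<Longrightarrow> \<bar>E i x\<bar> \<le> B2 i" by metis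
  have rM: "dom_lim R M ?\<mu>" using r(1) by (simp add: M_def[abs_def])
  have pM: "AE x in lebesgue. norm x \<le> R \<longrightarrow> (\<lambda>n. h (M n x)) \<longlonglongrightarrow> h (?\<mu> x)"
    "AE x in lebesgue. norm x \<le> R \<longrightarrow> (\<lambda>n. h' (M n x)) \<longlonglongrightarrow> h' (?\<mu> x)"
    by (rule AE_ptw_compose[OF dom_lim_ptw[OF rM] hc]; use M0 in simp)
      (rule AE_ptw_compose[OF dom_lim_ptw[OF rM] h(2)]; use M0 in simp)
  have d1: "dom_lim R (\<lambda>n x. h (M n x) * D n i x) (\<lambda>x. h (?\<mu> x) * ?q i x)" for i
    using rq[of i] unfolding D_def by (rule dom_lim_mult_bounded[OF _ pM(1)]) (use b(1) M0 in auto)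
  have cs: "\<bar>h' (M n x) * (D n i x)\<^sup>2\<bar> \<le> 0 + 4 * B * \<bar>moll (r n) (\<lambda>x. (w x $ i)\<^sup>2) x\<bar>" for n i x
  proof -
    have "(D n i x)\<^sup>2 \<le> moll (r n) (\<lambda>x. (2 * v x)\<^sup>2) x * moll (r n) (\<lambda>x. (w x $ i)\<^sup>2) x"
      unfolding D_def
    proof (rule moll_Cauchy_Schwarz)
      show "L1_loc lebesgue (\<lambda>x. (2 * v x)\<^sup>2)" using L1_loc_cmult[OF m(1), of 4] by (simp add: power_mult_distrib)
      show "L1_loc lebesgue (\<lambda>x. (w x $ i)\<^sup>2)" by (rule wi)
      show "L1_loc lebesgue (\<lambda>x. 2 * v x * w x $ i)" by (rule mq)
    qed
    also have "moll (r n) (\<lambda>x. (2 * v x)\<^sup>2) x = 4 * M n x" unfolding M_def by (simp add: power_mult_distrib moll_cmult)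
    finally have 1: "(D n i x)\<^sup>2 \<le> 4 * M n x * moll (r n) (\<lambda>x. (w x $ i)\<^sup>2) x" .
    have 2: "moll (r n) (\<lambda>x. (w x $ i)\<^sup>2) x \<ge> 0" by (rule moll_nonneg) simp
    have "\<bar>h' (M n x)\<bar> * (D n i x)\<^sup>2 \<le> \<bar>h' (M n x)\<bar> * (4 * M n x * moll (r n) (\<lambda>x. (w x $ i)\<^sup>2) x)"
      using 1 by (rule mult_left_mono) simp
    also have "\<dots> = 4 * \<bar>M n x * h' (M n x)\<bar> * moll (r n) (\<lambda>x. (w x $ i)\<^sup>2) x"
      using M0[of n x] by (simp add: abs_mult)
    also have "\<dots> \<le> 4 * B * moll (r n) (\<lambda>x. (w x $ i)\<^sup>2) x"
      using b(2)[OF M0[of n x]] 2 by (intro mult_right_mono mult_left_mono) auto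
    finally show ?thesis using 2 by (simp add: abs_mult)
  qed
  have B0: "B \<ge> 0" using b(1)[of 0] by simp
  have "dom_lim R (\<lambda>n x. h' (M n x) * (D n i x)\<^sup>2) (\<lambda>x. h' (?\<mu> x) * (?q i x)\<^sup>2)" for i
  proof (rule dom_lim_bound[OF rw[of i] _ cs])
    show "AE x in lebesgue. norm x \<le> R \<longrightarrow> (\<lambda>n. h' (M n x) * (D n i x)\<^sup>2) \<longlonglongrightarrow> h' (?\<mu> x) * (?q i x)\<^sup>2"
      using pM(2) dom_lim_ptw[OF rq[of i]] unfolding D_def
      by eventually_elim (auto intro!: tendsto_mult tendsto_power)
  qed (use B0 in simp)
  then have "dom_lim R (\<lambda>n x. (\<Sum>i\<in>UNIV. h' (M n x) * (D n i x)\<^sup>2)) (\<lambda>x. (\<Sum>i\<in>UNIV. h' (?\<mu> x) * (?q i x)\<^sup>2))"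
    by (intro dom_lim_sum) auto
  from dom_lim_add[OF this dom_lim_mult_bounded[OF rl pM(1)]] b(1)[OF M0]
  have "dom_lim R (\<lambda>n x. (\<Sum>i\<in>UNIV. h' (M n x) * (D n i x)\<^sup>2) + h (M n x) * moll (r n) l x)
     (\<lambda>x. (\<Sum>i\<in>UNIV. h' (?\<mu> x) * (?q i x)\<^sup>2) + h (?\<mu> x) * l x)" by blast
  moreover have "(\<Sum>i\<in>UNIV. h' (?\<mu> x) * (?q i x)\<^sup>2) = h' (?\<mu> x) * (4 * ?\<mu> x * (norm (w x))\<^sup>2)" for x
    by (simp add: norm_sq_vec power_mult_distrib sum_distrib_left)
  ultimately have dP: "dom_lim R P (\<lambda>x. h' (?\<mu> x) * (4 * ?\<mu> x * (norm (w x))\<^sup>2) + h (?\<mu> x) * l x)"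
    unfolding P_def[abs_def] by (simp add: sum_distrib_left)
  have hm: "(\<lambda>x. h (?\<mu> x)) \<in> borel_measurable lebesgue" "(\<lambda>x. h' (?\<mu> x)) \<in> borel_measurable lebesgue"
  proof -
    have k: "(\<lambda>x. k (?\<mu> x)) \<in> borel_measurable lebesgue" if k: "continuous_on {0..} k" for k :: "real \<Rightarrow> real"
    proof -
      have "continuous_on UNIV (\<lambda>s. k \<bar>s\<bar>)" by (rule continuous_on_compose2[OF k]) (auto intro!: continuous_intros)
      from continuous_on_real_compose_measurable[OF this m(4)] show ?thesis by simp
    qed
    show "(\<lambda>x. h (?\<mu> x)) \<in> borel_measurable lebesgue" "(\<lambda>x. h' (?\<mu> x)) \<in> borel_measurable lebesgue"
      by (rule k[OF hc], rule k[OF h(2)])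
  qed
  have mP: "P n \<in> borel_measurable lebesgue" for n unfolding P_def[abs_def]
    by (intro borel_measurable_add borel_measurable_times borel_measurable_sum borel_measurable_power
        borel_measurable_lebesgue_continuous[OF cont(4)] borel_measurable_lebesgue_continuous[OF conth(1)]
        borel_measurable_lebesgue_continuous[OF conth(2)] moll_measurable ml)
  have mP': "(\<lambda>x. h' (?\<mu> x) * (4 * ?\<mu> x * (norm (w x))\<^sup>2) + h (?\<mu> x) * l x) \<in> borel_measurable lebesgue"
    by (intro borel_measurable_add borel_measurable_times hm L1_loc_measurable[OF w(2)] borel_measurable_const m(4) L1_loc_measurable[OF ml])
  note I1 = dom_lim_integral[OF d1 _ _ borel_measurable_lebesgue_continuous[OF cont(2)] B2 sE]
  have m1: "(\<lambda>x. h (M n x) * D n i x) \<in> borel_measurable lebesgue" for n i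
    by (intro borel_measurable_times borel_measurable_lebesgue_continuous conth cont)
  have m2: "(\<lambda>x. h (?\<mu> x) * ?q i x) \<in> borel_measurable lebesgue" for i
    by (intro borel_measurable_times hm L1_loc_measurable[OF mq])
  have "(\<lambda>n. \<Sum>i\<in>UNIV. \<integral>x. (h (M n x) * D n i x) * E i x \<partial>lebesgue) \<longlonglongrightarrow>
      (\<Sum>i\<in>UNIV. \<integral>x. (h (?\<mu> x) * ?q i x) * E i x \<partial>lebesgue)"
    by (intro tendsto_sum I1(1) m1 m2)
  moreover have "(\<lambda>n. - (\<integral>x. P n x * \<eta> x \<partial>lebesgue)) \<longlonglongrightarrow>
      - (\<integral>x. (h' (?\<mu> x) * (4 * ?\<mu> x * (norm (w x))\<^sup>2) + h (?\<mu> x) * l x) * \<eta> x \<partial>lebesgue)"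
    by (intro tendsto_minus dom_lim_integral(1)[OF dP mP mP' borel_measurable_lebesgue_continuous[OF cont(1)] B1 s])
  ultimately have "(\<Sum>i\<in>UNIV. \<integral>x. (h (?\<mu> x) * ?q i x) * E i x \<partial>lebesgue) =
      - (\<integral>x. (h' (?\<mu> x) * (4 * ?\<mu> x * (norm (w x))\<^sup>2) + h (?\<mu> x) * l x) * \<eta> x \<partial>lebesgue)"
    unfolding step by (rule LIMSEQ_unique)
  moreover have "(\<Sum>i\<in>UNIV. \<integral>x. (h (?\<mu> x) * ?q i x) * E i x \<partial>lebesgue) =
     (\<integral>x. (\<Sum>i\<in>UNIV. (h (?\<mu> x) * ?q i x) * E i x) \<partial>lebesgue)"
    by (intro Bochner_Integration.integral_sum[symmetric] I1(3) m1 m2)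
  ultimately show ?thesis by (simp add: mult_ac add_ac)
qed

text \<open>Passes from C^1 test functions to \<zeta>, which is only bounded with a square
  integrable weak gradient. Mollifying \<zeta> keeps its bound, which suffices against the locally
  integrable \<open>m\<close>; for the other pairing
  \<open>\<bar>a * b\<bar> \<le> a\<^sup>2 + b\<^sup>2\<close> and Jensen give a majorant.\<close>

lemma weak_duality:
  fixes \<zeta> :: "real ^ 'n \<Rightarrow> real" and z :: "real ^ 'n \<Rightarrow> real ^ 'n"
  assumes z: "has_weak_gradient \<zeta> z" and b: "\<And>x. \<bar>\<zeta> x\<bar> \<le> C"
    and s: "\<And>x. norm x > R \<Longrightarrow> \<zeta> x = 0" "\<And>x. norm x > R \<Longrightarrow> z x = 0"
    and z2: "L1_loc lebesgue (\<lambda>x. (norm (z x))\<^sup>2)"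
    and p: "\<And>i. p i \<in> borel_measurable lebesgue" "\<And>i. L1_loc lebesgue (\<lambda>x. (p i x)\<^sup>2)" and m: "L1_loc lebesgue m"
    and test: "\<And>\<eta> E R. C1_with \<eta> E \<Longrightarrow> \<forall>x. norm x > R \<longrightarrow> \<eta> x = 0 \<Longrightarrow>
        (\<integral>x. (\<Sum>i\<in>UNIV. E i x * p i x) \<partial>lebesgue) = - (\<integral>x. \<eta> x * m x \<partial>lebesgue)"
  shows "(\<integral>x. (\<Sum>i\<in>UNIV. z x $ i * p i x) \<partial>lebesgue) = - (\<integral>x. \<zeta> x * m x \<partial>lebesgue)"
    and "integrable lebesgue (\<lambda>x. \<Sum>i\<in>UNIV. z x $ i * p i x)" and "integrable lebesgue (\<lambda>x. \<zeta> x * m x)"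
proof -
  note mz = has_weak_gradient_L1_loc[OF z]
  have zi: "L1_loc lebesgue (\<lambda>x. (z x $ i)\<^sup>2)" for i by (rule L1_loc_nth_sq[OF mz(5) z2])
  \<comment> \<open>Mollification enlarges the support by at most 1, hence the radius
    \<open>R + 1\<close>.\<close>
  obtain r :: "nat \<Rightarrow> nat" where r: "dom_lim (R + 1) (\<lambda>n. moll (r n) \<zeta>) \<zeta>"
    "\<And>i. dom_lim (R + 1) (\<lambda>n. moll (r n) (\<lambda>x. z x $ i)) (\<lambda>x. z x $ i)"
    "\<And>f. f \<in> range (\<lambda>i x. (z x $ i)\<^sup>2) \<Longrightarrow> dom_lim (R + 1) (\<lambda>n. moll (r n) f) f"
    by (rule weak_gradient_approx[OF z, of "range (\<lambda>i x. (z x $ i)\<^sup>2)" "R + 1"]) (use zi in auto)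
  have rz: "dom_lim (R + 1) (\<lambda>n. moll (r n) (\<lambda>x. (z x $ i)\<^sup>2)) (\<lambda>x. (z x $ i)\<^sup>2)" for i by (rule r(3)) auto
  have sup: "moll n f x = 0" if "\<And>x. norm x > R \<Longrightarrow> f x = 0" "norm x > R + 1" for n f x
  proof -
    have "1 / (real n + 1) \<le> 1" by simp
    then have "norm x > R + 1 / (real n + 1)" using that(2) by linarith
    then show ?thesis unfolding moll_def by (intro conv_support[OF mollifier_kernel that(1)])
  qed
  have bz: "\<bar>moll n \<zeta> x\<bar> \<le> C" for n x
    using moll_abs_le[OF mz(1) L1_loc_continuous, of "\<lambda>_. C" n x] b by (simp add: moll_const)
  let ?I = "\<lambda>x. indicator (cball 0 (R + 1)) x :: real"
  have Im: "?I \<in> borel_measurable lebesgue" by (intro borel_measurable_indicator) simp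
  have d1: "dom_lim (R + 1) (\<lambda>n x. moll (r n) \<zeta> x * m x) (\<lambda>x. \<zeta> x * m x)"
    by (rule dom_lim_mult_bounded[OF dom_lim_const[OF m] dom_lim_ptw[OF r(1)] bz])
  have d2: "dom_lim (R + 1) (\<lambda>n x. moll (r n) (\<lambda>x. z x $ i) x * p i x) (\<lambda>x. z x $ i * p i x)" for i
  proof (rule dom_lim_bound[OF dom_lim_add[OF rz[of i] dom_lim_const[OF p(2)[of i]]], where A = 0 and C = 1])
    show "AE x in lebesgue. norm x \<le> R + 1 \<longrightarrow> (\<lambda>n. moll (r n) (\<lambda>x. z x $ i) x * p i x) \<longlonglongrightarrow> z x $ i * p i x"
      using dom_lim_ptw[OF r(2)[of i]] by eventually_elim (auto intro: tendsto_mult_right)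
    show "\<bar>moll (r n) (\<lambda>x. z x $ i) x * p i x\<bar> \<le> 0 + 1 * \<bar>moll (r n) (\<lambda>x. (z x $ i)\<^sup>2) x + (p i x)\<^sup>2\<bar>" for n x
    proof -
      have "(moll (r n) (\<lambda>x. z x $ i) x)\<^sup>2 \<le> moll (r n) (\<lambda>x. (z x $ i)\<^sup>2) x"
        using moll_Cauchy_Schwarz[OF zi[of i], of "\<lambda>_. 1" "r n" x] mz(3)[of i] by (simp add: L1_loc_continuous moll_const)
      moreover have "\<bar>a * b\<bar> \<le> a\<^sup>2 + b\<^sup>2" for a b :: real
      proof -
        have "2 * (\<bar>a\<bar> * \<bar>b\<bar>) \<le> a\<^sup>2 + b\<^sup>2"
          using zero_le_power2[of "\<bar>a\<bar> - \<bar>b\<bar>"] by (simp add: power2_eq_square algebra_simps)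
        then show ?thesis using abs_ge_zero[of "a * b"] unfolding abs_mult by linarith
      qed
      ultimately show ?thesis by (smt (verit))
    qed
  qed simp
  have M1: "(\<lambda>x. moll n \<zeta> x * m x) \<in> borel_measurable lebesgue" "(\<lambda>x. \<zeta> x * m x) \<in> borel_measurable lebesgue" for n
    by (intro borel_measurable_times moll_measurable mz L1_loc_measurable[OF m])+
  have M2: "(\<lambda>x. moll n (\<lambda>x. z x $ i) x * p i x) \<in> borel_measurable lebesgue" "(\<lambda>x. z x $ i * p i x) \<in> borel_measurable lebesgue" for n i
    by (intro borel_measurable_times moll_measurable mz p(1))+
  note I1 = dom_lim_integral[OF d1 M1(1) M1(2) Im, of 1]
  note I2 = dom_lim_integral[OF d2 M2(1) M2(2) Im, of 1]
  have e1: "(\<lambda>x. moll n \<zeta> x * m x * ?I x) = (\<lambda>x. moll n \<zeta> x * m x)" for n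
    using sup[OF s(1)] by (fastforce simp: fun_eq_iff indicator_def)
  have e2: "(\<lambda>x. \<zeta> x * m x * ?I x) = (\<lambda>x. \<zeta> x * m x)"
    using s(1) by (fastforce simp: fun_eq_iff indicator_def)
  have e3: "(\<lambda>x. moll n (\<lambda>x. z x $ i) x * p i x * ?I x) = (\<lambda>x. moll n (\<lambda>x. z x $ i) x * p i x)" for n i
    using sup[of "\<lambda>x. z x $ i"] s(2) by (fastforce simp: fun_eq_iff indicator_def)
  have e4: "(\<lambda>x. z x $ i * p i x * ?I x) = (\<lambda>x. z x $ i * p i x)" for i
    using s(2) by (fastforce simp: fun_eq_iff indicator_def)
  have "(\<lambda>n. \<Sum>i\<in>UNIV. \<integral>x. moll (r n) (\<lambda>x. z x $ i) x * p i x \<partial>lebesgue) \<longlonglongrightarrow> (\<Sum>i\<in>UNIV. \<integral>x. z x $ i * p i x \<partial>lebesgue)"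
    using I2(1) unfolding e3 e4 by (intro tendsto_sum) auto
  moreover have "(\<Sum>i\<in>UNIV. \<integral>x. moll (r n) (\<lambda>x. z x $ i) x * p i x \<partial>lebesgue) = - (\<integral>x. moll (r n) \<zeta> x * m x \<partial>lebesgue)" for n
  proof -
    have "(\<Sum>i\<in>UNIV. \<integral>x. moll (r n) (\<lambda>x. z x $ i) x * p i x \<partial>lebesgue) =
        (\<integral>x. (\<Sum>i\<in>UNIV. moll (r n) (\<lambda>x. z x $ i) x * p i x) \<partial>lebesgue)"
      using I2(2)[of n] unfolding e3 by (intro Bochner_Integration.integral_sum[symmetric]) auto
    also have "\<dots> = - (\<integral>x. moll (r n) \<zeta> x * m x \<partial>lebesgue)"
      by (rule test[OF C1_with_moll[OF z], of "R + 1"]) (intro allI impI sup[OF s(1)])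
    finally show ?thesis .
  qed
  moreover have "(\<lambda>n. - (\<integral>x. moll (r n) \<zeta> x * m x \<partial>lebesgue)) \<longlonglongrightarrow> - (\<integral>x. \<zeta> x * m x \<partial>lebesgue)"
    using I1(1) unfolding e1 e2 by (intro tendsto_minus) auto
  ultimately have "(\<Sum>i\<in>UNIV. \<integral>x. z x $ i * p i x \<partial>lebesgue) = - (\<integral>x. \<zeta> x * m x \<partial>lebesgue)"
    using LIMSEQ_unique by simp
  moreover have "(\<Sum>i\<in>UNIV. \<integral>x. z x $ i * p i x \<partial>lebesgue) = (\<integral>x. (\<Sum>i\<in>UNIV. z x $ i * p i x) \<partial>lebesgue)"
    using I2(3) unfolding e4 by (intro Bochner_Integration.integral_sum[symmetric]) auto
  ultimately show "(\<integral>x. (\<Sum>i\<in>UNIV. z x $ i * p i x) \<partial>lebesgue) = - (\<integral>x. \<zeta> x * m x \<partial>lebesgue)" by simp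
  show "integrable lebesgue (\<lambda>x. \<Sum>i\<in>UNIV. z x $ i * p i x)"
    using I2(3) unfolding e4 by (intro Bochner_Integration.integrable_sum) auto
  show "integrable lebesgue (\<lambda>x. \<zeta> x * m x)"
    using I1(3) unfolding e2 by auto
qed

section \<open>Local integrability of the Hardy weight\<close>

lemma L1_loc_mult_continuous:
  fixes f g :: "real ^ 'n \<Rightarrow> real"
  assumes "L1_loc lebesgue f" "continuous_on UNIV g" "\<And>x. norm x > R \<Longrightarrow> g x = 0"
  shows "integrable lebesgue (\<lambda>x. g x * f x)"
proof -
  obtain B where "\<And>x. norm x \<le> R \<Longrightarrow> \<bar>g x\<bar> \<le> B" using continuous_cball_bound[OF assms(2)] by metis
  then show ?thesis
    using L1_loc_mult_integrable[OF assms(1) borel_measurable_lebesgue_continuous[OF assms(2)], of R B] assms(3) by blast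
qed

text \<open>The left side is the divergence of \<open>v\<^sup>2 * chi / (s + e)\<close> times the
  vector x, with \<open>s = |x|^2\<close>; \<open>wx\<close> stands for the inner product of the
  gradient of \<open>v\<close> with x, \<open>W\<close> for the squared length of that gradient,
  \<open>k\<close> for the derivative of the cutoff \<open>chi\<close>. From
  \<open>N \<ge> 3\<close> the field contributes at least \<open>1 / (s + e)\<close>, since 3 - 2 =
  1, and half of this absorbs the mixed term by Young's inequality.\<close>

lemma hardy_pointwise:
  fixes N s e v n2 wx chi k R1 :: real
  assumes N: "N \<ge> 3" and s: "s \<ge> 0" and e: "e > 0" and wx: "wx\<^sup>2 \<le> W * s" and W: "W \<ge> 0" 
    and c: "0 \<le> chi" and k: "\<bar>k\<bar> \<le> 4 * I"
  shows "v\<^sup>2 * (k * 2 * s / (s + e) + chi * (N / (s + e) - 2 * s / (s + e)\<^sup>2)) + 2 * v * wx * chi / (s + e)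
     \<ge> chi * v\<^sup>2 / (2 * (s + e)) - 2 * chi * W - 8 * I * v\<^sup>2"
proof -
  define q where "q = s + e"
  have q: "q > 0" "s \<le> q" using s e by (auto simp: q_def)
  have I0: "0 \<le> I" using k by linarith
  have "s / q \<le> 1" "0 \<le> s / q" using q s by (auto simp: divide_le_eq)
  then have "2 * (s / q) \<le> 2" "0 \<le> 2 * (s / q)" by linarith+
  then have "\<bar>k\<bar> * (2 * (s / q)) \<le> 4 * I * 2"
    by (intro mult_mono[OF k]) (use I0 in auto)
  then have "\<bar>k * 2 * (s / q)\<bar> \<le> 8 * I"
    using q s by (simp add: abs_mult)
  then have "- (8 * I) \<le> k * 2 * (s / q)" by linarith
  then have "v\<^sup>2 * - (8 * I) \<le> v\<^sup>2 * (k * 2 * (s / q))" by (rule mult_left_mono) simp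
  then have 1: "v\<^sup>2 * (k * 2 * s / q) \<ge> - (8 * I * v\<^sup>2)" by (simp add: mult_ac)
  have "N / q - 2 * s / q\<^sup>2 \<ge> 1 / q"
  proof -
    have "2 * s / q\<^sup>2 \<le> 2 / q" using q by (simp add: power2_eq_square field_simps)
    moreover have "3 / q \<le> N / q" using N q by (simp add: divide_right_mono)
    moreover have "3 / q - 2 / q = 1 / q" by (simp add: diff_divide_distrib[symmetric])
    ultimately show ?thesis by linarith
  qed
  then have 2: "v\<^sup>2 * (N / q - 2 * s / q\<^sup>2) \<ge> v\<^sup>2 * (1 / q)" by (intro mult_left_mono) auto
  have 3: "2 * v * wx / q \<ge> - (v\<^sup>2 / (2 * q)) - 2 * W"
  proof -
    have "0 \<le> (v / 2 + wx)\<^sup>2" by simp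
    then have "2 * v * wx \<ge> - (v\<^sup>2 / 2) - 2 * wx\<^sup>2"
      by (simp add: power2_eq_square field_simps)
    moreover have "wx\<^sup>2 \<le> W * q" using wx mult_left_mono[OF q(2) W] by linarith
    ultimately have "2 * v * wx \<ge> - (v\<^sup>2 / 2) - 2 * (W * q)" by linarith
    then have "2 * v * wx / q \<ge> (- (v\<^sup>2 / 2) - 2 * (W * q)) / q" using q by (simp add: divide_right_mono)
    also have "(- (v\<^sup>2 / 2) - 2 * (W * q)) / q = - (v\<^sup>2 / (2 * q)) - 2 * W" using q by (simp add: field_simps)
    finally show ?thesis .
  qed
  have "chi * (v\<^sup>2 * (N / q - 2 * s / q\<^sup>2) + 2 * v * wx / q) \<ge> chi * (v\<^sup>2 / (2 * q) - 2 * W)"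
  proof (rule mult_left_mono[OF _ c])
    have "v\<^sup>2 * (1 / q) - v\<^sup>2 / (2 * q) = v\<^sup>2 / (2 * q)" by (simp add: field_simps)
    then show "v\<^sup>2 / (2 * q) - 2 * W \<le> v\<^sup>2 * (N / q - 2 * s / q\<^sup>2) + 2 * v * wx / q"
      using 2 3 by linarith
  qed
  then show ?thesis using 1 unfolding q_def[symmetric] by (simp add: algebra_simps)
qed

lemma C1_with_radial_field:
  assumes a: "\<And>s. s \<ge> 0 \<Longrightarrow> (a has_real_derivative a' s) (at s)" and c: "continuous_on {0..} a'"
  shows "C1_with (\<lambda>x :: real ^ 'n. a ((norm x)\<^sup>2) * x $ j)
    (\<lambda>i x. a' ((norm x)\<^sup>2) * (2 * x $ i) * x $ j + a ((norm x)\<^sup>2) * (if i = j then 1 else 0))"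
proof -
  have "C1_with (\<lambda>x :: real ^ 'n. a ((norm x)\<^sup>2)) (\<lambda>i x. a' ((norm x)\<^sup>2) * (2 * x $ i))"
    by (rule C1_with_compose[OF C1_with_norm_sq, where S = "{0..}"]) (use a c in auto)
  from C1_with_mult[OF this C1_with_nth] show ?thesis .
qed

text \<open>The divergence of a compactly supported field has integral 0, so the pointwise bound
  estimates the integral of \<open>v\<^sup>2 / (|x|^2 + e)\<close> by those of \<open>|w|^2\<close>
  and \<open>v\<^sup>2\<close> over a ball, uniformly in \<open>e\<close>. Fatou's lemma removes
  \<open>e\<close>.\<close>

lemma weight_over_norm_sq_L1_loc:
  fixes v :: "real ^ 'n \<Rightarrow> real" and w :: "real ^ 'n \<Rightarrow> real ^ 'n"
  assumes N: "CARD('n) \<ge> 3" and u: "has_weak_gradient (\<lambda>x. (v x)\<^sup>2) (\<lambda>x. (2 * v x) *\<^sub>R w x)"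
    and w: "w \<in> borel_measurable lebesgue" "L1_loc lebesgue (\<lambda>x. (norm (w x))\<^sup>2)"
  shows "L1_loc lebesgue (\<lambda>x. (v x)\<^sup>2 / (norm x)\<^sup>2)"
proof (rule L1_locI)
  fix R :: real assume R: "R > 0"
  note m = has_weak_gradient_L1_loc[OF u]
  let ?k = "\<lambda>x :: real ^ 'n. radial_cutoff' R ((norm x)\<^sup>2)"
  let ?J = "\<lambda>x :: real ^ 'n. indicator (cball 0 (R + 1)) x :: real"
  have cc: "continuous_on UNIV (ball_cutoff R :: real ^ 'n \<Rightarrow> real)" using C1_with_ball_cutoff unfolding C1_with_def by blast
  have s0: "ball_cutoff R x = 0" if "norm x > R + 1" for x :: "real ^ 'n" by (rule ball_cutoff_eq_0) (use R that in auto)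
  define K where "K = (\<integral>x. 2 * (ball_cutoff R x * (norm (w x))\<^sup>2) + 8 * (?J x *\<^sub>R (v x)\<^sup>2) \<partial>lebesgue)"
  have iK: "integrable lebesgue (\<lambda>x. 2 * (ball_cutoff R x * (norm (w x))\<^sup>2) + 8 * (?J x *\<^sub>R (v x)\<^sup>2))"
    by (intro Bochner_Integration.integrable_add integrable_mult_right L1_loc_mult_continuous[OF w(2) cc s0] L1_loc_cball[OF m(1)])
  have main: "integrable lebesgue (\<lambda>x. ball_cutoff R x * (v x)\<^sup>2 / (2 * ((norm x)\<^sup>2 + e))) \<and>
     (\<integral>x. ball_cutoff R x * (v x)\<^sup>2 / (2 * ((norm x)\<^sup>2 + e)) \<partial>lebesgue) \<le> K" if e: "e > 0" for e
  proof -
    let ?q = "\<lambda>x :: real ^ 'n. (norm x)\<^sup>2 + e"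
    have q: "?q x > 0" for x :: "real ^ 'n" using e by (simp add: add_nonneg_pos)
    have q0: "?q x \<noteq> 0" for x using q[of x] by simp
    define b where "b s = 1 / (s + e)" for s
    define b' where "b' s = - (1 / (s + e)\<^sup>2)" for s
    have bd: "(b has_real_derivative b' s) (at s)" if "s \<ge> 0" for s
      using that e unfolding b_def b'_def by (auto intro!: derivative_eq_intros simp: power2_eq_square field_simps)
    have bc: "continuous_on {0..} b'"
      using e unfolding b'_def by (auto intro!: continuous_intros)
    define X where "X j i x = ?k x * (2 * x $ i) * (b ((norm x)\<^sup>2) * x $ j)
      + ball_cutoff R x * (b' ((norm x)\<^sup>2) * (2 * x $ i) * x $ j + b ((norm x)\<^sup>2) * (if i = j then 1 else 0))" for j i and x :: "real ^ 'n"
    define xi where "xi j x = ball_cutoff R x * (b ((norm x)\<^sup>2) * x $ j)" for j and x :: "real ^ 'n"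
    have C: "C1_with (xi j) (X j)" for j
      unfolding xi_def X_def by (rule C1_with_mult[OF C1_with_ball_cutoff C1_with_radial_field[OF bd bc]])
    have sx: "xi j x = 0" if "norm x > R + 1" for x j by (simp add: xi_def s0 that)
    have cX: "continuous_on UNIV (X j j)" "continuous_on UNIV (xi j)" for j using C by (auto simp: C1_with_def)
    have t: "(\<integral>x. (v x)\<^sup>2 * X j j x \<partial>lebesgue) = - (\<integral>x. ((2 * v x) *\<^sub>R w x) $ j * xi j x \<partial>lebesgue)" for j
      by (rule weak_gradient_test[OF u C sx])
    have i1: "integrable lebesgue (\<lambda>x. (v x)\<^sup>2 * X j j x)" for j
      using L1_loc_mult_continuous[OF m(1) cX(1) C1_with_support[OF C sx]] by (simp add: mult.commute)
    have i2: "integrable lebesgue (\<lambda>x. ((2 * v x) *\<^sub>R w x) $ j * xi j x)" for j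
      using L1_loc_mult_continuous[OF m(3)[of j] cX(2) sx] by (simp add: mult.commute)
    let ?F = "\<lambda>x. \<Sum>j\<in>UNIV. (v x)\<^sup>2 * X j j x + ((2 * v x) *\<^sub>R w x) $ j * xi j x"
    have iF: "integrable lebesgue ?F" by (intro Bochner_Integration.integrable_sum Bochner_Integration.integrable_add i1 i2)
    have F0: "(\<integral>x. ?F x \<partial>lebesgue) = 0"
      using i1 i2 t by (simp add: Bochner_Integration.integral_sum)
    have bnd: "?F x \<ge> ball_cutoff R x * (v x)\<^sup>2 / (2 * ?q x) - (2 * (ball_cutoff R x * (norm (w x))\<^sup>2) + 8 * (?J x *\<^sub>R (v x)\<^sup>2))" for x
    proof -
      have X': "(\<Sum>j\<in>UNIV. X j j x) = ?k x * 2 * (norm x)\<^sup>2 / ?q x + ball_cutoff R x * (real CARD('n) / ?q x - 2 * (norm x)\<^sup>2 / (?q x)\<^sup>2)"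
      proof -
        have "X j j x = (?k x * 2 / ?q x - ball_cutoff R x * 2 / (?q x)\<^sup>2) * (x $ j)\<^sup>2 + ball_cutoff R x / ?q x" for j
          by (simp add: X_def b_def b'_def power2_eq_square algebra_simps)
        then have "(\<Sum>j\<in>UNIV. X j j x) = (?k x * 2 / ?q x - ball_cutoff R x * 2 / (?q x)\<^sup>2) * (norm x)\<^sup>2 + real CARD('n) * (ball_cutoff R x / ?q x)"
          by (simp add: sum.distrib sum_distrib_left[symmetric] norm_sq_vec)
        then show ?thesis by (simp add: algebra_simps)
      qed
      have inn: "(\<Sum>j\<in>UNIV. w x $ j * x $ j) = w x \<bullet> x" by (simp add: inner_vec_def)
      have "(\<Sum>j\<in>UNIV. ((2 * v x) *\<^sub>R w x) $ j * xi j x) = 2 * v x * ball_cutoff R x / ?q x * (\<Sum>j\<in>UNIV. w x $ j * x $ j)"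
        unfolding sum_distrib_left by (intro sum.cong) (auto simp: xi_def b_def)
      then have F': "?F x = (v x)\<^sup>2 * (?k x * 2 * (norm x)\<^sup>2 / ?q x + ball_cutoff R x * (real CARD('n) / ?q x - 2 * (norm x)\<^sup>2 / (?q x)\<^sup>2))
          + 2 * v x * (w x \<bullet> x) * ball_cutoff R x / ?q x"
        unfolding sum.distrib sum_distrib_left[symmetric] X' inn by (simp add: mult_ac)
      have "(w x \<bullet> x)\<^sup>2 \<le> (norm (w x))\<^sup>2 * (norm x)\<^sup>2"
        using Cauchy_Schwarz_ineq[of "w x" x] by (simp add: power2_norm_eq_inner)
      moreover have "\<bar>?k x\<bar> \<le> 4 * ?J x"
      proof (cases "norm x \<le> R + 1")
        case True
        then show ?thesis using radial_cutoff_bounds(3)[of R "(norm x)\<^sup>2"] by simp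
      next
        case False
        have "(norm x)\<^sup>2 \<ge> (R + 1)\<^sup>2" using False R by (intro power_mono) auto
        then have "(norm x)\<^sup>2 - R\<^sup>2 \<ge> 1" using R by (simp add: power2_eq_square algebra_simps)
        then have "max 0 ((norm x)\<^sup>2 - R\<^sup>2) \<ge> 1" by simp
        then have "(max 0 ((norm x)\<^sup>2 - R\<^sup>2))\<^sup>2 \<ge> 1" by (rule one_le_power)
        then show ?thesis by (simp add: radial_cutoff'_def)
      qed
      ultimately have "?F x \<ge> ball_cutoff R x * (v x)\<^sup>2 / (2 * ?q x) - 2 * ball_cutoff R x * (norm (w x))\<^sup>2 - 8 * ?J x * (v x)\<^sup>2"
        unfolding F' using N e by (intro hardy_pointwise) (auto simp: ball_cutoff_bounds)
      then show ?thesis by (simp add: algebra_simps)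
    qed
    have "continuous_on UNIV (\<lambda>x :: real ^ 'n. ball_cutoff R x * (1 / (2 * ?q x)))"
    proof (intro continuous_intros cc ballI)
      show "2 * ?q x \<noteq> 0" for x :: "real ^ 'n" unfolding mult_eq_0_iff using q0 by simp
    qed
    from L1_loc_mult_continuous[OF m(1) this, of "R + 1"] s0
    have iL: "integrable lebesgue (\<lambda>x. ball_cutoff R x * (v x)\<^sup>2 / (2 * ?q x))" by (simp add: mult_ac)
    have "(\<integral>x. ball_cutoff R x * (v x)\<^sup>2 / (2 * ?q x) \<partial>lebesgue) \<le>
      (\<integral>x. ?F x + (2 * (ball_cutoff R x * (norm (w x))\<^sup>2) + 8 * (?J x *\<^sub>R (v x)\<^sup>2)) \<partial>lebesgue)"
      using bnd by (intro integral_mono iL Bochner_Integration.integrable_add[OF iF iK]) (simp add: algebra_simps)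
    also have "\<dots> = K" unfolding K_def using F0 by (subst Bochner_Integration.integral_add[OF iF iK]) simp
    finally show ?thesis using iL by simp
  qed
  define G where "G n x = ball_cutoff R x * (v x)\<^sup>2 / (2 * ((norm x)\<^sup>2 + 1 / (real n + 1)))" for n and x :: "real ^ 'n"
  have G0: "G n x \<ge> 0" for n x unfolding G_def by (intro divide_nonneg_nonneg mult_nonneg_nonneg ball_cutoff_bounds) auto
  have Gm: "integrable lebesgue (G n)" "(\<integral>x. G n x \<partial>lebesgue) \<le> K" for n
    using main[of "1 / (real n + 1)"] unfolding G_def by auto
  have h0: "(\<lambda>n. 1 / (real n + 1)) \<longlonglongrightarrow> 0" using LIMSEQ_inverse_real_of_nat by (simp add: inverse_eq_divide add.commute)
  have conv: "(\<lambda>n. G n x) \<longlonglongrightarrow> ball_cutoff R x * (v x)\<^sup>2 / (2 * ((norm x)\<^sup>2 + 0))" if "x \<noteq> 0" for x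
    unfolding G_def by (intro tendsto_intros h0) (use that in auto)
  define H where "H x = ball_cutoff R x * (v x)\<^sup>2 / (2 * (norm x)\<^sup>2)" for x :: "real ^ 'n"
  have le: "ennreal (H x) \<le> liminf (\<lambda>n. ennreal (G n x))" for x
  \<comment> \<open>At the origin \<open>H\<close> has the value 0, since division by 0 yields
    0.\<close>
  proof (cases "x = 0")
    case True then show ?thesis by (simp add: H_def)
  next
    case False
    have "(\<lambda>n. ennreal (G n x)) \<longlonglongrightarrow> ennreal (H x)" using conv[OF False] by (intro tendsto_ennrealI) (simp add: H_def)
    then show ?thesis using lim_imp_Liminf[OF trivial_limit_sequentially] by (metis order_refl)
  qed
  have "(\<integral>\<^sup>+x. ennreal (H x) \<partial>lebesgue) \<le> (\<integral>\<^sup>+x. liminf (\<lambda>n. ennreal (G n x)) \<partial>lebesgue)"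
    by (intro nn_integral_mono le)
  also have "\<dots> \<le> liminf (\<lambda>n. \<integral>\<^sup>+x. ennreal (G n x) \<partial>lebesgue)"
    using Gm(1) by (intro nn_integral_liminf) auto
  also have "\<dots> \<le> liminf (\<lambda>n. ennreal K)"
    using Gm G0 by (intro Liminf_mono always_eventually allI) (simp add: nn_integral_eq_integral ennreal_leI)
  also have "\<dots> = ennreal K" by (simp add: Liminf_const)
  finally have fin: "(\<integral>\<^sup>+x. ennreal (H x) \<partial>lebesgue) < \<infinity>" by (simp add: le_less_trans ennreal_less_top)
  have nm: "(\<lambda>x :: real ^ 'n. (norm x)\<^sup>2) \<in> borel_measurable lebesgue"
    by (intro borel_measurable_lebesgue_continuous continuous_intros)
  have H0: "H x \<ge> 0" for x unfolding H_def by (intro divide_nonneg_nonneg mult_nonneg_nonneg ball_cutoff_bounds) auto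
  have "integrable lebesgue H"
  proof (rule integrableI_bounded)
    show "H \<in> borel_measurable lebesgue" unfolding H_def
      by (intro borel_measurable_divide borel_measurable_times borel_measurable_lebesgue_continuous[OF cc] m(4) nm borel_measurable_const)
    show "(\<integral>\<^sup>+x. ennreal (norm (H x)) \<partial>lebesgue) < \<infinity>" using fin H0 by simp
  qed
  then have "integrable lebesgue (\<lambda>x. 2 * H x)" by simp
  then show "integrable lebesgue (\<lambda>x. indicator (cball 0 R) x *\<^sub>R ((v x)\<^sup>2 / (norm x)\<^sup>2))"
  proof (rule Bochner_Integration.integrable_bound)
    show "(\<lambda>x. indicator (cball 0 R) x *\<^sub>R ((v x)\<^sup>2 / (norm x)\<^sup>2)) \<in> borel_measurable lebesgue"
      by (intro borel_measurable_scaleR borel_measurable_indicator borel_measurable_divide m(4) nm) simp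
    show "AE x in lebesgue. norm (indicator (cball 0 R) x *\<^sub>R ((v x)\<^sup>2 / (norm x)\<^sup>2)) \<le> norm (2 * H x)"
      using R by (intro AE_I2) (auto simp: H_def indicator_def ball_cutoff_eq_1(1))
  qed
qed

section \<open>The ground state inequality\<close>

text \<open>
  With \<open>t = sqrt \<mu>\<close>, the factor \<open>damp d t * tame d (t\<^sup>2)\<close> tends to \<open>1\<close> on \<open>{\<mu> > 0}\<close> as \<open>d\<close> tends to \<open>0\<close>. It makes
  \<open>damp d (sqrt \<mu>) * \<phi>\<^sup>2\<close> have a gradient in \<open>L\<^sup>2\<close> although \<open>grad \<phi>\<close> is square integrable only against \<open>\<mu>\<close>, and
  likewise for \<open>tame d \<mu> * grad \<mu>\<close>.
\<close>

definition damp :: "real \<Rightarrow> real \<Rightarrow> real" where "damp d t = t\<^sup>2 / (t\<^sup>2 + d)"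
definition damp' :: "real \<Rightarrow> real \<Rightarrow> real" where "damp' d t = 2 * t * d / (t\<^sup>2 + d)\<^sup>2"
definition tame :: "real \<Rightarrow> real \<Rightarrow> real" where "tame d s = 1 / (1 + d * s)"
definition tame' :: "real \<Rightarrow> real \<Rightarrow> real" where "tame' d s = - d / (1 + d * s)\<^sup>2"
definition trunc :: "real \<Rightarrow> real \<Rightarrow> real" where "trunc d t = t\<^sup>2 * damp d t * tame d (t\<^sup>2)"
definition trunc' :: "real \<Rightarrow> real \<Rightarrow> real" where
  "trunc' d t = (2 * t * damp d t + t\<^sup>2 * damp' d t) * tame d (t\<^sup>2) + t\<^sup>2 * damp d t * (tame' d (t\<^sup>2) * (2 * t))"

context
  fixes d :: real
  assumes d: "0 < d" "d \<le> 1"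
begin

lemma damp_denominator_pos: "t\<^sup>2 + d > 0" for t :: real
  using d by (simp add: add_nonneg_pos)

lemma tame_denominator_pos: "s \<ge> 0 \<Longrightarrow> 1 + d * s > 0" for s :: real
  using d by (simp add: add_pos_nonneg)

lemma DERIV_damp: "(damp d has_real_derivative damp' d t) (at t)"
  unfolding damp_def[abs_def] damp'_def using damp_denominator_pos[of t]
  by (auto intro!: derivative_eq_intros simp: power2_eq_square field_simps)

lemma DERIV_tame: "s \<ge> 0 \<Longrightarrow> (tame d has_real_derivative tame' d s) (at s)"
  unfolding tame_def[abs_def] tame'_def using tame_denominator_pos[of s]
  by (auto intro!: derivative_eq_intros simp: power2_eq_square field_simps)

lemma DERIV_trunc: "(trunc d has_real_derivative trunc' d t) (at t)"
proof -
  have "((\<lambda>t. tame d (t\<^sup>2)) has_real_derivative tame' d (t\<^sup>2) * (2 * t)) (at t)"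
    by (rule DERIV_chain2[OF DERIV_tame]) (auto intro!: derivative_eq_intros)
  moreover have "((\<lambda>t. t\<^sup>2) has_real_derivative 2 * t) (at t)" by (auto intro!: derivative_eq_intros)
  ultimately have "((\<lambda>t. t\<^sup>2 * damp d t * tame d (t\<^sup>2)) has_real_derivative
      (2 * t * damp d t + damp' d t * t\<^sup>2) * tame d (t\<^sup>2) + tame' d (t\<^sup>2) * (2 * t) * (t\<^sup>2 * damp d t)) (at t)"
    by (intro DERIV_mult DERIV_damp)
  then show ?thesis unfolding trunc_def[abs_def] trunc'_def by (simp add: mult_ac)
qed

lemma continuous_damp: "continuous_on UNIV (damp d)" "continuous_on UNIV (damp' d)"
  unfolding damp_def damp'_def using damp_denominator_pos by (auto intro!: continuous_intros simp: less_imp_neq[symmetric])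

lemma continuous_tame: "continuous_on {0..} (tame d)" "continuous_on {0..} (tame' d)"
  unfolding tame_def tame'_def using tame_denominator_pos by (auto intro!: continuous_intros simp: less_imp_neq[symmetric])

lemma continuous_trunc: "continuous_on UNIV (trunc d)" "continuous_on UNIV (trunc' d)"
proof -
  have "continuous_on UNIV (\<lambda>t :: real. tame d (t\<^sup>2))" "continuous_on UNIV (\<lambda>t :: real. tame' d (t\<^sup>2))"
    by (auto intro!: continuous_on_compose2[OF continuous_tame(1)] continuous_on_compose2[OF continuous_tame(2)] continuous_intros)
  then show "continuous_on UNIV (trunc d)" "continuous_on UNIV (trunc' d)"
    unfolding trunc_def trunc'_def using continuous_damp by (auto intro!: continuous_intros)
qed

lemma damp_bounds: "0 \<le> damp d t" "damp d t \<le> 1" "damp d t \<le> t\<^sup>2 / d"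
proof -
  show "0 \<le> damp d t" unfolding damp_def using damp_denominator_pos[of t] by simp
  show "damp d t \<le> 1" unfolding damp_def using damp_denominator_pos[of t] d by (simp add: divide_le_eq)
  show "damp d t \<le> t\<^sup>2 / d" unfolding damp_def using damp_denominator_pos[of t] d by (intro divide_left_mono) auto
qed

lemma damp'_bounds: "\<bar>damp' d t\<bar> \<le> 1 / d" "\<bar>damp' d t * t\<bar> \<le> 1"
proof -
  have "2 * (t\<^sup>2 * d) \<le> (t\<^sup>2 + d)\<^sup>2"
  proof -
    have "(t\<^sup>2 + d)\<^sup>2 = t\<^sup>2 * t\<^sup>2 + 2 * (t\<^sup>2 * d) + d * d" by (simp add: power2_eq_square algebra_simps)
    moreover have "0 \<le> t\<^sup>2 * t\<^sup>2" "0 \<le> d * d" by auto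
    ultimately show ?thesis by linarith
  qed
  then show "\<bar>damp' d t * t\<bar> \<le> 1" unfolding damp'_def using damp_denominator_pos[of t] d
    by (simp add: abs_mult power2_eq_square divide_le_eq mult_ac)
  have "2 * \<bar>t\<bar> * d \<le> t\<^sup>2 + d"
  proof -
    have "2 * \<bar>t\<bar> * d \<le> t\<^sup>2 * d + d"
      using mult_right_mono[of "2 * \<bar>t\<bar>" "t\<^sup>2 + 1" d] zero_le_power2[of "\<bar>t\<bar> - 1"] d
      by (simp add: power2_eq_square algebra_simps)
    moreover have "t\<^sup>2 * d \<le> t\<^sup>2 * 1" using d by (intro mult_left_mono) auto
    ultimately show ?thesis by simp
  qed
  then have "2 * \<bar>t\<bar> * d * d \<le> (t\<^sup>2 + d) * (t\<^sup>2 + d)"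
    using d damp_denominator_pos[of t] by (intro mult_mono) auto
  then have "2 * \<bar>t\<bar> * d / (t\<^sup>2 + d)\<^sup>2 \<le> 1 / d"
    using d damp_denominator_pos[of t] by (simp add: power2_eq_square divide_le_eq pos_le_divide_eq mult_ac)
  then show "\<bar>damp' d t\<bar> \<le> 1 / d" unfolding damp'_def using d by (simp add: abs_mult)
qed

lemma tame_bounds:
  assumes "s \<ge> 0"
  shows "0 \<le> tame d s" "tame d s \<le> 1" "\<bar>s * tame' d s\<bar> \<le> tame d s" "\<bar>s * tame' d s\<bar> \<le> 1"
proof -
  have p: "1 + d * s > 0" "d * s \<ge> 0" using tame_denominator_pos[OF assms] d assms by auto
  show 0: "0 \<le> tame d s" "tame d s \<le> 1" unfolding tame_def using p by (auto simp: divide_le_eq)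
  have "\<bar>s * tame' d s\<bar> = (d * s) / (1 + d * s) * tame d s"
    unfolding tame'_def tame_def using p d assms by (simp add: abs_mult power2_eq_square)
  also have "\<dots> \<le> 1 * tame d s" using p 0 by (intro mult_right_mono) (auto simp: divide_le_eq)
  finally show "\<bar>s * tame' d s\<bar> \<le> tame d s" by simp
  then show "\<bar>s * tame' d s\<bar> \<le> 1" using 0 by linarith
qed

lemma abs_tame_bound: "\<bar>t\<bar> * tame d (t\<^sup>2) \<le> 1 / d"
proof -
  have "\<bar>t\<bar> * d \<le> 1 + d * t\<^sup>2"
  proof -
    have "d * (2 * \<bar>t\<bar>) \<le> d * (t\<^sup>2 + 1)"
      using zero_le_power2[of "\<bar>t\<bar> - 1"] d by (intro mult_left_mono) (simp_all add: power2_eq_square algebra_simps)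
    moreover have "0 \<le> d * \<bar>t\<bar>" using d by simp
    ultimately have "d * \<bar>t\<bar> \<le> d * t\<^sup>2 + d" by (simp add: algebra_simps)
    then show ?thesis using d by (simp add: algebra_simps)
  qed
  then show ?thesis unfolding tame_def using tame_denominator_pos[of "t\<^sup>2"] d
    by (simp add: pos_le_divide_eq pos_divide_le_eq mult_ac)
qed

text \<open>\<open>trunc d (v x)\<close> is the weight times the damping factor. The bounds
  \<open>1 / d\<close> and \<open>5 / d\<close> admit it to the chain and product rules at fixed
  \<open>d\<close>; the bounds \<open>t\<^sup>2\<close> and \<open>5 * \<bar>t\<bar>\<close> are
  free of \<open>d\<close> and enter the majorant as \<open>d\<close> tends to 0. In 5 = 3 + 2, the
  3 comes from differentiating \<open>t\<^sup>2 * damp d t\<close> and the 2 from differentiating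
  \<open>tame\<close>.\<close>

lemma trunc_bounds: "\<bar>trunc d t\<bar> \<le> t\<^sup>2" "\<bar>trunc d t\<bar> \<le> 1 / d" "\<bar>trunc' d t\<bar> \<le> 5 * \<bar>t\<bar>" "\<bar>trunc' d t\<bar> \<le> 5 / d"
proof -
  note T = tame_bounds[of "t\<^sup>2", simplified]
  have "\<bar>trunc d t\<bar> = t\<^sup>2 * (damp d t * tame d (t\<^sup>2))"
    unfolding trunc_def using damp_bounds(1)[of t] T by (simp add: abs_mult)
  also have "\<dots> \<le> t\<^sup>2 * (1 * tame d (t\<^sup>2))"
    using damp_bounds(1,2)[of t] T by (intro mult_left_mono mult_right_mono) auto
  finally have *: "\<bar>trunc d t\<bar> \<le> t\<^sup>2 * tame d (t\<^sup>2)" by simp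
  moreover have "t\<^sup>2 * tame d (t\<^sup>2) \<le> t\<^sup>2 * 1" using T by (intro mult_left_mono) auto
  ultimately show "\<bar>trunc d t\<bar> \<le> t\<^sup>2" by simp
  have "t\<^sup>2 * tame d (t\<^sup>2) \<le> 1 / d" unfolding tame_def using tame_denominator_pos[of "t\<^sup>2"] d
    by (simp add: pos_le_divide_eq pos_divide_le_eq mult_ac)
  then show "\<bar>trunc d t\<bar> \<le> 1 / d" using * by simp
  have a: "\<bar>2 * t * damp d t + t\<^sup>2 * damp' d t\<bar> \<le> 3 * \<bar>t\<bar>"
  proof -
    have "\<bar>2 * t * damp d t\<bar> \<le> 2 * \<bar>t\<bar> * 1"
      using damp_bounds(1,2)[of t] unfolding abs_mult by (intro mult_mono) auto
    moreover have "\<bar>t\<^sup>2 * damp' d t\<bar> = \<bar>t\<bar> * \<bar>damp' d t * t\<bar>" by (simp add: abs_mult power2_eq_square)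
    moreover have "\<bar>t\<bar> * \<bar>damp' d t * t\<bar> \<le> \<bar>t\<bar> * 1" using damp'_bounds(2)[of t] by (intro mult_left_mono) auto
    ultimately show ?thesis by linarith
  qed
  have b: "\<bar>t\<^sup>2 * damp d t * (tame' d (t\<^sup>2) * (2 * t))\<bar> \<le> 2 * \<bar>t\<bar> * tame d (t\<^sup>2)"
  proof -
    have "\<bar>t\<^sup>2 * damp d t * (tame' d (t\<^sup>2) * (2 * t))\<bar> = damp d t * (2 * \<bar>t\<bar> * \<bar>t\<^sup>2 * tame' d (t\<^sup>2)\<bar>)"
      using damp_bounds(1)[of t] by (simp add: abs_mult)
    also have "\<dots> \<le> 1 * (2 * \<bar>t\<bar> * tame d (t\<^sup>2))"
      using damp_bounds(1,2)[of t] T by (intro mult_mono mult_left_mono) auto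
    finally show ?thesis by simp
  qed
  have "\<bar>trunc' d t\<bar> \<le> \<bar>2 * t * damp d t + t\<^sup>2 * damp' d t\<bar> * tame d (t\<^sup>2) + 2 * \<bar>t\<bar> * tame d (t\<^sup>2)"
  proof -
    have "\<bar>(2 * t * damp d t + t\<^sup>2 * damp' d t) * tame d (t\<^sup>2)\<bar> = \<bar>2 * t * damp d t + t\<^sup>2 * damp' d t\<bar> * tame d (t\<^sup>2)"
      using T(1) by (simp add: abs_mult)
    then show ?thesis unfolding trunc'_def
      using b abs_triangle_ineq[of "(2 * t * damp d t + t\<^sup>2 * damp' d t) * tame d (t\<^sup>2)"
        "t\<^sup>2 * damp d t * (tame' d (t\<^sup>2) * (2 * t))"] by linarith
  qed
  also have "\<dots> \<le> 3 * \<bar>t\<bar> * tame d (t\<^sup>2) + 2 * \<bar>t\<bar> * tame d (t\<^sup>2)"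
    using a T by (intro add_right_mono mult_right_mono) auto
  finally have c: "\<bar>trunc' d t\<bar> \<le> 5 * (\<bar>t\<bar> * tame d (t\<^sup>2))" by (simp add: algebra_simps)
  have "\<bar>t\<bar> * tame d (t\<^sup>2) \<le> \<bar>t\<bar> * 1" using T by (intro mult_left_mono) auto
  then show "\<bar>trunc' d t\<bar> \<le> 5 * \<bar>t\<bar>" using c by simp
  show "\<bar>trunc' d t\<bar> \<le> 5 / d" using c abs_tame_bound[of t] by simp
qed

end

text \<open>At \<open>t = 0\<close> the factor \<open>damp d t\<close> is 0 for every
  \<open>d\<close> and cannot tend to 1, which explains the condition \<open>t \<noteq> 0\<close>.
  The zero set of the weight thereby drops out of the limit.\<close>

lemma damp_limits:
  assumes dn: "dn \<longlonglongrightarrow> 0"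
  shows "(\<lambda>n. trunc (dn n) t) \<longlonglongrightarrow> t\<^sup>2"
    "t \<noteq> 0 \<Longrightarrow> (\<lambda>n. trunc' (dn n) t) \<longlonglongrightarrow> 2 * t"
    "t \<noteq> 0 \<Longrightarrow> (\<lambda>n. damp (dn n) t * tame (dn n) (t\<^sup>2)) \<longlonglongrightarrow> 1"
    "t \<noteq> 0 \<Longrightarrow> (\<lambda>n. damp' (dn n) t * tame (dn n) (t\<^sup>2) * t) \<longlonglongrightarrow> 0"
    "t \<noteq> 0 \<Longrightarrow> (\<lambda>n. damp (dn n) t * tame' (dn n) (t\<^sup>2) * t\<^sup>2) \<longlonglongrightarrow> 0"
proof -
  have t1: "(\<lambda>n. tame (dn n) (t\<^sup>2)) \<longlonglongrightarrow> 1 / (1 + 0 * t\<^sup>2)" unfolding tame_def by (intro tendsto_intros dn) simp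
  have t2: "(\<lambda>n. tame' (dn n) (t\<^sup>2)) \<longlonglongrightarrow> - 0 / (1 + 0 * t\<^sup>2)\<^sup>2" unfolding tame'_def by (intro tendsto_intros dn) simp
  have t3: "(\<lambda>n. damp (dn n) t) \<longlonglongrightarrow> t\<^sup>2 / (t\<^sup>2 + 0)" if "t \<noteq> 0" unfolding damp_def by (intro tendsto_intros dn) (use that in simp)
  have t4: "(\<lambda>n. damp' (dn n) t) \<longlonglongrightarrow> 2 * t * 0 / (t\<^sup>2 + 0)\<^sup>2" if "t \<noteq> 0" unfolding damp'_def by (intro tendsto_intros dn) (use that in simp)
  note T = t1[simplified] t2[simplified] t3[simplified] t4[simplified]
  show "(\<lambda>n. trunc (dn n) t) \<longlonglongrightarrow> t\<^sup>2"
  proof (cases "t = 0")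
    case False
    have "(\<lambda>n. trunc (dn n) t) \<longlonglongrightarrow> t\<^sup>2 * 1 * 1" unfolding trunc_def using False by (intro tendsto_intros) (auto intro: T T(3)[THEN tendsto_eq_rhs])
    then show ?thesis by simp
  qed (simp add: trunc_def)
  assume t: "t \<noteq> 0"
  then have T3: "(\<lambda>n. damp (dn n) t) \<longlonglongrightarrow> 1" and T4: "(\<lambda>n. damp' (dn n) t) \<longlonglongrightarrow> 0" using T(3,4) by auto
  have "(\<lambda>n. trunc' (dn n) t) \<longlonglongrightarrow> (2 * t * 1 + t\<^sup>2 * 0) * 1 + t\<^sup>2 * 1 * (0 * (2 * t))"
    unfolding trunc'_def by (intro tendsto_intros T(1,2) T3 T4)
  then show "(\<lambda>n. trunc' (dn n) t) \<longlonglongrightarrow> 2 * t" by simp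
  show "(\<lambda>n. damp (dn n) t * tame (dn n) (t\<^sup>2)) \<longlonglongrightarrow> 1" using tendsto_mult[OF T3 T(1)] by simp
  show "(\<lambda>n. damp' (dn n) t * tame (dn n) (t\<^sup>2) * t) \<longlonglongrightarrow> 0"
    using tendsto_mult[OF tendsto_mult[OF T4 T(1)] tendsto_const[of t]] by simp
  show "(\<lambda>n. damp (dn n) t * tame' (dn n) (t\<^sup>2) * t\<^sup>2) \<longlonglongrightarrow> 0"
    using tendsto_mult[OF tendsto_mult[OF T3 T(2)] tendsto_const[of "t\<^sup>2"]] by simp
qed

lemma borel_measurable_norm_compose:
  fixes f :: "'a \<Rightarrow> 'b :: euclidean_space"
  assumes "f \<in> borel_measurable M"
  shows "(\<lambda>x. norm (f x)) \<in> borel_measurable M"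
  using assms by (rule measurable_compose) (rule borel_measurable_norm)

lemma L1_loc_mult_compact:
  fixes u a :: "real ^ 'n \<Rightarrow> real"
  assumes u: "L1_loc lebesgue u" and s: "\<And>x. norm x > R \<Longrightarrow> u x = 0" and a: "continuous_on UNIV a"
  shows "integrable lebesgue (\<lambda>x. u x * a x)"
proof -
  obtain B where B: "\<And>x. norm x \<le> R \<Longrightarrow> \<bar>a x\<bar> \<le> B" using continuous_cball_bound[OF a] by metis
  have "(\<lambda>x. indicator (cball 0 R) x * a x) \<in> borel_measurable lebesgue"
    by (intro borel_measurable_times borel_measurable_indicator borel_measurable_lebesgue_continuous a) simp
  then have "integrable lebesgue (\<lambda>x. (indicator (cball 0 R) x * a x) * u x)"
    by (rule L1_loc_mult_integrable[OF u, where B = B and R = R]) (auto simp: B)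
  moreover have "(\<lambda>x. (indicator (cball 0 R) x * a x) * u x) = (\<lambda>x. u x * a x)"
    using s by (fastforce simp: fun_eq_iff indicator_def)
  ultimately show ?thesis by simp
qed

section \<open>The completed square with a damped weight\<close>

lemma weak_divergence_test:
  fixes u :: "real ^ 'n \<Rightarrow> real" and A :: "real ^ 'n \<Rightarrow> real ^ 'n"
  assumes u: "has_weak_gradient u g" and R: "R \<ge> 0"
    and s: "\<And>x. norm x > R \<Longrightarrow> u x = 0" "\<And>x. norm x > R \<Longrightarrow> g x = 0"
    and A: "\<And>j. C1_with (\<lambda>x. A x $ j) (DA j)"
  shows "integrable lebesgue (\<lambda>x. u x * (\<Sum>j\<in>UNIV. DA j j x) + g x \<bullet> A x)"
    and "(\<integral>x. u x * (\<Sum>j\<in>UNIV. DA j j x) + g x \<bullet> A x \<partial>lebesgue) = 0"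
proof -
  note m = has_weak_gradient_L1_loc[OF u]
  have c: "continuous_on UNIV (DA j j)" "continuous_on UNIV (\<lambda>x. A x $ j)" for j using A[of j] by (auto simp: C1_with_def)
  have i1: "integrable lebesgue (\<lambda>x. u x * DA j j x)" for j by (rule L1_loc_mult_compact[OF m(1) s(1) c(1)])
  have i2: "integrable lebesgue (\<lambda>x. g x $ j * A x $ j)" for j
    by (rule L1_loc_mult_compact[OF m(3) _ c(2), where R = R]) (simp add: s(2))
  have t: "(\<integral>x. u x * DA j j x \<partial>lebesgue) = - (\<integral>x. g x $ j * A x $ j \<partial>lebesgue)" for j
    by (rule weak_gradient_test_compact[OF u A R s])
  have eq: "(\<lambda>x. u x * (\<Sum>j\<in>UNIV. DA j j x) + g x \<bullet> A x) = (\<lambda>x. \<Sum>j\<in>UNIV. (u x * DA j j x + g x $ j * A x $ j))"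
    by (simp add: fun_eq_iff inner_vec_def sum.distrib sum_distrib_left)
  show "integrable lebesgue (\<lambda>x. u x * (\<Sum>j\<in>UNIV. DA j j x) + g x \<bullet> A x)"
    unfolding eq using i1 i2 by (intro Bochner_Integration.integrable_sum Bochner_Integration.integrable_add)
  have "(\<integral>x. (\<Sum>j\<in>UNIV. (u x * DA j j x + g x $ j * A x $ j)) \<partial>lebesgue) = (\<Sum>j\<in>UNIV. \<integral>x. (u x * DA j j x + g x $ j * A x $ j) \<partial>lebesgue)"
    using i1 i2 by (intro Bochner_Integration.integral_sum Bochner_Integration.integrable_add)
  also have "\<dots> = 0" using i1 i2 t by (intro sum.neutral) simp
  finally show "(\<integral>x. u x * (\<Sum>j\<in>UNIV. DA j j x) + g x \<bullet> A x \<partial>lebesgue) = 0" unfolding eq .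
qed

text \<open>The expanded square of \<open>v *\<^sub>R g - f *\<^sub>R (v *\<^sub>R A - w)\<close>,
  multiplied by \<open>th\<close>. The term \<open>(norm g)\<^sup>2 * v\<^sup>2\<close> is given
  back its full coefficient, so that the right side is independent of \<open>th\<close>.\<close>

lemma square_completion:
  fixes g A w :: "real ^ 'n" and th :: real
  assumes "0 \<le> th" "th \<le> 1"
  shows "th * (2 * f * v\<^sup>2 * (g \<bullet> A) - 2 * f * v * (g \<bullet> w) - f\<^sup>2 * v\<^sup>2 * (norm A)\<^sup>2 + 2 * f\<^sup>2 * v * (w \<bullet> A) - f\<^sup>2 * (norm w)\<^sup>2)
    \<le> (norm g)\<^sup>2 * v\<^sup>2"
proof -
  have "(norm (v *\<^sub>R g - f *\<^sub>R (v *\<^sub>R A - w)))\<^sup>2 \<ge> 0" by simp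
  then have "2 * f * v\<^sup>2 * (g \<bullet> A) - 2 * f * v * (g \<bullet> w) - f\<^sup>2 * v\<^sup>2 * (norm A)\<^sup>2 + 2 * f\<^sup>2 * v * (w \<bullet> A) - f\<^sup>2 * (norm w)\<^sup>2
    \<le> (norm g)\<^sup>2 * v\<^sup>2"
    unfolding power2_norm_eq_inner
    by (simp add: inner_diff_left inner_diff_right inner_commute power2_eq_square algebra_simps)
  then have "th * (2 * f * v\<^sup>2 * (g \<bullet> A) - 2 * f * v * (g \<bullet> w) - f\<^sup>2 * v\<^sup>2 * (norm A)\<^sup>2 + 2 * f\<^sup>2 * v * (w \<bullet> A) - f\<^sup>2 * (norm w)\<^sup>2)
    \<le> th * ((norm g)\<^sup>2 * v\<^sup>2)" using assms(1) by (rule mult_left_mono)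
  also have "\<dots> \<le> 1 * ((norm g)\<^sup>2 * v\<^sup>2)" using assms by (intro mult_right_mono) auto
  finally show ?thesis by simp
qed

text \<open>Two divergences of integral 0 remove the gradient of \<phi> from the damped square. In
  \<open>Q\<close>, the expression \<open>(norm (w x))\<^sup>2 - l x / 2\<close> is the weight times
  the potential \<open>U_mu\<close>; it is replaced by 0 on the zero set of \<open>v\<close>, which
  is the value of the damped expressions there for every \<open>d\<close>.\<close>

lemma ground_state_inequality:
  fixes v \<phi> l :: "real ^ 'n \<Rightarrow> real" and w g A :: "real ^ 'n \<Rightarrow> real ^ 'n"
  assumes vw: "has_weak_gradient v w" and v2: "L1_loc lebesgue (\<lambda>x. (v x)\<^sup>2)" and w2: "L1_loc lebesgue (\<lambda>x. (norm (w x))\<^sup>2)"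
    and l: "has_weak_laplacian (\<lambda>x. (v x)\<^sup>2) l"
    and f: "has_weak_gradient \<phi> g" and C: "\<And>x. \<bar>\<phi> x\<bar> \<le> C" and R: "R \<ge> 0"
    and s: "\<And>x. norm x > R \<Longrightarrow> \<phi> x = 0" "\<And>x. norm x > R \<Longrightarrow> g x = 0"
    and gi: "integrable lebesgue (\<lambda>x. (norm (g x))\<^sup>2 * (v x)\<^sup>2)"
    and A: "\<And>j. C1_with (\<lambda>x. A x $ j) (DA j)"
  defines "Q \<equiv> \<lambda>x. (\<phi> x)\<^sup>2 * ((v x)\<^sup>2 * ((\<Sum>j\<in>UNIV. DA j j x) + (norm (A x))\<^sup>2) + (if v x = 0 then 0 else (norm (w x))\<^sup>2 - l x / 2))"
  shows "integrable lebesgue Q" and "- (\<integral>x. Q x \<partial>lebesgue) \<le> (\<integral>x. (norm (g x))\<^sup>2 * (v x)\<^sup>2 \<partial>lebesgue)"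
proof -
  note mv = has_weak_gradient_L1_loc[OF vw] and mf = has_weak_gradient_L1_loc[OF f]
  have ml: "L1_loc lebesgue l" using l by (simp add: has_weak_laplacian_def)
  have C0: "C \<ge> 0" using C[of 0] by linarith
  have f2: "\<bar>\<phi> x * \<phi> x\<bar> \<le> C * C" for x unfolding abs_mult by (intro mult_mono C C0) auto
  have Ff: "has_weak_gradient (\<lambda>x. \<phi> x * \<phi> x) (\<lambda>x. \<phi> x *\<^sub>R g x + \<phi> x *\<^sub>R g x)"
    by (rule has_weak_gradient_mult[OF f f C C])
  have u: "has_weak_gradient (\<lambda>x. (v x)\<^sup>2) (\<lambda>x. (2 * v x) *\<^sub>R w x)"
    by (rule has_weak_gradient_square[OF vw v2 w2])
  define divA where "divA x = (\<Sum>j\<in>UNIV. DA j j x)" for x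
  \<comment> \<open>What must be added to the divergences \<open>Q1\<close> and
    \<open>- Q2 / 2\<close> to obtain the damped expanded square without its term in
    \<open>|g|^2\<close>. No gradient of \<phi> is left in it.\<close>
  define J where "J d x = (\<phi> x)\<^sup>2 * (- trunc d (v x) * divA x - trunc' d (v x) * (w x \<bullet> A x)
      + (damp' d (v x) * tame d ((v x)\<^sup>2) * v x + 2 * (damp d (v x) * tame' d ((v x)\<^sup>2) * (v x)\<^sup>2) - damp d (v x) * tame d ((v x)\<^sup>2)) * (norm (w x))\<^sup>2
      + damp d (v x) * tame d ((v x)\<^sup>2) * (l x / 2 - (v x)\<^sup>2 * (norm (A x))\<^sup>2 + 2 * v x * (w x \<bullet> A x)))" for d x
  have cA: "continuous_on UNIV A"
    unfolding continuous_on_componentwise[of UNIV A]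
  proof
    fix b :: "real ^ 'n" assume "b \<in> Basis"
    then obtain j where "b = axis j 1" by (auto simp: Basis_vec_def)
    then show "continuous_on UNIV (\<lambda>x. A x \<bullet> b)" using A[of j] by (simp add: inner_axis C1_with_def)
  qed
  have cD: "continuous_on UNIV divA" unfolding divA_def using A by (intro continuous_intros) (auto simp: C1_with_def)
  have measA: "A \<in> borel_measurable lebesgue" "divA \<in> borel_measurable lebesgue"
    by (intro borel_measurable_lebesgue_continuous cA cD)+
  note measl = L1_loc_measurable[OF ml]
  have wA: "(\<lambda>x. w x \<bullet> A x) \<in> borel_measurable lebesgue" by (intro borel_measurable_inner mv measA)
  have nA: "(\<lambda>x. (norm (A x))\<^sup>2) \<in> borel_measurable lebesgue" "(\<lambda>x. (norm (w x))\<^sup>2) \<in> borel_measurable lebesgue"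
    by (intro borel_measurable_power borel_measurable_norm_compose mv measA)+
  \<comment> \<open>Integrability of \<open>J d\<close> is a premise here; a majorant common to all
    \<open>d\<close> provides it below.\<close>
  have step: "integrable lebesgue (J d) \<longrightarrow> (\<integral>x. J d x \<partial>lebesgue) \<le> (\<integral>x. (norm (g x))\<^sup>2 * (v x)\<^sup>2 \<partial>lebesgue)" if d: "0 < d" "d \<le> 1" for d
  proof
    assume iJ: "integrable lebesgue (J d)"
    have gS: "has_weak_gradient (\<lambda>x. trunc d (v x)) (\<lambda>x. trunc' d (v x) *\<^sub>R w x)"
      by (rule has_weak_gradient_compose[OF vw DERIV_trunc[OF d] continuous_trunc(2)[OF d] trunc_bounds(4)[OF d]])
    have gT: "has_weak_gradient (\<lambda>x. damp d (v x)) (\<lambda>x. damp' d (v x) *\<^sub>R w x)"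
      by (rule has_weak_gradient_compose[OF vw DERIV_damp[OF d] continuous_damp(2)[OF d] damp'_bounds(1)[OF d]])
    have dT: "\<bar>damp d t\<bar> \<le> 1" for t using damp_bounds[OF d, of t] by simp
    \<comment> \<open>The divergence of \<open>\<phi>\<^sup>2 * trunc d v\<close> times the field
      \<open>A\<close>, written out by the product rule.\<close>
    define Q1 where "Q1 x = \<phi> x * \<phi> x * trunc d (v x) * divA x + (trunc d (v x) *\<^sub>R (\<phi> x *\<^sub>R g x + \<phi> x *\<^sub>R g x) + (\<phi> x * \<phi> x) *\<^sub>R (trunc' d (v x) *\<^sub>R w x)) \<bullet> A x" for x
    have Q1: "integrable lebesgue Q1" "(\<integral>x. Q1 x \<partial>lebesgue) = 0"
      unfolding Q1_def divA_def
      by (rule weak_divergence_test[OF has_weak_gradient_mult[OF Ff gS f2 trunc_bounds(2)[OF d]] R _ _ A]; simp add: s)+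
    let ?z = "\<lambda>x. damp d (v x) *\<^sub>R (\<phi> x *\<^sub>R g x + \<phi> x *\<^sub>R g x) + (\<phi> x * \<phi> x) *\<^sub>R (damp' d (v x) *\<^sub>R w x)"
    let ?zeta = "\<lambda>x. \<phi> x * \<phi> x * damp d (v x)"
    have gz: "has_weak_gradient ?zeta ?z" by (rule has_weak_gradient_mult[OF Ff gT f2 dT])
    let ?p = "\<lambda>i x. tame d ((v x)\<^sup>2) * (2 * v x * w x $ i)"
    let ?m = "\<lambda>x. tame d ((v x)\<^sup>2) * l x + tame' d ((v x)\<^sup>2) * (4 * (v x)\<^sup>2 * (norm (w x))\<^sup>2)"
    have tm: "(\<lambda>x. tame d ((v x)\<^sup>2)) \<in> borel_measurable lebesgue" "(\<lambda>x. tame' d ((v x)\<^sup>2)) \<in> borel_measurable lebesgue"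
    proof -
      have "continuous_on UNIV (\<lambda>t :: real. tame d (t\<^sup>2))" "continuous_on UNIV (\<lambda>t :: real. tame' d (t\<^sup>2))"
        by (auto intro!: continuous_on_compose2[OF continuous_tame(1)[OF d]] continuous_on_compose2[OF continuous_tame(2)[OF d]] continuous_intros)
      then show "(\<lambda>x. tame d ((v x)\<^sup>2)) \<in> borel_measurable lebesgue" "(\<lambda>x. tame' d ((v x)\<^sup>2)) \<in> borel_measurable lebesgue"
        by (auto intro: continuous_on_real_compose_measurable mv)
    qed
    \<comment> \<open>From \<open>damp\<^sup>2 \<le> damp \<le> v\<^sup>2 / d\<close>, one power of
      the damping is traded for the weight, so the squared gradient of \<phi> occurs only multiplied
      by \<open>(v x)\<^sup>2\<close>.\<close>
    have z2: "L1_loc lebesgue (\<lambda>x. (norm (?z x))\<^sup>2)"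
    proof (rule L1_loc_bound)
      show "L1_loc lebesgue (\<lambda>x. 8 * C\<^sup>2 / d * ((norm (g x))\<^sup>2 * (v x)\<^sup>2) + 2 * C ^ 4 / d\<^sup>2 * (norm (w x))\<^sup>2)"
        by (intro L1_loc_add L1_loc_cmult L1_loc_integrable gi w2)
      show "(\<lambda>x. (norm (?z x))\<^sup>2) \<in> borel_measurable lebesgue"
        using has_weak_gradient_L1_loc(5)[OF gz] by (intro borel_measurable_power borel_measurable_norm_compose)
      show "AE x in lebesgue. norm ((norm (?z x))\<^sup>2) \<le> norm (8 * C\<^sup>2 / d * ((norm (g x))\<^sup>2 * (v x)\<^sup>2) + 2 * C ^ 4 / d\<^sup>2 * (norm (w x))\<^sup>2)"
      proof (rule AE_I2)
        fix x
        let ?a = "damp d (v x) *\<^sub>R (\<phi> x *\<^sub>R g x + \<phi> x *\<^sub>R g x)" and ?b = "(\<phi> x * \<phi> x) *\<^sub>R (damp' d (v x) *\<^sub>R w x)"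
        have "(norm (?a + ?b))\<^sup>2 \<le> (norm ?a + norm ?b)\<^sup>2" by (intro power_mono norm_triangle_ineq) simp
        also have "\<dots> \<le> 2 * (norm ?a)\<^sup>2 + 2 * (norm ?b)\<^sup>2"
          using zero_le_power2[of "norm ?a - norm ?b"] by (simp add: power2_eq_square algebra_simps)
        finally have 1: "(norm (?a + ?b))\<^sup>2 \<le> 2 * (norm ?a)\<^sup>2 + 2 * (norm ?b)\<^sup>2" .
        have p2: "(\<phi> x)\<^sup>2 \<le> C\<^sup>2" using C[of x] by (simp add: abs_le_square_iff[symmetric] C0)
        have "?a = (2 * damp d (v x) * \<phi> x) *\<^sub>R g x" by (simp add: scaleR_2[symmetric] scaleR_add_left[symmetric])
        then have "(norm ?a)\<^sup>2 = (2 * damp d (v x) * \<phi> x)\<^sup>2 * (norm (g x))\<^sup>2"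
          by (simp only: norm_scaleR power_mult_distrib power2_abs)
        also have "\<dots> = 4 * (damp d (v x) * damp d (v x)) * (\<phi> x)\<^sup>2 * (norm (g x))\<^sup>2"
          by (simp add: power2_eq_square mult_ac)
        also have "\<dots> \<le> 4 * ((v x)\<^sup>2 / d * 1) * C\<^sup>2 * (norm (g x))\<^sup>2"
          using damp_bounds[OF d, of "v x"] p2 d by (intro mult_right_mono mult_mono mult_left_mono) auto
        finally have 2: "(norm ?a)\<^sup>2 \<le> 4 * C\<^sup>2 / d * ((norm (g x))\<^sup>2 * (v x)\<^sup>2)" by (simp add: mult_ac)
        have "(norm ?b)\<^sup>2 = (\<phi> x)\<^sup>2 * (\<phi> x)\<^sup>2 * \<bar>damp' d (v x)\<bar>\<^sup>2 * (norm (w x))\<^sup>2"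
          by (simp add: power_mult_distrib power2_eq_square abs_mult)
        also have "\<dots> \<le> C\<^sup>2 * C\<^sup>2 * (1 / d)\<^sup>2 * (norm (w x))\<^sup>2"
        proof -
          have "\<bar>damp' d (v x)\<bar>\<^sup>2 \<le> (1 / d)\<^sup>2" using damp'_bounds(1)[OF d, of "v x"] by (intro power_mono) auto
          with p2 show ?thesis by (intro mult_right_mono mult_mono) auto
        qed
        finally have 3: "(norm ?b)\<^sup>2 \<le> C ^ 4 / d\<^sup>2 * (norm (w x))\<^sup>2" by (simp add: power_divide power_add[symmetric])
        from 1 2 3 have "(norm (?z x))\<^sup>2 \<le> 8 * C\<^sup>2 / d * ((norm (g x))\<^sup>2 * (v x)\<^sup>2) + 2 * C ^ 4 / d\<^sup>2 * (norm (w x))\<^sup>2"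
          by linarith
        then show "norm ((norm (?z x))\<^sup>2) \<le> norm (8 * C\<^sup>2 / d * ((norm (g x))\<^sup>2 * (v x)\<^sup>2) + 2 * C ^ 4 / d\<^sup>2 * (norm (w x))\<^sup>2)"
          by simp
      qed
    qed
    have pm: "?p i \<in> borel_measurable lebesgue" for i
      by (intro borel_measurable_times tm mv borel_measurable_const)
    have p2: "L1_loc lebesgue (\<lambda>x. (?p i x)\<^sup>2)" for i
    proof (rule L1_loc_bound)
      show "L1_loc lebesgue (\<lambda>x. 4 / d\<^sup>2 * (w x $ i)\<^sup>2)" by (intro L1_loc_cmult L1_loc_nth_sq mv w2)
      show "(\<lambda>x. (?p i x)\<^sup>2) \<in> borel_measurable lebesgue" by (intro borel_measurable_power pm)
      show "AE x in lebesgue. norm ((?p i x)\<^sup>2) \<le> norm (4 / d\<^sup>2 * (w x $ i)\<^sup>2)"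
      proof (rule AE_I2)
        fix x
        have "(?p i x)\<^sup>2 = 4 * (\<bar>v x\<bar> * tame d ((v x)\<^sup>2))\<^sup>2 * (w x $ i)\<^sup>2" by (simp add: power_mult_distrib)
        also have "\<dots> \<le> 4 * (1 / d)\<^sup>2 * (w x $ i)\<^sup>2"
          using abs_tame_bound[OF d, of "v x"] tame_bounds(1)[OF d, of "(v x)\<^sup>2"]
          by (intro mult_right_mono mult_left_mono power_mono) auto
        finally show "norm ((?p i x)\<^sup>2) \<le> norm (4 / d\<^sup>2 * (w x $ i)\<^sup>2)" by (simp add: power_divide)
      qed
    qed
    have mm: "L1_loc lebesgue ?m"
    proof (rule L1_loc_bound)
      show "L1_loc lebesgue (\<lambda>x. \<bar>l x\<bar> + 4 * (norm (w x))\<^sup>2)" by (intro L1_loc_add L1_loc_abs L1_loc_cmult ml w2)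
      show "?m \<in> borel_measurable lebesgue"
        by (intro borel_measurable_add borel_measurable_times tm measl borel_measurable_const mv nA borel_measurable_power)
      show "AE x in lebesgue. norm (?m x) \<le> norm (\<bar>l x\<bar> + 4 * (norm (w x))\<^sup>2)"
      proof (rule AE_I2)
        fix x
        note T = tame_bounds[OF d, of "(v x)\<^sup>2", simplified]
        have "\<bar>tame d ((v x)\<^sup>2) * l x\<bar> \<le> 1 * \<bar>l x\<bar>" unfolding abs_mult using T by (intro mult_right_mono) auto
        moreover have "\<bar>tame' d ((v x)\<^sup>2) * (4 * (v x)\<^sup>2 * (norm (w x))\<^sup>2)\<bar> = 4 * \<bar>(v x)\<^sup>2 * tame' d ((v x)\<^sup>2)\<bar> * (norm (w x))\<^sup>2"
          by (simp add: abs_mult)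
        moreover have "4 * \<bar>(v x)\<^sup>2 * tame' d ((v x)\<^sup>2)\<bar> * (norm (w x))\<^sup>2 \<le> 4 * 1 * (norm (w x))\<^sup>2"
          using T by (intro mult_right_mono mult_left_mono) auto
        ultimately show "norm (?m x) \<le> norm (\<bar>l x\<bar> + 4 * (norm (w x))\<^sup>2)"
          unfolding real_norm_def by linarith
      qed
    qed
    have zb: "\<bar>?zeta x\<bar> \<le> C * C * 1" for x
      unfolding abs_mult[of "\<phi> x * \<phi> x"] using f2[of x] dT C0 by (intro mult_mono) auto
    have te: "(\<integral>x. (\<Sum>i\<in>UNIV. E i x * ?p i x) \<partial>lebesgue) = - (\<integral>x. \<eta> x * ?m x \<partial>lebesgue)"
      if "C1_with \<eta> E" "\<forall>x. norm x > R \<longrightarrow> \<eta> x = 0" for \<eta> E R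
      by (rule weak_laplacian_compose[OF u l mv(5) w2 DERIV_tame[OF d] continuous_tame(2)[OF d], where B = 1])
        (use tame_bounds[OF d] that in auto)
    have sz: "?zeta x = 0" "?z x = 0" if "norm x > R" for x using s that by auto
    have wd: "(\<integral>x. (\<Sum>i\<in>UNIV. ?z x $ i * ?p i x) \<partial>lebesgue) = - (\<integral>x. ?zeta x * ?m x \<partial>lebesgue)"
      "integrable lebesgue (\<lambda>x. \<Sum>i\<in>UNIV. ?z x $ i * ?p i x)" "integrable lebesgue (\<lambda>x. ?zeta x * ?m x)"
      by (rule weak_duality[OF gz zb sz z2 pm p2 mm], assumption, assumption, erule (1) te)+
    \<comment> \<open>Formally the divergence of
      \<open>\<phi>\<^sup>2 * damp d v * tame d \<mu>\<close> times \<open>grad \<mu>\<close>, where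
      \<open>\<mu> = v\<^sup>2\<close>. Half of it contains the mixed term in
      \<open>g x \<bullet> w x\<close> with the coefficient 2 of the square.\<close>
    define Q2 where "Q2 x = (\<Sum>i\<in>UNIV. ?z x $ i * ?p i x) + ?zeta x * ?m x" for x
    have Q2: "integrable lebesgue Q2" "(\<integral>x. Q2 x \<partial>lebesgue) = 0"
      unfolding Q2_def
      by (rule Bochner_Integration.integrable_add[OF wd(2,3)])
        (simp only: Bochner_Integration.integral_add[OF wd(2,3)] wd(1) add.left_inverse)
    have pt: "Q1 x - Q2 x / 2 + J d x \<le> (norm (g x))\<^sup>2 * (v x)\<^sup>2" for x
    proof -
      define T T' h h' where "T = damp d (v x)" and "T' = damp' d (v x)" and "h = tame d ((v x)\<^sup>2)" and "h' = tame' d ((v x)\<^sup>2)"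
      have S: "trunc d (v x) = (v x)\<^sup>2 * T * h" by (simp add: trunc_def T_def h_def)
      have th: "0 \<le> T * h" "T * h \<le> 1"
        using damp_bounds[OF d, of "v x"] tame_bounds[OF d, of "(v x)\<^sup>2"] unfolding T_def h_def
        by (auto intro: mult_le_one)
      have e1: "Q1 x = (\<phi> x)\<^sup>2 * trunc d (v x) * divA x + 2 * \<phi> x * trunc d (v x) * (g x \<bullet> A x) + (\<phi> x)\<^sup>2 * trunc' d (v x) * (w x \<bullet> A x)"
        unfolding Q1_def inner_add_left inner_scaleR_left scaleR_add_right by (simp add: power2_eq_square algebra_simps)
      have "(\<Sum>i\<in>UNIV. ?z x $ i * ?p i x) = ?z x \<bullet> ((2 * h * v x) *\<^sub>R w x)"
        by (simp add: inner_vec_def h_def mult_ac)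
      also have "\<dots> = 4 * \<phi> x * (T * h) * v x * (g x \<bullet> w x) + 2 * (\<phi> x)\<^sup>2 * (T' * h * v x) * (norm (w x))\<^sup>2"
        unfolding power2_norm_eq_inner T_def[symmetric] T'_def[symmetric] inner_add_left inner_scaleR_left inner_scaleR_right scaleR_add_right
        by (simp add: power2_eq_square algebra_simps)
      finally have e2: "Q2 x = 4 * \<phi> x * (T * h) * v x * (g x \<bullet> w x) + 2 * (\<phi> x)\<^sup>2 * (T' * h * v x) * (norm (w x))\<^sup>2
         + (\<phi> x)\<^sup>2 * T * (h * l x + h' * (4 * (v x)\<^sup>2 * (norm (w x))\<^sup>2))"
        unfolding Q2_def T_def h_def h'_def by (simp add: power2_eq_square)
      have "Q1 x - Q2 x / 2 + J d x = T * h * (2 * \<phi> x * (v x)\<^sup>2 * (g x \<bullet> A x) - 2 * \<phi> x * v x * (g x \<bullet> w x) - (\<phi> x)\<^sup>2 * (v x)\<^sup>2 * (norm (A x))\<^sup>2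
          + 2 * (\<phi> x)\<^sup>2 * v x * (w x \<bullet> A x) - (\<phi> x)\<^sup>2 * (norm (w x))\<^sup>2)"
        unfolding e1 e2 J_def S T_def[symmetric] T'_def[symmetric] h_def[symmetric] h'_def[symmetric]
        by (simp add: field_simps)
      also have "\<dots> \<le> (norm (g x))\<^sup>2 * (v x)\<^sup>2" by (rule square_completion[OF th])
      finally show ?thesis .
    qed
    have "(\<integral>x. J d x \<partial>lebesgue) = (\<integral>x. Q1 x - Q2 x / 2 + J d x \<partial>lebesgue)"
      using Q1 Q2 iJ by simp
    also have "\<dots> \<le> (\<integral>x. (norm (g x))\<^sup>2 * (v x)\<^sup>2 \<partial>lebesgue)"
      using Q1(1) Q2(1) iJ gi by (intro integral_mono pt) auto
    finally show "(\<integral>x. J d x \<partial>lebesgue) \<le> (\<integral>x. (norm (g x))\<^sup>2 * (v x)\<^sup>2 \<partial>lebesgue)" .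
  qed
  \<comment> \<open>The product \<open>\<bar>v\<bar> * \<bar>w \<bullet> A\<bar>\<close> enters the
    estimate of \<open>J\<close> five times through \<open>trunc'\<close> and twice through the last
    bracket, each time bounded by \<open>v\<^sup>2 * |A|^2 + |w|^2\<close>. Hence 8 = 1 + 7 in front
    of \<open>|A|^2\<close> and 11 = 4 + 7 in front of \<open>|w|^2\<close>.\<close>
  have "continuous_on UNIV (\<lambda>x. \<bar>divA x\<bar> + 8 * (norm (A x))\<^sup>2)" by (intro continuous_intros cD cA)
  then obtain K where K: "K \<ge> 0" "\<And>x. norm x \<le> R \<Longrightarrow> \<bar>\<bar>divA x\<bar> + 8 * (norm (A x))\<^sup>2\<bar> \<le> K"
    by (rule continuous_cball_bound[where R = R]) blast
  define Dom where "Dom x = C\<^sup>2 * (K * (indicator (cball 0 R) x *\<^sub>R (v x)\<^sup>2) + 11 * (indicator (cball 0 R) x *\<^sub>R (norm (w x))\<^sup>2)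
     + indicator (cball 0 R) x *\<^sub>R \<bar>l x\<bar>)" for x :: "real ^ 'n"
  have iD: "integrable lebesgue Dom" unfolding Dom_def
    by (intro integrable_mult_right Bochner_Integration.integrable_add L1_loc_cball v2 w2 L1_loc_abs ml)
  have JD: "\<bar>J d x\<bar> \<le> Dom x" if d: "0 < d" "d \<le> 1" for d x
  proof (cases "norm x \<le> R")
    case False
    then show ?thesis using s(1)[of x] by (simp add: J_def Dom_def)
  next
    case True
    note T = tame_bounds[OF d, of "(v x)\<^sup>2", simplified] and D = damp_bounds[OF d, of "v x"]
    have th: "0 \<le> damp d (v x) * tame d ((v x)\<^sup>2)" "damp d (v x) * tame d ((v x)\<^sup>2) \<le> 1"
      using T D by (auto intro: mult_le_one)
    have p2: "(\<phi> x)\<^sup>2 \<le> C\<^sup>2" using C[of x] by (simp add: abs_le_square_iff[symmetric] C0)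
    have vwA: "\<bar>v x\<bar> * \<bar>w x \<bullet> A x\<bar> \<le> (v x)\<^sup>2 * (norm (A x))\<^sup>2 + (norm (w x))\<^sup>2"
    proof -
      have "\<bar>v x\<bar> * \<bar>w x \<bullet> A x\<bar> \<le> \<bar>v x\<bar> * (norm (w x) * norm (A x))" by (intro mult_left_mono Cauchy_Schwarz_ineq2) auto
      also have "\<dots> \<le> (\<bar>v x\<bar> * norm (A x))\<^sup>2 + (norm (w x))\<^sup>2"
      proof -
        have "2 * ((\<bar>v x\<bar> * norm (A x)) * norm (w x)) \<le> (\<bar>v x\<bar> * norm (A x))\<^sup>2 + (norm (w x))\<^sup>2"
          using zero_le_power2[of "\<bar>v x\<bar> * norm (A x) - norm (w x)"] by (simp add: power2_eq_square algebra_simps)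
        moreover have "0 \<le> (\<bar>v x\<bar> * norm (A x)) * norm (w x)" by simp
        ultimately have "(\<bar>v x\<bar> * norm (A x)) * norm (w x) \<le> (\<bar>v x\<bar> * norm (A x))\<^sup>2 + (norm (w x))\<^sup>2" by linarith
        then show ?thesis by (simp add: mult_ac)
      qed
      finally show ?thesis by (simp add: power_mult_distrib)
    qed
    have t1: "\<bar>- trunc d (v x) * divA x\<bar> \<le> (v x)\<^sup>2 * \<bar>divA x\<bar>"
      unfolding abs_mult using trunc_bounds(1)[OF d, of "v x"] by (intro mult_right_mono) auto
    have t2: "\<bar>trunc' d (v x) * (w x \<bullet> A x)\<bar> \<le> 5 * (\<bar>v x\<bar> * \<bar>w x \<bullet> A x\<bar>)"
      using mult_right_mono[OF trunc_bounds(3)[OF d, of "v x"], of "\<bar>w x \<bullet> A x\<bar>"] by (simp add: abs_mult mult_ac)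
    have a1: "\<bar>damp' d (v x) * tame d ((v x)\<^sup>2) * v x\<bar> \<le> 1"
    proof -
      have "\<bar>damp' d (v x) * tame d ((v x)\<^sup>2) * v x\<bar> = \<bar>damp' d (v x) * v x\<bar> * tame d ((v x)\<^sup>2)" using T by (simp add: abs_mult)
      also have "\<dots> \<le> 1" using damp'_bounds(2)[OF d, of "v x"] T by (intro mult_le_one) auto
      finally show ?thesis .
    qed
    have a2: "\<bar>damp d (v x) * tame' d ((v x)\<^sup>2) * (v x)\<^sup>2\<bar> \<le> 1"
    proof -
      have "\<bar>damp d (v x) * tame' d ((v x)\<^sup>2) * (v x)\<^sup>2\<bar> = damp d (v x) * \<bar>(v x)\<^sup>2 * tame' d ((v x)\<^sup>2)\<bar>" using D by (simp add: abs_mult)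
      also have "\<dots> \<le> 1" using D T by (intro mult_le_one) auto
      finally show ?thesis .
    qed
    have t3: "\<bar>(damp' d (v x) * tame d ((v x)\<^sup>2) * v x + 2 * (damp d (v x) * tame' d ((v x)\<^sup>2) * (v x)\<^sup>2) - damp d (v x) * tame d ((v x)\<^sup>2)) * (norm (w x))\<^sup>2\<bar>
       \<le> 4 * (norm (w x))\<^sup>2"
    proof -
      have "\<bar>damp' d (v x) * tame d ((v x)\<^sup>2) * v x + 2 * (damp d (v x) * tame' d ((v x)\<^sup>2) * (v x)\<^sup>2) - damp d (v x) * tame d ((v x)\<^sup>2)\<bar> \<le> 4"
        using a1 a2 th by linarith
      from mult_right_mono[OF this, of "(norm (w x))\<^sup>2"] show ?thesis by (simp add: abs_mult)
    qed
    have t4: "\<bar>damp d (v x) * tame d ((v x)\<^sup>2) * (l x / 2 - (v x)\<^sup>2 * (norm (A x))\<^sup>2 + 2 * v x * (w x \<bullet> A x))\<bar>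
      \<le> \<bar>l x\<bar> + (v x)\<^sup>2 * (norm (A x))\<^sup>2 + 2 * (\<bar>v x\<bar> * \<bar>w x \<bullet> A x\<bar>)"
    proof -
      have "\<bar>l x / 2 - (v x)\<^sup>2 * (norm (A x))\<^sup>2 + 2 * v x * (w x \<bullet> A x)\<bar> \<le> \<bar>l x / 2\<bar> + \<bar>(v x)\<^sup>2 * (norm (A x))\<^sup>2\<bar> + \<bar>2 * v x * (w x \<bullet> A x)\<bar>"
        by linarith
      also have "\<dots> \<le> \<bar>l x\<bar> + (v x)\<^sup>2 * (norm (A x))\<^sup>2 + 2 * (\<bar>v x\<bar> * \<bar>w x \<bullet> A x\<bar>)" by (simp add: abs_mult)
      finally have b: "\<bar>l x / 2 - (v x)\<^sup>2 * (norm (A x))\<^sup>2 + 2 * v x * (w x \<bullet> A x)\<bar> \<le> \<bar>l x\<bar> + (v x)\<^sup>2 * (norm (A x))\<^sup>2 + 2 * (\<bar>v x\<bar> * \<bar>w x \<bullet> A x\<bar>)" .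
      have "\<bar>damp d (v x) * tame d ((v x)\<^sup>2)\<bar> * \<bar>l x / 2 - (v x)\<^sup>2 * (norm (A x))\<^sup>2 + 2 * v x * (w x \<bullet> A x)\<bar>
        \<le> 1 * (\<bar>l x\<bar> + (v x)\<^sup>2 * (norm (A x))\<^sup>2 + 2 * (\<bar>v x\<bar> * \<bar>w x \<bullet> A x\<bar>))"
        using th b by (intro mult_mono) auto
      then show ?thesis by (simp only: abs_mult mult_1)
    qed
    define Y where "Y = - trunc d (v x) * divA x - trunc' d (v x) * (w x \<bullet> A x)
      + (damp' d (v x) * tame d ((v x)\<^sup>2) * v x + 2 * (damp d (v x) * tame' d ((v x)\<^sup>2) * (v x)\<^sup>2) - damp d (v x) * tame d ((v x)\<^sup>2)) * (norm (w x))\<^sup>2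
      + damp d (v x) * tame d ((v x)\<^sup>2) * (l x / 2 - (v x)\<^sup>2 * (norm (A x))\<^sup>2 + 2 * v x * (w x \<bullet> A x))"
    have "\<bar>Y\<bar> \<le> (v x)\<^sup>2 * \<bar>divA x\<bar> + 5 * (\<bar>v x\<bar> * \<bar>w x \<bullet> A x\<bar>) + 4 * (norm (w x))\<^sup>2
       + (\<bar>l x\<bar> + (v x)\<^sup>2 * (norm (A x))\<^sup>2 + 2 * (\<bar>v x\<bar> * \<bar>w x \<bullet> A x\<bar>))"
    proof -
      have "\<bar>a - b + c + e\<bar> \<le> A1 + A2 + A3 + A4" if "\<bar>a\<bar> \<le> A1" "\<bar>b\<bar> \<le> A2" "\<bar>c\<bar> \<le> A3" "\<bar>e\<bar> \<le> A4"
        for a b c e A1 A2 A3 A4 :: real using that by linarith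
      from this[OF t1 t2 t3 t4] show ?thesis unfolding Y_def .
    qed
    also have "\<dots> \<le> (v x)\<^sup>2 * \<bar>divA x\<bar> + 8 * ((v x)\<^sup>2 * (norm (A x))\<^sup>2) + 11 * (norm (w x))\<^sup>2 + \<bar>l x\<bar>"
      using vwA by linarith
    also have "\<dots> = (v x)\<^sup>2 * (\<bar>divA x\<bar> + 8 * (norm (A x))\<^sup>2) + 11 * (norm (w x))\<^sup>2 + \<bar>l x\<bar>" by (simp add: algebra_simps)
    also have "\<dots> \<le> (v x)\<^sup>2 * K + 11 * (norm (w x))\<^sup>2 + \<bar>l x\<bar>"
      using K(2)[OF True] by (intro add_right_mono mult_left_mono) auto
    finally have "(\<phi> x)\<^sup>2 * \<bar>Y\<bar> \<le> C\<^sup>2 * ((v x)\<^sup>2 * K + 11 * (norm (w x))\<^sup>2 + \<bar>l x\<bar>)"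
      using p2 by (intro mult_mono) auto
    moreover have "\<bar>J d x\<bar> = (\<phi> x)\<^sup>2 * \<bar>Y\<bar>" by (simp add: J_def Y_def abs_mult)
    moreover have "Dom x = C\<^sup>2 * ((v x)\<^sup>2 * K + 11 * (norm (w x))\<^sup>2 + \<bar>l x\<bar>)" using True by (simp add: Dom_def mult_ac)
    ultimately show ?thesis by simp
  qed
  have Jm: "J d \<in> borel_measurable lebesgue" if d: "0 < d" "d \<le> 1" for d
  proof -
    have "continuous_on UNIV (\<lambda>t :: real. tame d (t\<^sup>2))" "continuous_on UNIV (\<lambda>t :: real. tame' d (t\<^sup>2))"
      by (auto intro!: continuous_on_compose2[OF continuous_tame(1)[OF d]] continuous_on_compose2[OF continuous_tame(2)[OF d]] continuous_intros)
    note t = this[THEN continuous_on_real_compose_measurable, OF mv(4)]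
      continuous_damp[OF d, THEN continuous_on_real_compose_measurable, OF mv(4)]
      continuous_trunc[OF d, THEN continuous_on_real_compose_measurable, OF mv(4)]
    show ?thesis unfolding J_def[abs_def]
      by (intro borel_measurable_add borel_measurable_diff borel_measurable_times borel_measurable_uminus borel_measurable_divide
          borel_measurable_power borel_measurable_const t mv(4) mf(4) measl measA(2) wA nA)
  qed
  define dn where "dn n = 1 / (real n + 1)" for n
  have dn: "0 < dn n" "dn n \<le> 1" for n by (auto simp: dn_def)
  have dn0: "dn \<longlonglongrightarrow> 0" using LIMSEQ_inverse_real_of_nat unfolding dn_def by (simp add: inverse_eq_divide add.commute)
  have Jlim: "(\<lambda>n. J (dn n) x) \<longlonglongrightarrow> - Q x" for x
  proof (cases "v x = 0")
    case True
    then have "J d x = 0" "Q x = 0" for d by (simp_all add: J_def Q_def trunc_def trunc'_def damp_def damp'_def)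
    then show ?thesis by simp
  next
    case False
    note L = damp_limits[OF dn0, of "v x"] and L' = damp_limits(2-)[OF dn0 False]
    have "(\<lambda>n. J (dn n) x) \<longlonglongrightarrow> (\<phi> x)\<^sup>2 * (- (v x)\<^sup>2 * divA x - (2 * v x) * (w x \<bullet> A x)
      + (0 + 2 * 0 - 1) * (norm (w x))\<^sup>2 + 1 * (l x / 2 - (v x)\<^sup>2 * (norm (A x))\<^sup>2 + 2 * v x * (w x \<bullet> A x)))"
      unfolding J_def by (intro tendsto_mult tendsto_add tendsto_diff tendsto_minus tendsto_const L(1) L')
    moreover have "(\<phi> x)\<^sup>2 * (- (v x)\<^sup>2 * divA x - (2 * v x) * (w x \<bullet> A x)
      + (0 + 2 * 0 - 1) * (norm (w x))\<^sup>2 + 1 * (l x / 2 - (v x)\<^sup>2 * (norm (A x))\<^sup>2 + 2 * v x * (w x \<bullet> A x))) = - Q x"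
      using False by (simp add: Q_def divA_def[symmetric] algebra_simps)
    ultimately show ?thesis by simp
  qed
  have Qm: "(\<lambda>x. - Q x) \<in> borel_measurable lebesgue"
    by (rule borel_measurable_LIMSEQ_metric[OF Jm[OF dn] Jlim])
  have iJ: "integrable lebesgue (J (dn n))" for n
  proof (rule Bochner_Integration.integrable_bound[OF iD Jm[OF dn]], rule AE_I2)
    fix x
    show "norm (J (dn n) x) \<le> norm (Dom x)" using JD[OF dn, of n x] by simp
  qed
  have bd: "AE x in lebesgue. norm (J (dn n) x) \<le> Dom x" for n using JD[OF dn] by auto
  have lim: "AE x in lebesgue. (\<lambda>n. J (dn n) x) \<longlonglongrightarrow> - Q x" using Jlim by auto
  have iQ: "integrable lebesgue (\<lambda>x. - Q x)"
    by (rule integrable_dominated_convergence[OF Qm Jm[OF dn] iD lim bd])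
  then show "integrable lebesgue Q" using integrable_minus by fastforce
  have "(\<lambda>n. \<integral>x. J (dn n) x \<partial>lebesgue) \<longlonglongrightarrow> (\<integral>x. - Q x \<partial>lebesgue)"
    by (rule integral_dominated_convergence[OF Qm Jm[OF dn] iD lim bd])
  moreover have "(\<integral>x. J (dn n) x \<partial>lebesgue) \<le> (\<integral>x. (norm (g x))\<^sup>2 * (v x)\<^sup>2 \<partial>lebesgue)" for n
    using step[OF dn] iJ by blast
  ultimately have "(\<integral>x. - Q x \<partial>lebesgue) \<le> (\<integral>x. (norm (g x))\<^sup>2 * (v x)\<^sup>2 \<partial>lebesgue)"
    by (meson LIMSEQ_le_const2)
  then show "- (\<integral>x. Q x \<partial>lebesgue) \<le> (\<integral>x. (norm (g x))\<^sup>2 * (v x)\<^sup>2 \<partial>lebesgue)" by simp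
qed

section \<open>The Hardy inequality with logarithmic remainder\<close>

text \<open>
  \<open>log_drift b (r\<^sup>2) x\<close> is \<open>grad \<Phi> / \<Phi>\<close> for \<open>\<Phi>(x) = r powr (- b) * sqrt (- ln r)\<close>, \<open>r = norm x\<close>. The cutoff
  vanishes for \<open>s \<ge> 1/2\<close>, away from the singularity of \<open>log_drift\<close> at \<open>s = 1\<close>.
\<close>

definition log_drift :: "real \<Rightarrow> real \<Rightarrow> real" where "log_drift b s = - b / s + 1 / (s * ln s)"
definition log_drift' :: "real \<Rightarrow> real \<Rightarrow> real" where "log_drift' b s = b / s\<^sup>2 - (ln s + 1) / (s * ln s)\<^sup>2"
definition drift_cutoff :: "real \<Rightarrow> real" where "drift_cutoff s = (max 0 (1 - 2 * s))\<^sup>2"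
definition drift_cutoff' :: "real \<Rightarrow> real" where "drift_cutoff' s = - (4 * max 0 (1 - 2 * s))"
definition cut_drift :: "real \<Rightarrow> real \<Rightarrow> real" where "cut_drift b s = drift_cutoff s * log_drift b s"
definition cut_drift' :: "real \<Rightarrow> real \<Rightarrow> real" where "cut_drift' b s = drift_cutoff' s * log_drift b s + drift_cutoff s * log_drift' b s"

lemma DERIV_drift_cutoff: "(drift_cutoff has_real_derivative drift_cutoff' s) (at s)"
proof -
  have "((\<lambda>s. 1 - 2 * s) has_real_derivative - 2) (at s)" by (auto intro!: derivative_eq_intros)
  from DERIV_chain2[OF DERIV_max_sq this] show ?thesis
    unfolding drift_cutoff_def[abs_def] drift_cutoff'_def by (simp add: mult_ac)
qed

lemma drift_cutoff_0: "s \<ge> 1 / 2 \<Longrightarrow> drift_cutoff s = 0" "s \<ge> 1 / 2 \<Longrightarrow> drift_cutoff' s = 0"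
  by (auto simp: drift_cutoff_def drift_cutoff'_def)

lemma DERIV_log_drift:
  assumes "0 < s" "s < 1"
  shows "(log_drift b has_real_derivative log_drift' b s) (at s)"
proof -
  have ln: "ln s \<noteq> 0" using assms by simp
  have "((\<lambda>s. - b / s + 1 / (s * ln s)) has_real_derivative b / s\<^sup>2 + - (1 * ln s + 1 / s * s) / (s * ln s)\<^sup>2) (at s)"
    using assms ln by (auto intro!: derivative_eq_intros simp: power2_eq_square)
  moreover have "1 / s * s = 1" using assms by simp
  ultimately show ?thesis unfolding log_drift_def[abs_def] log_drift'_def
    by (simp only: mult_1 minus_divide_left diff_conv_add_uminus)
qed

lemma DERIV_cut_drift:
  assumes "0 < s"
  shows "(cut_drift b has_real_derivative cut_drift' b s) (at s)"
proof (cases "s < 1")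
  case True
  from DERIV_mult[OF DERIV_drift_cutoff DERIV_log_drift[OF assms True, of b]]
  show ?thesis unfolding cut_drift_def[abs_def] cut_drift'_def by (simp add: algebra_simps)
next
  case False
  have "((\<lambda>s. 0) has_real_derivative 0) (at s)" by simp
  then have "(cut_drift b has_real_derivative 0) (at s)"
    by (rule DERIV_cong_ev[THEN iffD1, rotated 3])
      (use False drift_cutoff_0(1) in \<open>auto simp: cut_drift_def intro!: eventually_mono[OF eventually_nhds_in_open[of "{1/2<..}" s]]\<close>)
  then show ?thesis using False by (simp add: cut_drift'_def drift_cutoff_0)
qed

lemma continuous_cut_drift': "continuous_on {0<..} (cut_drift' b)"
proof -
  have c: "continuous_on UNIV drift_cutoff" "continuous_on UNIV drift_cutoff'"
    unfolding drift_cutoff_def drift_cutoff'_def by (intro continuous_intros)+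
  have "continuous_on {0<..<1} (cut_drift' b)"
    unfolding cut_drift'_def log_drift_def log_drift'_def
    by (intro continuous_intros continuous_on_subset[OF c(1)] continuous_on_subset[OF c(2)]) auto
  moreover have "continuous_on {1/2<..} (cut_drift' b)"
  proof -
    have "continuous_on {1/2<..} (cut_drift' b) \<longleftrightarrow> continuous_on {1/2<..} (\<lambda>s :: real. 0 :: real)"
      by (intro continuous_on_cong) (auto simp: cut_drift'_def drift_cutoff_0)
    then show ?thesis by simp
  qed
  ultimately have "continuous_on ({0<..<1} \<union> {1/2<..}) (cut_drift' b)"
    by (intro continuous_on_open_Un) auto
  moreover have "{0<..<1} \<union> {1/2<..} = {0 :: real<..}" by auto
  ultimately show ?thesis by simp
qed

lemma abs_ln_lower: "0 < s \<Longrightarrow> s \<le> 1 / 2 \<Longrightarrow> \<bar>ln s\<bar> \<ge> 1 / 2" for s :: real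
  using ln_le_minus_one[of s] by auto

text \<open>For \<open>s \<le> 1 / 2\<close> the reciprocal of \<open>ln s\<close> is at most 2 in
  absolute value; it enters the first bound linearly and the second also squared, whence
  \<open>b + 2\<close> and \<open>b + 2 + 4\<close>.\<close>

lemma log_drift_bounds:
  assumes s: "0 < s" "s \<le> 1 / 2" and b: "b \<ge> 0"
  shows "s * \<bar>log_drift b s\<bar> \<le> b + 2" "s\<^sup>2 * \<bar>log_drift' b s\<bar> \<le> b + 6"
proof -
  note l = abs_ln_lower[OF s]
  have il: "\<bar>1 / ln s\<bar> \<le> 2" using l by (auto simp: abs_divide divide_le_eq)
  have "s * log_drift b s = - b + 1 / ln s" using s by (simp add: log_drift_def field_simps)
  then have "\<bar>s * log_drift b s\<bar> \<le> b + 2" using il b by linarith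
  then show "s * \<bar>log_drift b s\<bar> \<le> b + 2" using s by (simp add: abs_mult)
  have ln0: "ln s \<noteq> 0" using l by auto
  have "s\<^sup>2 * log_drift' b s = b - 1 / ln s - (1 / ln s)\<^sup>2" using s ln0 by (simp add: log_drift'_def power2_eq_square field_simps)
  moreover have "(1 / ln s)\<^sup>2 \<le> 4" using power_mono[OF il abs_ge_zero, of 2] unfolding power2_abs by simp
  moreover have "0 \<le> (1 / ln s)\<^sup>2" by simp
  ultimately have "\<bar>s\<^sup>2 * log_drift' b s\<bar> \<le> b + 6" using il b by linarith
  then show "s\<^sup>2 * \<bar>log_drift' b s\<bar> \<le> b + 6" by (simp add: abs_mult)
qed

lemma drift_cutoff_bounds: "s \<ge> 0 \<Longrightarrow> 0 \<le> drift_cutoff s \<and> drift_cutoff s \<le> 1" "s \<ge> 0 \<Longrightarrow> \<bar>drift_cutoff' s\<bar> \<le> 4" "drift_cutoff s \<ge> 1 - 4 * s \<or> s > 1/2"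
proof -
  show "0 \<le> drift_cutoff s \<and> drift_cutoff s \<le> 1" if "s \<ge> 0" using that by (auto simp: drift_cutoff_def power_le_one)
  show "\<bar>drift_cutoff' s\<bar> \<le> 4" if "s \<ge> 0" using that by (auto simp: drift_cutoff'_def)
  show "drift_cutoff s \<ge> 1 - 4 * s \<or> s > 1/2"
  proof (cases "s > 1/2")
    case False
    then have "drift_cutoff s = 1 - 4 * s + 4 * s\<^sup>2" by (simp add: drift_cutoff_def power2_eq_square algebra_simps)
    then show ?thesis by simp
  qed simp
qed

text \<open>The bounds scale like the field itself and hold on the whole half-line, as the cutoff
  vanishes from 1/2 on. In \<open>5 * b + 14 = 4 * (b + 2) + (b + 6)\<close> the first summand stems
  from the derivative of the cutoff.\<close>

lemma cut_drift_bounds: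
  assumes s: "0 < s" and b: "b \<ge> 0"
  shows "\<bar>cut_drift b s\<bar> \<le> (b + 2) / s" "\<bar>cut_drift' b s\<bar> \<le> (5 * b + 14) / s\<^sup>2"
proof -
  have "\<bar>cut_drift b s\<bar> \<le> (b + 2) / s \<and> \<bar>cut_drift' b s\<bar> \<le> (5 * b + 14) / s\<^sup>2"
  proof (cases "s \<le> 1 / 2")
    case False
    then show ?thesis using s b by (simp add: cut_drift_def cut_drift'_def drift_cutoff_0)
  next
    case True
    note B = log_drift_bounds[OF s True b]
    have k: "0 \<le> drift_cutoff s" "drift_cutoff s \<le> 1" "\<bar>drift_cutoff' s\<bar> \<le> 4" using drift_cutoff_bounds[of s] s by auto
    have 1: "\<bar>log_drift b s\<bar> \<le> (b + 2) / s" using B(1) s by (simp add: pos_le_divide_eq mult.commute)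
    have 2: "\<bar>log_drift' b s\<bar> \<le> (b + 6) / s\<^sup>2" using B(2) s by (simp add: pos_le_divide_eq mult.commute)
    have "\<bar>cut_drift b s\<bar> \<le> 1 * ((b + 2) / s)" unfolding cut_drift_def abs_mult using k 1 by (intro mult_mono) auto
    moreover have "\<bar>cut_drift' b s\<bar> \<le> 4 * ((b + 2) / s) + 1 * ((b + 6) / s\<^sup>2)"
    proof -
      have "\<bar>drift_cutoff' s * log_drift b s\<bar> \<le> 4 * ((b + 2) / s)" unfolding abs_mult using k 1 by (intro mult_mono) auto
      moreover have "\<bar>drift_cutoff s * log_drift' b s\<bar> \<le> 1 * ((b + 6) / s\<^sup>2)" unfolding abs_mult using k 2 by (intro mult_mono) auto
      ultimately show ?thesis unfolding cut_drift'_def by linarith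
    qed
    moreover have "4 * ((b + 2) / s) \<le> (4 * (b + 2)) / s\<^sup>2"
    proof -
      have "4 * (b + 2) * s \<le> 4 * (b + 2) * 1" using True b by (intro mult_left_mono) auto
      then have "4 * (b + 2) * s / s\<^sup>2 \<le> 4 * (b + 2) * 1 / s\<^sup>2" by (rule divide_right_mono) simp
      then show ?thesis using s by (simp add: power2_eq_square)
    qed
    moreover have "(4 * (b + 2)) / s\<^sup>2 + (b + 6) / s\<^sup>2 = (5 * b + 14) / s\<^sup>2" by (simp add: add_divide_distrib[symmetric])
    ultimately show ?thesis by linarith
  qed
  then show "\<bar>cut_drift b s\<bar> \<le> (b + 2) / s" "\<bar>cut_drift' b s\<bar> \<le> (5 * b + 14) / s\<^sup>2" by auto
qed

text \<open>A field \<open>a (|x|^2)\<close> times x in dimension \<open>n\<close> has divergence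
  \<open>n * a + 2 * s * a'\<close> and squared length \<open>s * a\<^sup>2\<close>, so the left
  side is the Laplacian of \<Phi> divided by \<Phi>. The choice \<open>n = 2 * b + 2\<close> cancels
  the terms in \<open>1 / (s * ln s)\<close>; the factor 1/4 is hidden in
  \<open>ln s = 2 * ln r\<close>.\<close>

lemma log_drift_identity:
  assumes s: "0 < s" "s < 1" and n: "n = 2 * b + 2"
  shows "s * (log_drift b s)\<^sup>2 + n * log_drift b s + 2 * s * log_drift' b s = - (b\<^sup>2 / s) - 1 / (s * (ln s)\<^sup>2)"
proof -
  have "ln s \<noteq> 0" using s by simp
  then show ?thesis unfolding n log_drift_def log_drift'_def using s by (simp add: field_simps power2_eq_square)
qed

text \<open>Below 1/2 the cutoff perturbs the identity by bounded terms only. Replacing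
  \<open>k\<close> by 1 costs at most \<open>4 * s * P \<le> 4 * (b\<^sup>2 + 4)\<close>, the
  derivative of the cutoff at most \<open>8 * (b + 2)\<close>, and the term with
  \<open>k - k\<^sup>2\<close> has the favourable sign. The sum of the costs is
  \<open>4 * b\<^sup>2 + 8 * b + 32\<close>.\<close>

lemma cut_drift_lower:
  assumes s: "0 < s" and b: "b \<ge> 0" and n: "n = 2 * b + 2"
  shows "b\<^sup>2 / s + (if s < 1/2 then 1 / (s * (ln s)\<^sup>2) else 0) - (4 * b\<^sup>2 + 8 * b + 32)
    \<le> - (2 * s * cut_drift' b s + n * cut_drift b s + s * (cut_drift b s)\<^sup>2)"
proof (cases "s < 1 / 2")
  case False
  then have "b\<^sup>2 / s \<le> b\<^sup>2 / (1 / 2)" by (intro divide_left_mono) auto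
  then have "b\<^sup>2 / s \<le> 2 * b\<^sup>2" by simp
  then have "b\<^sup>2 / s \<le> 4 * b\<^sup>2 + 8 * b + 32" using b zero_le_power2[of b] by linarith
  then show ?thesis using False by (simp add: cut_drift_def cut_drift'_def drift_cutoff_0)
next
  case True
  define P where "P = b\<^sup>2 / s + 1 / (s * (ln s)\<^sup>2)"
  have P0: "P \<ge> 0" using s by (simp add: P_def)
  define k where "k = drift_cutoff s"
  have k: "0 \<le> k" "k \<le> 1" "\<bar>drift_cutoff' s\<bar> \<le> 4" using drift_cutoff_bounds(1,2)[of s] s by (auto simp: k_def)
  have k4: "1 - 4 * s \<le> k" using drift_cutoff_bounds(3)[of s] True by (auto simp: k_def)
  have id: "s * (log_drift b s)\<^sup>2 + n * log_drift b s + 2 * s * log_drift' b s = - P"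
    using log_drift_identity[OF s _ n] True by (simp add: P_def)
  have eq: "- (2 * s * cut_drift' b s + n * cut_drift b s + s * (cut_drift b s)\<^sup>2) =
     k * P + s * (k - k\<^sup>2) * (log_drift b s)\<^sup>2 - 2 * (drift_cutoff' s * (s * log_drift b s))"
  proof -
    have P: "P = - (s * (log_drift b s)\<^sup>2 + n * log_drift b s + 2 * s * log_drift' b s)" using id by simp
    show ?thesis unfolding cut_drift_def cut_drift'_def k_def by (subst P) (simp add: power2_eq_square algebra_simps)
  qed
  have "k\<^sup>2 \<le> k * 1" unfolding power2_eq_square using k by (intro mult_left_mono) auto
  then have 1: "0 \<le> s * (k - k\<^sup>2) * (log_drift b s)\<^sup>2" using s by simp
  have "\<bar>drift_cutoff' s\<bar> * (s * \<bar>log_drift b s\<bar>) \<le> 4 * (b + 2)"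
    using k log_drift_bounds(1)[OF s _ b] True s by (intro mult_mono) auto
  then have 2: "\<bar>drift_cutoff' s * (s * log_drift b s)\<bar> \<le> 4 * (b + 2)" using s by (simp add: abs_mult)
  have 3: "(1 - 4 * s) * P \<le> k * P" using k4 P0 by (rule mult_right_mono)
  have sP: "s * P \<le> b\<^sup>2 + 4"
  proof -
    have "\<bar>1 / ln s\<bar> \<le> 2" using abs_ln_lower[OF s] True by (auto simp: abs_divide divide_le_eq)
    then have "\<bar>1 / ln s\<bar>\<^sup>2 \<le> 2\<^sup>2" by (intro power_mono) auto
    moreover have "s * P = b\<^sup>2 + \<bar>1 / ln s\<bar>\<^sup>2" using s by (simp add: P_def field_simps power2_eq_square)
    ultimately show ?thesis by simp
  qed
  have 4: "(1 - 4 * s) * P = P - 4 * (s * P)" by (simp add: algebra_simps)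
  have gen: "P - 4 * B - 8 * (b + 2) \<le> kP + Y - 2 * X"
    if "0 \<le> Y" "X \<le> 4 * (b + 2)" "Z \<le> kP" "Z = P - 4 * sP" "sP \<le> B" for B kP X Y Z sP
    using that by linarith
  have "P - 4 * (b\<^sup>2 + 4) - 8 * (b + 2) \<le> - (2 * s * cut_drift' b s + n * cut_drift b s + s * (cut_drift b s)\<^sup>2)"
    unfolding eq by (rule gen[OF 1 order_trans[OF abs_ge_self 2] 3 4 sP])
  then show ?thesis using True by (simp add: P_def)
qed

lemma AE_not_zero: "AE x in lebesgue. x \<noteq> (0 :: real ^ 'n)"
  using AE_not_in[of "{0 :: real ^ 'n}" lebesgue] by (auto simp: negligible_iff_null_sets[symmetric])

text \<open>Shifting the argument of the drift to \<open>(norm x)\<^sup>2 + e\<close> makes the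
  field C^1 at the origin. The logarithmic term gained from the drift is the very function that
  \<open>U\<close> concedes to the potential; the two cancel and leave
  \<open>(b\<^sup>2 - L) / (norm x)\<^sup>2\<close> up to constants.\<close>

lemma hardy_bounded:
  fixes v \<phi> l :: "real ^ 'n \<Rightarrow> real" and w g :: "real ^ 'n \<Rightarrow> real ^ 'n"
  assumes N: "CARD('n) \<ge> 3"
    and vw: "has_weak_gradient v w" and v2: "L1_loc lebesgue (\<lambda>x. (v x)\<^sup>2)" and w2: "L1_loc lebesgue (\<lambda>x. (norm (w x))\<^sup>2)"
    and l: "has_weak_laplacian (\<lambda>x. (v x)\<^sup>2) l"
    and f: "has_weak_gradient \<phi> g" and C: "\<And>x. \<bar>\<phi> x\<bar> \<le> C" and R: "R \<ge> 0"
    and s: "\<And>x. norm x > R \<Longrightarrow> \<phi> x = 0" "\<And>x. norm x > R \<Longrightarrow> g x = 0"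
    and gi: "integrable lebesgue (\<lambda>x. (norm (g x))\<^sup>2 * (v x)\<^sup>2)"
    and U: "AE x in lebesgue. v x \<noteq> 0 \<longrightarrow> ((norm (w x))\<^sup>2 - l x / 2) / (v x)\<^sup>2 \<le>
       L / (norm x)\<^sup>2 + (if (norm x)\<^sup>2 < 1 / 2 then 1 / ((norm x)\<^sup>2 * (ln ((norm x)\<^sup>2))\<^sup>2) else 0) + K"
  defines "b \<equiv> (real CARD('n) - 2) / 2"
  shows "integrable lebesgue (\<lambda>x. (\<phi> x)\<^sup>2 * (v x)\<^sup>2)" "integrable lebesgue (\<lambda>x. (\<phi> x)\<^sup>2 * ((v x)\<^sup>2 / (norm x)\<^sup>2))"
    "(b\<^sup>2 - L) * (\<integral>x. (\<phi> x)\<^sup>2 * ((v x)\<^sup>2 / (norm x)\<^sup>2) \<partial>lebesgue) \<le>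
      (\<integral>x. (norm (g x))\<^sup>2 * (v x)\<^sup>2 \<partial>lebesgue) + (4 * b\<^sup>2 + 8 * b + 32 + K) * (\<integral>x. (\<phi> x)\<^sup>2 * (v x)\<^sup>2 \<partial>lebesgue)"
proof -
  note mv = has_weak_gradient_L1_loc[OF vw] and mf = has_weak_gradient_L1_loc[OF f]
  have ml: "L1_loc lebesgue l" using l by (simp add: has_weak_laplacian_def)
  define n where "n = real CARD('n)"
  have b0: "b \<ge> 0" and nb: "n = 2 * b + 2" using N by (simp_all add: b_def n_def field_simps)
  have u: "has_weak_gradient (\<lambda>x. (v x)\<^sup>2) (\<lambda>x. (2 * v x) *\<^sub>R w x)"
    by (rule has_weak_gradient_square[OF vw v2 w2])
  have vx: "L1_loc lebesgue (\<lambda>x. (v x)\<^sup>2 / (norm x)\<^sup>2)"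
    by (rule weight_over_norm_sq_L1_loc[OF N u mv(5) w2])
  have C0: "C \<ge> 0" using C[of 0] by linarith
  have p2: "\<bar>(\<phi> x)\<^sup>2\<bar> \<le> C\<^sup>2" for x using C[of x] by (simp add: abs_le_square_iff[symmetric] C0)
  have p2m: "(\<lambda>x. (\<phi> x)\<^sup>2) \<in> borel_measurable lebesgue" using mf(4) by (rule borel_measurable_power)
  have int: "integrable lebesgue (\<lambda>x. (\<phi> x)\<^sup>2 * h x)" if "L1_loc lebesgue h" for h
    by (rule L1_loc_mult_integrable[OF that p2m, where R = R and B = "C\<^sup>2"]) (use p2 s(1) in auto)
  show i1: "integrable lebesgue (\<lambda>x. (\<phi> x)\<^sup>2 * (v x)\<^sup>2)" by (rule int[OF v2])
  show i2: "integrable lebesgue (\<lambda>x. (\<phi> x)\<^sup>2 * ((v x)\<^sup>2 / (norm x)\<^sup>2))" by (rule int[OF vx])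
  \<comment> \<open>Divergence plus squared length of the shifted field, as a function of the
    squared norm \<open>s\<close>.\<close>
  define W where "W e s = 2 * s * cut_drift' b (s + e) + n * cut_drift b (s + e) + s * (cut_drift b (s + e))\<^sup>2" for e s
  define V where "V x = (if v x = 0 then 0 else (norm (w x))\<^sup>2 - l x / 2)" for x
  define Q where "Q e x = (\<phi> x)\<^sup>2 * ((v x)\<^sup>2 * W e ((norm x)\<^sup>2) + V x)" for e x
  define K1 where "K1 = 2 * (5 * b + 14) + n * (b + 2) + (b + 2)\<^sup>2"
  have main: "integrable lebesgue (Q e) \<and> - (\<integral>x. Q e x \<partial>lebesgue) \<le> (\<integral>x. (norm (g x))\<^sup>2 * (v x)\<^sup>2 \<partial>lebesgue)" if e: "e > 0" for e
  proof -
    define A :: "real ^ 'n \<Rightarrow> real ^ 'n" where "A x = (cut_drift b ((norm x)\<^sup>2 + e)) *\<^sub>R x" for x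
    define DA where "DA j i x = cut_drift' b ((norm x)\<^sup>2 + e) * (2 * x $ i) * x $ j + cut_drift b ((norm x)\<^sup>2 + e) * (if i = j then 1 else 0)" for j i and x :: "real ^ 'n"
    have d: "((\<lambda>s. cut_drift b (s + e)) has_real_derivative cut_drift' b (s + e)) (at s)" if "s \<ge> 0" for s
      using DERIV_cut_drift[of "s + e" b] e that by (simp add: DERIV_shift[symmetric])
    have c: "continuous_on {0..} (\<lambda>s. cut_drift' b (s + e))"
      by (rule continuous_on_compose2[OF continuous_cut_drift'[of b]]) (use e in \<open>auto intro!: continuous_intros\<close>)
    have CA: "C1_with (\<lambda>x. A x $ j) (DA j)" for j
      using C1_with_radial_field[OF d c, of j] unfolding A_def DA_def by simp
    have dv: "(\<Sum>j\<in>UNIV. DA j j x) + (norm (A x))\<^sup>2 = W e ((norm x)\<^sup>2)" for x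
    proof -
      have "(\<Sum>j\<in>UNIV. DA j j x) = 2 * cut_drift' b ((norm x)\<^sup>2 + e) * (norm x)\<^sup>2 + n * cut_drift b ((norm x)\<^sup>2 + e)"
      proof -
        have "DA j j x = 2 * cut_drift' b ((norm x)\<^sup>2 + e) * (x $ j)\<^sup>2 + cut_drift b ((norm x)\<^sup>2 + e)" for j
          by (simp add: DA_def power2_eq_square)
        then show ?thesis by (simp add: sum.distrib sum_distrib_left[symmetric] norm_sq_vec[symmetric] n_def)
      qed
      moreover have "(norm (A x))\<^sup>2 = (norm x)\<^sup>2 * (cut_drift b ((norm x)\<^sup>2 + e))\<^sup>2" by (simp add: A_def power_mult_distrib)
      ultimately show ?thesis by (simp add: W_def)
    qed
    show ?thesis
      using ground_state_inequality[OF vw v2 w2 l f C R s gi CA] unfolding dv Q_def[abs_def] V_def[abs_def] by simp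
  qed
  \<comment> \<open>All three terms scale like \<open>1 / s\<close> uniformly in \<open>e\<close>,
    so the locally integrable \<open>v\<^sup>2 / |x|^2\<close> dominates as \<open>e\<close> tends
    to 0.\<close>
  have Wb: "\<bar>W e s\<bar> \<le> K1 / s" if e: "e \<ge> 0" and s: "s > 0" for e s
  proof -
    define t where "t = s + e"
    have t: "t > 0" "s \<le> t" "1 / t \<le> 1 / s" using e s by (auto simp: t_def intro!: divide_left_mono)
    note h = cut_drift_bounds[OF t(1) b0]
    have st: "s / t\<^sup>2 \<le> 1 / s"
    proof -
      have "s / t \<le> 1" "0 \<le> s / t" using t s by auto
      then have "s / t * (1 / t) \<le> 1 * (1 / s)" using t by (intro mult_mono) auto
      then show ?thesis by (simp add: power2_eq_square)
    qed
    have "\<bar>2 * s * cut_drift' b t\<bar> \<le> 2 * s * ((5 * b + 14) / t\<^sup>2)" unfolding abs_mult using s h by (intro mult_mono) auto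
    also have "\<dots> = 2 * (5 * b + 14) * (s / t\<^sup>2)" by simp
    also have "\<dots> \<le> 2 * (5 * b + 14) * (1 / s)" using b0 st by (intro mult_left_mono) auto
    finally have 1: "\<bar>2 * s * cut_drift' b t\<bar> \<le> 2 * (5 * b + 14) * (1 / s)" .
    have n0: "n \<ge> 0" by (simp add: n_def)
    have "\<bar>n * cut_drift b t\<bar> \<le> n * ((b + 2) * (1 / t))" unfolding abs_mult using n0 h by (intro mult_mono) auto
    also have "\<dots> \<le> n * ((b + 2) * (1 / s))" using n0 b0 t(3) by (intro mult_left_mono) auto
    finally have 2: "\<bar>n * cut_drift b t\<bar> \<le> n * (b + 2) * (1 / s)" by (simp add: mult_ac)
    have "\<bar>cut_drift b t\<bar>\<^sup>2 \<le> ((b + 2) / t)\<^sup>2" using h(1) by (intro power_mono) auto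
    then have "\<bar>s * (cut_drift b t)\<^sup>2\<bar> \<le> s * ((b + 2) / t)\<^sup>2" using s by (simp add: abs_mult)
    also have "\<dots> = (b + 2)\<^sup>2 * (s / t\<^sup>2)" by (simp add: power_divide)
    also have "\<dots> \<le> (b + 2)\<^sup>2 * (1 / s)" using st by (intro mult_left_mono) auto
    finally have 3: "\<bar>s * (cut_drift b t)\<^sup>2\<bar> \<le> (b + 2)\<^sup>2 * (1 / s)" .
    have "K1 / s = 2 * (5 * b + 14) * (1 / s) + n * (b + 2) * (1 / s) + (b + 2)\<^sup>2 * (1 / s)"
      by (simp add: K1_def add_divide_distrib)
    then show ?thesis unfolding W_def t_def[symmetric] using 1 2 3 by linarith
  qed
  define en where "en k = 1 / (real k + 1)" for k
  have en: "en k > 0" for k by (simp add: en_def)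
  have en0: "en \<longlonglongrightarrow> 0" using LIMSEQ_inverse_real_of_nat unfolding en_def by (simp add: inverse_eq_divide add.commute)
  have Wlim: "(\<lambda>k. W (en k) s) \<longlonglongrightarrow> W 0 s" if s: "s > 0" for s
  proof -
    have t: "(\<lambda>k. s + en k) \<longlonglongrightarrow> s + 0" by (intro tendsto_intros en0)
    have i: "isCont (cut_drift b) (s + 0)" using DERIV_isCont[OF DERIV_cut_drift[OF s]] by simp
    have i': "isCont (cut_drift' b) (s + 0)"
      using continuous_cut_drift'[of b] s by (simp add: continuous_on_eq_continuous_at)
    show ?thesis unfolding W_def
      by (intro tendsto_intros isCont_tendsto_compose[OF i t] isCont_tendsto_compose[OF i' t])
  qed
  define Dom where "Dom x = K1 * ((\<phi> x)\<^sup>2 * ((v x)\<^sup>2 / (norm x)\<^sup>2)) + ((\<phi> x)\<^sup>2 * (norm (w x))\<^sup>2 + (\<phi> x)\<^sup>2 * \<bar>l x\<bar>)" for x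
  have iDom: "integrable lebesgue Dom" unfolding Dom_def
    by (intro Bochner_Integration.integrable_add integrable_mult_right int vx w2 L1_loc_abs ml)
  have QD: "\<bar>Q e x\<bar> \<le> Dom x" if "e \<ge> 0" "x \<noteq> 0" for e x
  proof -
    have W': "\<bar>W e ((norm x)\<^sup>2)\<bar> \<le> K1 / (norm x)\<^sup>2" using that by (intro Wb) auto
    have "\<bar>(v x)\<^sup>2 * W e ((norm x)\<^sup>2) + V x\<bar> \<le> (v x)\<^sup>2 * (K1 / (norm x)\<^sup>2) + ((norm (w x))\<^sup>2 + \<bar>l x\<bar>)"
    proof -
      have "\<bar>(v x)\<^sup>2 * W e ((norm x)\<^sup>2)\<bar> \<le> (v x)\<^sup>2 * (K1 / (norm x)\<^sup>2)" unfolding abs_mult using W' by (intro mult_mono) auto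
      moreover have "\<bar>V x\<bar> \<le> (norm (w x))\<^sup>2 + \<bar>l x\<bar>"
      proof -
        have 0: "0 \<le> (norm (w x))\<^sup>2" by simp
        then have "\<bar>(norm (w x))\<^sup>2 - l x / 2\<bar> \<le> (norm (w x))\<^sup>2 + \<bar>l x\<bar>" by linarith
        with 0 show ?thesis by (simp add: V_def)
      qed
      ultimately show ?thesis by linarith
    qed
    then have "(\<phi> x)\<^sup>2 * \<bar>(v x)\<^sup>2 * W e ((norm x)\<^sup>2) + V x\<bar> \<le> (\<phi> x)\<^sup>2 * ((v x)\<^sup>2 * (K1 / (norm x)\<^sup>2) + ((norm (w x))\<^sup>2 + \<bar>l x\<bar>))"
      by (rule mult_left_mono) simp
    moreover have "\<bar>Q e x\<bar> = (\<phi> x)\<^sup>2 * \<bar>(v x)\<^sup>2 * W e ((norm x)\<^sup>2) + V x\<bar>" by (simp add: Q_def abs_mult)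
    moreover have "Dom x = (\<phi> x)\<^sup>2 * ((v x)\<^sup>2 * (K1 / (norm x)\<^sup>2) + ((norm (w x))\<^sup>2 + \<bar>l x\<bar>))"
      by (simp add: Dom_def algebra_simps)
    ultimately show ?thesis by simp
  qed
  have Qm: "Q (en k) \<in> borel_measurable lebesgue" for k using main[OF en] by blast
  have Vm: "V \<in> borel_measurable lebesgue"
  proof -
    have "{x \<in> space lebesgue. v x = 0} \<in> sets lebesgue" using mv(4) by measurable
    moreover have "(\<lambda>x. (norm (w x))\<^sup>2 - l x / 2) \<in> borel_measurable lebesgue"
      by (intro borel_measurable_diff borel_measurable_divide L1_loc_measurable[OF w2] L1_loc_measurable[OF ml] borel_measurable_const)
    ultimately show ?thesis unfolding V_def by (intro measurable_If) auto
  qed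
  have W0m: "(\<lambda>x :: real ^ 'n. W 0 ((norm x)\<^sup>2)) \<in> borel_measurable lebesgue"
  proof -
    have "W 0 \<in> borel_measurable borel"
      unfolding W_def cut_drift_def cut_drift'_def drift_cutoff_def drift_cutoff'_def log_drift_def log_drift'_def by measurable
    then show ?thesis
      by (intro measurable_compose[of "\<lambda>x :: real ^ 'n. (norm x)\<^sup>2" lebesgue borel "W 0" borel] borel_measurable_lebesgue_continuous continuous_intros)
  qed
  have Q0m: "Q 0 \<in> borel_measurable lebesgue"
    unfolding Q_def[abs_def] by (intro borel_measurable_times borel_measurable_add p2m W0m Vm L1_loc_measurable[OF v2])
  have lim: "AE x in lebesgue. (\<lambda>k. Q (en k) x) \<longlonglongrightarrow> Q 0 x"
    using AE_not_zero
  proof eventually_elim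
    case (elim x)
    then show ?case unfolding Q_def by (intro tendsto_intros Wlim) simp
  qed
  have bd: "AE x in lebesgue. norm (Q (en k) x) \<le> Dom x" for k
    using AE_not_zero
  proof eventually_elim
    case (elim x)
    then show ?case using QD[of "en k" x] en[of k] by simp
  qed
  have iQ: "integrable lebesgue (Q 0)" by (rule integrable_dominated_convergence[OF Q0m Qm iDom lim bd])
  have "(\<lambda>k. - (\<integral>x. Q (en k) x \<partial>lebesgue)) \<longlonglongrightarrow> - (\<integral>x. Q 0 x \<partial>lebesgue)"
    by (intro tendsto_minus integral_dominated_convergence[OF Q0m Qm iDom lim bd])
  then have Q0: "- (\<integral>x. Q 0 x \<partial>lebesgue) \<le> (\<integral>x. (norm (g x))\<^sup>2 * (v x)\<^sup>2 \<partial>lebesgue)"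
    by (rule LIMSEQ_le_const2) (use main[OF en] in blast)
  let ?c = "4 * b\<^sup>2 + 8 * b + 32 + K"
  have "(\<integral>x. (b\<^sup>2 - L) * ((\<phi> x)\<^sup>2 * ((v x)\<^sup>2 / (norm x)\<^sup>2)) - ?c * ((\<phi> x)\<^sup>2 * (v x)\<^sup>2) \<partial>lebesgue) \<le> (\<integral>x. - Q 0 x \<partial>lebesgue)"
  proof (rule integral_mono_AE)
    show "integrable lebesgue (\<lambda>x. (b\<^sup>2 - L) * ((\<phi> x)\<^sup>2 * ((v x)\<^sup>2 / (norm x)\<^sup>2)) - ?c * ((\<phi> x)\<^sup>2 * (v x)\<^sup>2))"
      by (intro Bochner_Integration.integrable_diff integrable_mult_right i1 i2)
    show "integrable lebesgue (\<lambda>x. - Q 0 x)" using iQ by simp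
    show "AE x in lebesgue. (b\<^sup>2 - L) * ((\<phi> x)\<^sup>2 * ((v x)\<^sup>2 / (norm x)\<^sup>2)) - ?c * ((\<phi> x)\<^sup>2 * (v x)\<^sup>2) \<le> - Q 0 x"
      using AE_not_zero U
    proof eventually_elim
      case (elim x)
      define s where "s = (norm x)\<^sup>2"
      have s: "s > 0" using elim(1) by (simp add: s_def)
      show ?case
      proof (cases "v x = 0")
        case True
        then show ?thesis by (simp add: Q_def V_def)
      next
        case False
        let ?i = "if s < 1/2 then 1 / (s * (ln s)\<^sup>2) else 0"
        have 1: "b\<^sup>2 / s + ?i - (4 * b\<^sup>2 + 8 * b + 32) \<le> - W 0 s"
          using cut_drift_lower[OF s b0 nb] by (simp add: W_def)
        have 2: "V x / (v x)\<^sup>2 \<le> L / s + ?i + K" using elim(2)[rule_format, OF False] False unfolding s_def V_def by (simp only: if_False)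
        have "(b\<^sup>2 - L) / s - ?c \<le> - W 0 s - V x / (v x)\<^sup>2"
          using 1 2 unfolding diff_divide_distrib by linarith
        then have "((\<phi> x)\<^sup>2 * (v x)\<^sup>2) * ((b\<^sup>2 - L) / s - ?c) \<le> ((\<phi> x)\<^sup>2 * (v x)\<^sup>2) * (- W 0 s - V x / (v x)\<^sup>2)"
          by (rule mult_left_mono) simp
        also have "\<dots> = - Q 0 x" unfolding Q_def s_def[symmetric] using False by (simp add: algebra_simps)
        finally show ?thesis unfolding s_def[symmetric] by (simp add: algebra_simps)
      qed
    qed
  qed
  also have "\<dots> = - (\<integral>x. Q 0 x \<partial>lebesgue)" by simp
  also note Q0
  also have "(\<integral>x. (b\<^sup>2 - L) * ((\<phi> x)\<^sup>2 * ((v x)\<^sup>2 / (norm x)\<^sup>2)) - ?c * ((\<phi> x)\<^sup>2 * (v x)\<^sup>2) \<partial>lebesgue) =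
      (\<integral>x. (b\<^sup>2 - L) * ((\<phi> x)\<^sup>2 * ((v x)\<^sup>2 / (norm x)\<^sup>2)) \<partial>lebesgue) - (\<integral>x. ?c * ((\<phi> x)\<^sup>2 * (v x)\<^sup>2) \<partial>lebesgue)"
    by (intro Bochner_Integration.integral_diff integrable_mult_right i1 i2)
  also have "\<dots> = (b\<^sup>2 - L) * (\<integral>x. (\<phi> x)\<^sup>2 * ((v x)\<^sup>2 / (norm x)\<^sup>2) \<partial>lebesgue) - ?c * (\<integral>x. (\<phi> x)\<^sup>2 * (v x)\<^sup>2 \<partial>lebesgue)"
    by (simp only: integral_mult_right_zero)
  finally show "(b\<^sup>2 - L) * (\<integral>x. (\<phi> x)\<^sup>2 * ((v x)\<^sup>2 / (norm x)\<^sup>2) \<partial>lebesgue) \<le>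
      (\<integral>x. (norm (g x))\<^sup>2 * (v x)\<^sup>2 \<partial>lebesgue) + ?c * (\<integral>x. (\<phi> x)\<^sup>2 * (v x)\<^sup>2 \<partial>lebesgue)" by linarith
qed

section \<open>From bounded functions of compact support to the weighted Sobolev space\<close>

definition squash :: "real \<Rightarrow> real \<Rightarrow> real" where "squash d t = t * tame d (t\<^sup>2)"
definition squash' :: "real \<Rightarrow> real \<Rightarrow> real" where "squash' d t = tame d (t\<^sup>2) + 2 * (t\<^sup>2 * tame' d (t\<^sup>2))"

lemma DERIV_squash: "0 < d \<Longrightarrow> d \<le> 1 \<Longrightarrow> (squash d has_real_derivative squash' d t) (at t)"
proof -
  assume d: "0 < d" "d \<le> 1"
  have "((\<lambda>t. tame d (t\<^sup>2)) has_real_derivative tame' d (t\<^sup>2) * (2 * t)) (at t)"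
    by (rule DERIV_chain2[OF DERIV_tame[OF d]]) (auto intro!: derivative_eq_intros)
  from DERIV_mult[OF DERIV_ident this] show ?thesis
    unfolding squash_def[abs_def] squash'_def by (simp add: power2_eq_square mult_ac)
qed

lemma continuous_squash': "0 < d \<Longrightarrow> d \<le> 1 \<Longrightarrow> continuous_on UNIV (squash' d)"
proof -
  assume d: "0 < d" "d \<le> 1"
  have "continuous_on UNIV (\<lambda>t :: real. tame d (t\<^sup>2))" "continuous_on UNIV (\<lambda>t :: real. tame' d (t\<^sup>2))"
    by (auto intro!: continuous_on_compose2[OF continuous_tame(1)[OF d]] continuous_on_compose2[OF continuous_tame(2)[OF d]] continuous_intros)
  then show ?thesis unfolding squash'_def by (intro continuous_intros)
qed

text \<open>For each \<open>d\<close> the truncated function is bounded, as the product rule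
  demands, while the bounds by \<open>\<bar>t\<bar>\<close> and 3 are free of \<open>d\<close>, as
  the limit demands. A sharp cut at a level would not be of class C^1, which the chain rule asks
  for.\<close>

lemma squash_bounds:
  assumes d: "0 < d" "d \<le> 1"
  shows "\<bar>squash d t\<bar> \<le> \<bar>t\<bar>" "\<bar>squash d t\<bar> \<le> 1 / d" "\<bar>squash' d t\<bar> \<le> 3"
proof -
  note T = tame_bounds[OF d, of "t\<^sup>2", simplified]
  have eq: "\<bar>squash d t\<bar> = \<bar>t\<bar> * tame d (t\<^sup>2)" using T by (simp add: squash_def abs_mult)
  have "\<bar>t\<bar> * tame d (t\<^sup>2) \<le> \<bar>t\<bar> * 1" using T by (intro mult_left_mono) auto
  then show "\<bar>squash d t\<bar> \<le> \<bar>t\<bar>" using eq by simp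
  show "\<bar>squash d t\<bar> \<le> 1 / d" using eq abs_tame_bound[OF d, of t] by simp
  show "\<bar>squash' d t\<bar> \<le> 3" unfolding squash'_def using T by linarith
qed

lemma squash_limits:
  assumes dn: "dn \<longlonglongrightarrow> 0"
  shows "(\<lambda>n. squash (dn n) t) \<longlonglongrightarrow> t" "(\<lambda>n. squash' (dn n) t) \<longlonglongrightarrow> 1"
proof -
  have t1: "(\<lambda>n. tame (dn n) (t\<^sup>2)) \<longlonglongrightarrow> 1 / (1 + 0 * t\<^sup>2)" unfolding tame_def by (intro tendsto_intros dn) simp
  have t2: "(\<lambda>n. tame' (dn n) (t\<^sup>2)) \<longlonglongrightarrow> - 0 / (1 + 0 * t\<^sup>2)\<^sup>2" unfolding tame'_def by (intro tendsto_intros dn) simp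
  show "(\<lambda>n. squash (dn n) t) \<longlonglongrightarrow> t" using tendsto_mult[OF tendsto_const[of t] t1] by (simp add: squash_def)
  have "(\<lambda>n. squash' (dn n) t) \<longlonglongrightarrow> 1 / (1 + 0 * t\<^sup>2) + 2 * (t\<^sup>2 * (- 0 / (1 + 0 * t\<^sup>2)\<^sup>2))"
    unfolding squash'_def by (intro tendsto_intros t1 t2)
  then show "(\<lambda>n. squash' (dn n) t) \<longlonglongrightarrow> 1" by simp
qed

text \<open>The transition takes place between the radii \<open>R\<close> and \<open>2 * R\<close>,
  which keeps the gradient bounded as \<open>R\<close> grows; the gradient of
  \<open>ball_cutoff R\<close> is of order \<open>R\<close>.\<close>

definition wide_cutoff :: "real \<Rightarrow> real ^ 'n \<Rightarrow> real" where
  "wide_cutoff R x = radial_cutoff 1 ((norm x)\<^sup>2 / R\<^sup>2)"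

definition wide_cutoff' :: "real \<Rightarrow> real ^ 'n \<Rightarrow> real ^ 'n" where
  "wide_cutoff' R x = (radial_cutoff' 1 ((norm x)\<^sup>2 / R\<^sup>2) * (2 / R\<^sup>2)) *\<^sub>R x"

lemma C1_with_wide_cutoff:
  assumes "R > 0"
  shows "C1_with (wide_cutoff R) (\<lambda>i x. wide_cutoff' R x $ i)"
proof -
  have d: "((\<lambda>s. radial_cutoff 1 (s / R\<^sup>2)) has_real_derivative radial_cutoff' 1 (s / R\<^sup>2) * (1 / R\<^sup>2)) (at s)" for s
    by (rule DERIV_chain2[OF DERIV_radial_cutoff DERIV_cdivide[OF DERIV_ident]])
  have c: "continuous_on UNIV (\<lambda>s. radial_cutoff' 1 (s / R\<^sup>2) * (1 / R\<^sup>2))"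
    unfolding radial_cutoff'_def using assms by (intro continuous_intros) auto
  from C1_with_compose[OF C1_with_norm_sq UNIV_I d c]
  show ?thesis unfolding wide_cutoff_def[abs_def] wide_cutoff'_def by (simp add: mult_ac)
qed

lemma wide_cutoff_bounds: "0 \<le> wide_cutoff R x" "wide_cutoff R x \<le> 1"
  by (simp_all add: wide_cutoff_def radial_cutoff_bounds)

lemma wide_cutoff_inner: 
  assumes "R > 0" "norm x \<le> R"
  shows "wide_cutoff R x = 1" "wide_cutoff' R x = 0"
proof -
  have "(norm x)\<^sup>2 \<le> R\<^sup>2" using assms by (intro power_mono) auto
  then have "(norm x)\<^sup>2 / R\<^sup>2 \<le> 1" using assms(1) by simp
  then show "wide_cutoff R x = 1" "wide_cutoff' R x = 0"
    by (auto simp: wide_cutoff_def wide_cutoff'_def radial_cutoff_def radial_cutoff'_def)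
qed

lemma wide_cutoff_outer:
  assumes "R > 0" "norm x > 2 * R"
  shows "wide_cutoff R x = 0" "wide_cutoff' R x = 0"
proof -
  have "(2 * R)\<^sup>2 \<le> (norm x)\<^sup>2" using assms by (intro power_mono) auto
  then have "4 \<le> (norm x)\<^sup>2 / R\<^sup>2" using assms(1) by (simp add: pos_le_divide_eq power_mult_distrib)
  then have "max 0 ((norm x)\<^sup>2 / R\<^sup>2 - 1\<^sup>2) \<ge> 1" by simp
  then have "(max 0 ((norm x)\<^sup>2 / R\<^sup>2 - 1\<^sup>2))\<^sup>2 \<ge> 1" by (rule one_le_power)
  then show "wide_cutoff R x = 0" "wide_cutoff' R x = 0"
    by (auto simp: wide_cutoff_def wide_cutoff'_def radial_cutoff_def radial_cutoff'_def)
qed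

lemma wide_cutoff'_bound:
  assumes "R \<ge> 1"
  shows "norm (wide_cutoff' R x) \<le> 16"
proof (cases "norm x > 2 * R")
  case True
  then show ?thesis using wide_cutoff_outer(2)[of R x] assms by simp
next
  case False
  have R: "R > 0" "R\<^sup>2 > 0" using assms by auto
  have "norm (wide_cutoff' R x) = \<bar>radial_cutoff' 1 ((norm x)\<^sup>2 / R\<^sup>2)\<bar> * (2 / R\<^sup>2 * norm x)"
    by (simp add: wide_cutoff'_def abs_mult)
  also have "\<dots> \<le> 4 * (2 / R\<^sup>2 * (2 * R))"
    using False R radial_cutoff_bounds(3) by (intro mult_mono mult_left_mono) auto
  also have "\<dots> = 16 / R" using R by (simp add: power2_eq_square)
  also have "\<dots> \<le> 16" using assms by (simp add: divide_le_eq)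
  finally show ?thesis .
qed

text \<open>Truncated by \<open>squash\<close> and a wide cutoff, \<phi> falls under the bounded
  case. The right side converges below an integrable majorant, the left side is treated by Fatou's
  lemma, which requires \<open>b\<^sup>2 - L \<ge> 0\<close>. The form in \<open>ennreal\<close>
  includes that the left integral is finite when this factor is positive.\<close>

lemma hardy_weighted:
  fixes v \<phi> l :: "real ^ 'n \<Rightarrow> real" and w g :: "real ^ 'n \<Rightarrow> real ^ 'n"
  assumes N: "CARD('n) \<ge> 3"
    and vw: "has_weak_gradient v w" and v2: "L1_loc lebesgue (\<lambda>x. (v x)\<^sup>2)" and w2: "L1_loc lebesgue (\<lambda>x. (norm (w x))\<^sup>2)"
    and l: "has_weak_laplacian (\<lambda>x. (v x)\<^sup>2) l"
    and U: "AE x in lebesgue. v x \<noteq> 0 \<longrightarrow> ((norm (w x))\<^sup>2 - l x / 2) / (v x)\<^sup>2 \<le>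
       L / (norm x)\<^sup>2 + (if (norm x)\<^sup>2 < 1 / 2 then 1 / ((norm x)\<^sup>2 * (ln ((norm x)\<^sup>2))\<^sup>2) else 0) + K"
    and f: "has_weak_gradient \<phi> g"
    and i: "integrable lebesgue (\<lambda>x. (\<phi> x)\<^sup>2 * (v x)\<^sup>2)" "integrable lebesgue (\<lambda>x. (norm (g x))\<^sup>2 * (v x)\<^sup>2)"
  defines "b \<equiv> (real CARD('n) - 2) / 2"
  assumes kap: "b\<^sup>2 - L \<ge> 0"
  shows "ennreal (b\<^sup>2 - L) * (\<integral>\<^sup>+x. ennreal ((v x)\<^sup>2 * ((\<phi> x)\<^sup>2 / (norm x)\<^sup>2)) \<partial>lebesgue) \<le>
      ennreal ((\<integral>x. (norm (g x))\<^sup>2 * (v x)\<^sup>2 \<partial>lebesgue) + (4 * b\<^sup>2 + 8 * b + 32 + K) * (\<integral>x. (\<phi> x)\<^sup>2 * (v x)\<^sup>2 \<partial>lebesgue))"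
proof -
  note mf = has_weak_gradient_L1_loc[OF f]
  define cc where "cc = 4 * b\<^sup>2 + 8 * b + 32 + K"
  define dn where "dn n = 1 / (real n + 1)" for n
  have dn: "0 < dn n" "dn n \<le> 1" for n by (auto simp: dn_def)
  have dn0: "dn \<longlonglongrightarrow> 0" using LIMSEQ_inverse_real_of_nat unfolding dn_def by (simp add: inverse_eq_divide add.commute)
  define Rn where "Rn n = real n + 1" for n
  have Rn: "Rn n > 0" "Rn n \<ge> 1" for n by (auto simp: Rn_def)
  define u where "u n x = squash (dn n) (\<phi> x) * wide_cutoff (Rn n) x" for n x
  define h where "h n x = wide_cutoff (Rn n) x *\<^sub>R (squash' (dn n) (\<phi> x) *\<^sub>R g x) + squash (dn n) (\<phi> x) *\<^sub>R wide_cutoff' (Rn n) x" for n x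
  have uh: "has_weak_gradient (u n) (h n)" for n
  proof -
    have 1: "has_weak_gradient (\<lambda>x. squash (dn n) (\<phi> x)) (\<lambda>x. squash' (dn n) (\<phi> x) *\<^sub>R g x)"
      by (rule has_weak_gradient_compose[OF f DERIV_squash[OF dn] continuous_squash'[OF dn] squash_bounds(3)[OF dn]])
    have 2: "has_weak_gradient (wide_cutoff (Rn n)) (wide_cutoff' (Rn n) :: real ^ 'n \<Rightarrow> real ^ 'n)"
      using has_weak_gradient_C1[OF C1_with_wide_cutoff[OF Rn(1)[of n]]] by simp
    show ?thesis unfolding u_def[abs_def] h_def[abs_def]
      by (rule has_weak_gradient_mult[OF 1 2 squash_bounds(2)[OF dn], of 1]) (simp add: wide_cutoff_bounds)
  qed
  note mu = has_weak_gradient_L1_loc[OF uh]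
  have ub: "\<bar>u n x\<bar> \<le> 1 / dn n" for n x
  proof -
    have "\<bar>u n x\<bar> \<le> 1 / dn n * 1" unfolding u_def abs_mult
      using squash_bounds(2)[OF dn, of n "\<phi> x"] wide_cutoff_bounds[of "Rn n" x] dn[of n] by (intro mult_mono) auto
    then show ?thesis by simp
  qed
  have ub2: "(u n x)\<^sup>2 \<le> (\<phi> x)\<^sup>2" for n x
  proof -
    have "\<bar>u n x\<bar> \<le> \<bar>\<phi> x\<bar> * 1" unfolding u_def abs_mult
      using squash_bounds(1)[OF dn, of n "\<phi> x"] wide_cutoff_bounds[of "Rn n" x] by (intro mult_mono) auto
    then show ?thesis by (simp add: abs_le_square_iff)
  qed
  have s: "u n x = 0" "h n x = 0" if "norm x > 2 * Rn n" for n x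
    using wide_cutoff_outer[OF Rn(1)[of n] that] by (simp_all add: u_def h_def)
  \<comment> \<open>From \<open>norm (h n x) \<le> 3 * norm (g x) + 16 * \<bar>\<phi>
    x\<bar>\<close> and the inequality
    \<open>(p + q)\<^sup>2 \<le> 2 * p\<^sup>2 + 2 * q\<^sup>2\<close>: 18 = 2 * 9 and 512 = 2 *
    256.\<close>
  have hb: "(norm (h n x))\<^sup>2 \<le> 18 * (norm (g x))\<^sup>2 + 512 * (\<phi> x)\<^sup>2" for n x
  proof -
    have "norm (h n x) \<le> norm (wide_cutoff (Rn n) x *\<^sub>R (squash' (dn n) (\<phi> x) *\<^sub>R g x)) + norm (squash (dn n) (\<phi> x) *\<^sub>R wide_cutoff' (Rn n) x)"
      unfolding h_def by (rule norm_triangle_ineq)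
    moreover have "norm (wide_cutoff (Rn n) x *\<^sub>R (squash' (dn n) (\<phi> x) *\<^sub>R g x)) \<le> 1 * (3 * norm (g x))"
      unfolding norm_scaleR using wide_cutoff_bounds[of "Rn n" x] squash_bounds(3)[OF dn] by (intro mult_mono) auto
    moreover have "norm (squash (dn n) (\<phi> x) *\<^sub>R wide_cutoff' (Rn n) x) \<le> \<bar>\<phi> x\<bar> * 16"
      unfolding norm_scaleR using squash_bounds(1)[OF dn] wide_cutoff'_bound[OF Rn(2)] by (intro mult_mono) auto
    ultimately have "norm (h n x) \<le> 3 * norm (g x) + 16 * \<bar>\<phi> x\<bar>" by linarith
    then have "(norm (h n x))\<^sup>2 \<le> (3 * norm (g x) + 16 * \<bar>\<phi> x\<bar>)\<^sup>2" by (intro power_mono) auto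
    also have "\<dots> \<le> 2 * (3 * norm (g x))\<^sup>2 + 2 * (16 * \<bar>\<phi> x\<bar>)\<^sup>2"
      using zero_le_power2[of "3 * norm (g x) - 16 * \<bar>\<phi> x\<bar>"] by (simp add: power2_eq_square algebra_simps)
    finally show ?thesis by (simp add: power_mult_distrib)
  qed
  have cut_ev: "\<forall>\<^sub>F n in sequentially. wide_cutoff (Rn n) x = 1 \<and> wide_cutoff' (Rn n) x = 0" for x :: "real ^ 'n"
  proof -
    obtain m :: nat where m: "norm x \<le> m" using real_arch_simple by blast
    have "wide_cutoff (Rn n) x = 1 \<and> wide_cutoff' (Rn n) x = 0" if "n \<ge> m" for n
      using wide_cutoff_inner[OF Rn(1)[of n], of x] m that by (simp add: Rn_def)
    then show ?thesis by (auto simp: eventually_sequentially)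
  qed
  have ulim: "(\<lambda>n. u n x) \<longlonglongrightarrow> \<phi> x" for x
    using squash_limits(1)[OF dn0, of "\<phi> x"]
    by (rule Lim_transform_eventually) (use cut_ev[of x] in eventually_elim, simp add: u_def)
  have hlim: "(\<lambda>n. h n x) \<longlonglongrightarrow> g x" for x
  proof -
    have "(\<lambda>n. squash' (dn n) (\<phi> x) *\<^sub>R g x) \<longlonglongrightarrow> 1 *\<^sub>R g x"
      by (intro tendsto_scaleR squash_limits(2)[OF dn0] tendsto_const)
    then have "(\<lambda>n. h n x) \<longlonglongrightarrow> 1 *\<^sub>R g x"
      by (rule Lim_transform_eventually) (use cut_ev[of x] in eventually_elim, simp add: h_def)
    then show ?thesis by simp
  qed
  have v2m: "(\<lambda>x. (v x)\<^sup>2) \<in> borel_measurable lebesgue" by (rule L1_loc_measurable[OF v2])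
  have m1: "(\<lambda>x. (norm (h n x))\<^sup>2 * (v x)\<^sup>2) \<in> borel_measurable lebesgue" for n
    by (intro borel_measurable_times borel_measurable_power borel_measurable_norm_compose mu(5) v2m)
  have m2: "(\<lambda>x. (u n x)\<^sup>2 * (v x)\<^sup>2) \<in> borel_measurable lebesgue" for n
    by (intro borel_measurable_times borel_measurable_power mu(4) v2m)
  have iD: "integrable lebesgue (\<lambda>x. 18 * ((norm (g x))\<^sup>2 * (v x)\<^sup>2) + 512 * ((\<phi> x)\<^sup>2 * (v x)\<^sup>2))"
    using i by (intro Bochner_Integration.integrable_add integrable_mult_right)
  have bd1: "AE x in lebesgue. norm ((norm (h n x))\<^sup>2 * (v x)\<^sup>2) \<le> 18 * ((norm (g x))\<^sup>2 * (v x)\<^sup>2) + 512 * ((\<phi> x)\<^sup>2 * (v x)\<^sup>2)" for n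
  proof (rule AE_I2)
    fix x
    show "norm ((norm (h n x))\<^sup>2 * (v x)\<^sup>2) \<le> 18 * ((norm (g x))\<^sup>2 * (v x)\<^sup>2) + 512 * ((\<phi> x)\<^sup>2 * (v x)\<^sup>2)"
      using mult_right_mono[OF hb[of n x], of "(v x)\<^sup>2"] by (simp add: algebra_simps)
  qed
  have lim1: "AE x in lebesgue. (\<lambda>n. (norm (h n x))\<^sup>2 * (v x)\<^sup>2) \<longlonglongrightarrow> (norm (g x))\<^sup>2 * (v x)\<^sup>2"
    by (intro AE_I2 tendsto_mult_right tendsto_power tendsto_norm hlim)
  have bd2: "AE x in lebesgue. norm ((u n x)\<^sup>2 * (v x)\<^sup>2) \<le> (\<phi> x)\<^sup>2 * (v x)\<^sup>2" for n
    using ub2 by (intro AE_I2) (simp add: mult_right_mono)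
  have lim2: "AE x in lebesgue. (\<lambda>n. (u n x)\<^sup>2 * (v x)\<^sup>2) \<longlonglongrightarrow> (\<phi> x)\<^sup>2 * (v x)\<^sup>2"
    by (intro AE_I2 tendsto_mult_right tendsto_power ulim)
  have g1: "integrable lebesgue (\<lambda>x. (norm (h n x))\<^sup>2 * (v x)\<^sup>2)" for n
    by (rule Bochner_Integration.integrable_bound[OF iD m1]) (use bd1[of n] in \<open>eventually_elim, simp\<close>)
  define RHS where "RHS n = (\<integral>x. (norm (h n x))\<^sup>2 * (v x)\<^sup>2 \<partial>lebesgue) + cc * (\<integral>x. (u n x)\<^sup>2 * (v x)\<^sup>2 \<partial>lebesgue)" for n
  have RHSlim: "RHS \<longlonglongrightarrow> (\<integral>x. (norm (g x))\<^sup>2 * (v x)\<^sup>2 \<partial>lebesgue) + cc * (\<integral>x. (\<phi> x)\<^sup>2 * (v x)\<^sup>2 \<partial>lebesgue)"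
    unfolding RHS_def
    by (intro tendsto_add tendsto_mult_left
        integral_dominated_convergence[OF borel_measurable_integrable[OF i(2)] m1 iD lim1 bd1]
        integral_dominated_convergence[OF borel_measurable_integrable[OF i(1)] m2 i(1) lim2 bd2])
  have R0: "2 * Rn n \<ge> 0" for n using Rn(1)[of n] by simp
  have hb2: "integrable lebesgue (\<lambda>x. (u n x)\<^sup>2 * ((v x)\<^sup>2 / (norm x)\<^sup>2))"
    and hb3: "(b\<^sup>2 - L) * (\<integral>x. (u n x)\<^sup>2 * ((v x)\<^sup>2 / (norm x)\<^sup>2) \<partial>lebesgue) \<le> RHS n" for n
    unfolding RHS_def cc_def b_def
    by (rule hardy_bounded[OF N vw v2 w2 l uh[of n] ub[of n] R0[of n] s[of n] g1[of n] U]; assumption)+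
  have step: "(\<integral>\<^sup>+x. ennreal ((b\<^sup>2 - L) * ((u n x)\<^sup>2 * ((v x)\<^sup>2 / (norm x)\<^sup>2))) \<partial>lebesgue) \<le> ennreal (RHS n)" for n
  proof -
    have "(\<integral>\<^sup>+x. ennreal ((b\<^sup>2 - L) * ((u n x)\<^sup>2 * ((v x)\<^sup>2 / (norm x)\<^sup>2))) \<partial>lebesgue) =
       ennreal (\<integral>x. (b\<^sup>2 - L) * ((u n x)\<^sup>2 * ((v x)\<^sup>2 / (norm x)\<^sup>2)) \<partial>lebesgue)"
      using hb2 kap by (intro nn_integral_eq_integral integrable_mult_right) auto
    also have "\<dots> \<le> ennreal (RHS n)"
      using hb3[of n] by (intro ennreal_leI) (simp only: integral_mult_right_zero)
    finally show ?thesis .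
  qed
  have nm: "(\<lambda>x :: real ^ 'n. (norm x)\<^sup>2) \<in> borel_measurable lebesgue"
    by (intro borel_measurable_lebesgue_continuous continuous_intros)
  have "ennreal (b\<^sup>2 - L) * (\<integral>\<^sup>+x. ennreal ((v x)\<^sup>2 * ((\<phi> x)\<^sup>2 / (norm x)\<^sup>2)) \<partial>lebesgue) =
      (\<integral>\<^sup>+x. ennreal ((b\<^sup>2 - L) * ((\<phi> x)\<^sup>2 * ((v x)\<^sup>2 / (norm x)\<^sup>2))) \<partial>lebesgue)"
  proof -
    have "(\<lambda>x. (v x)\<^sup>2 * ((\<phi> x)\<^sup>2 / (norm x)\<^sup>2)) \<in> borel_measurable lebesgue"
      by (intro borel_measurable_times borel_measurable_divide borel_measurable_power mf(4) v2m nm)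
    then have "ennreal (b\<^sup>2 - L) * (\<integral>\<^sup>+x. ennreal ((v x)\<^sup>2 * ((\<phi> x)\<^sup>2 / (norm x)\<^sup>2)) \<partial>lebesgue) =
       (\<integral>\<^sup>+x. ennreal (b\<^sup>2 - L) * ennreal ((v x)\<^sup>2 * ((\<phi> x)\<^sup>2 / (norm x)\<^sup>2)) \<partial>lebesgue)"
      by (intro nn_integral_cmult[symmetric]) auto
    then show ?thesis using kap by (simp add: ennreal_mult[symmetric] mult_ac)
  qed
  also have "\<dots> \<le> (\<integral>\<^sup>+x. liminf (\<lambda>n. ennreal ((b\<^sup>2 - L) * ((u n x)\<^sup>2 * ((v x)\<^sup>2 / (norm x)\<^sup>2)))) \<partial>lebesgue)"
  proof (rule nn_integral_mono)
    fix x
    have "(\<lambda>n. ennreal ((b\<^sup>2 - L) * ((u n x)\<^sup>2 * ((v x)\<^sup>2 / (norm x)\<^sup>2)))) \<longlonglongrightarrow> ennreal ((b\<^sup>2 - L) * ((\<phi> x)\<^sup>2 * ((v x)\<^sup>2 / (norm x)\<^sup>2)))"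
      by (intro tendsto_ennrealI tendsto_mult_left tendsto_mult_right tendsto_power ulim)
    then show "ennreal ((b\<^sup>2 - L) * ((\<phi> x)\<^sup>2 * ((v x)\<^sup>2 / (norm x)\<^sup>2))) \<le> liminf (\<lambda>n. ennreal ((b\<^sup>2 - L) * ((u n x)\<^sup>2 * ((v x)\<^sup>2 / (norm x)\<^sup>2))))"
      using lim_imp_Liminf[OF trivial_limit_sequentially] by (metis order_refl)
  qed
  also have "\<dots> \<le> liminf (\<lambda>n. \<integral>\<^sup>+x. ennreal ((b\<^sup>2 - L) * ((u n x)\<^sup>2 * ((v x)\<^sup>2 / (norm x)\<^sup>2))) \<partial>lebesgue)"
    by (intro nn_integral_liminf measurable_compose[OF borel_measurable_integrable measurable_ennreal]
        integrable_mult_right hb2)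
  also have "\<dots> \<le> liminf (\<lambda>n. ennreal (RHS n))"
    by (intro Liminf_mono always_eventually allI step)
  also have "\<dots> = ennreal ((\<integral>x. (norm (g x))\<^sup>2 * (v x)\<^sup>2 \<partial>lebesgue) + cc * (\<integral>x. (\<phi> x)\<^sup>2 * (v x)\<^sup>2 \<partial>lebesgue))"
    by (intro lim_imp_Liminf[OF trivial_limit_sequentially] tendsto_ennrealI RHSlim)
  finally show ?thesis unfolding cc_def .
qed

section \<open>Optimality of the constant\<close>

lemma L1_loc_weighted_iff:
  fixes \<mu> f :: "real ^ 'n \<Rightarrow> real"
  assumes m: "\<mu> \<in> borel_measurable lebesgue" "\<And>x. \<mu> x \<ge> 0" and f: "f \<in> borel_measurable lebesgue"
  shows "L1_loc (weighted \<mu>) f \<longleftrightarrow> L1_loc lebesgue (\<lambda>x. \<mu> x * f x)"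
proof -
  have "set_integrable (weighted \<mu>) K f \<longleftrightarrow> set_integrable lebesgue K (\<lambda>x. \<mu> x * f x)" if K: "compact K" for K
  proof -
    have "(\<lambda>x. indicator K x *\<^sub>R f x) \<in> borel_measurable lebesgue"
      using K f by (intro borel_measurable_scaleR borel_measurable_indicator) (auto intro: lmeasurable_compact fmeasurableD)
    then show ?thesis unfolding set_integrable_def weighted_def
      using m by (subst integrable_density) (auto simp: mult_ac)
  qed
  then show ?thesis by (simp add: L1_loc_def)
qed

lemma integral_weighted:
  fixes \<mu> f :: "real ^ 'n \<Rightarrow> real"
  assumes m: "\<mu> \<in> borel_measurable lebesgue" "\<And>x. \<mu> x \<ge> 0" and f: "f \<in> borel_measurable lebesgue"
  shows "(\<integral>x. f x \<partial>weighted \<mu>) = (\<integral>x. f x * \<mu> x \<partial>lebesgue)"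
    and "integrable (weighted \<mu>) f \<longleftrightarrow> integrable lebesgue (\<lambda>x. f x * \<mu> x)"
proof -
  show "(\<integral>x. f x \<partial>weighted \<mu>) = (\<integral>x. f x * \<mu> x \<partial>lebesgue)"
    unfolding weighted_def using m f by (subst integral_density) (auto simp: mult.commute)
  show "integrable (weighted \<mu>) f \<longleftrightarrow> integrable lebesgue (\<lambda>x. f x * \<mu> x)"
    unfolding weighted_def using m f by (subst integrable_density) (auto simp: mult.commute)
qed

lemma norm_powr_measurable: "(\<lambda>x :: real ^ 'n. norm x powr a) \<in> borel_measurable lebesgue"
  by (intro measurable_completion) measurable

lemma measurable_weighted: "f \<in> borel_measurable (weighted \<mu>) \<longleftrightarrow> f \<in> borel_measurable lebesgue"
  by (simp add: weighted_def)

text \<open>For the radial function with profile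
  \<open>a s = (s + e) powr (\<gamma> / 2) * k s\<close> at \<open>s = |x|^2\<close>, the left side
  is the squared gradient \<open>4 * s * (a' s)\<^sup>2\<close>. The coefficient
  \<open>\<gamma>\<^sup>2\<close> of the leading term competes with the Hardy constant; the
  remainder has one more power of \<open>s + e\<close>. Its constant comes from
  \<open>k \<le> 1\<close>, \<open>\<bar>k'\<bar> \<le> 2\<close> and
  \<open>s + e \<le> 2\<close>.\<close>

lemma test_profile_bound:
  fixes s e \<gamma> :: real
  assumes s: "0 \<le> s" and e: "0 < e" "e \<le> 1"
  defines "k \<equiv> (max 0 (1 - s))\<^sup>2" and "k' \<equiv> - (2 * max 0 (1 - s))"
  shows "4 * s * (\<gamma> / 2 * (s + e) powr (\<gamma> / 2 - 1) * k + (s + e) powr (\<gamma> / 2) * k')\<^sup>2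
    \<le> \<gamma>\<^sup>2 * (k\<^sup>2 * (s + e) powr (\<gamma> - 1)) + (8 * \<bar>\<gamma>\<bar> + 32) * (if s \<le> 1 then (s + e) powr \<gamma> else 0)"
proof (cases "s \<le> 1")
  case False
  then show ?thesis by (simp add: k_def k'_def)
next
  case True
  define q where "q = s + e"
  have q: "q > 0" "s \<le> q" "q \<le> 2" using s e True by (auto simp: q_def)
  have m: "max 0 (1 - s) = 1 - s" using True by simp
  have k: "0 \<le> k" "k \<le> 1" "\<bar>k'\<bar> \<le> 2" using True s unfolding k_def k'_def m by (auto simp: power_le_one)
  have "q powr (\<gamma> / 2) = q powr (\<gamma> / 2 - 1) * q powr 1" by (simp only: powr_add[symmetric]) simp
  then have p1: "q powr (\<gamma> / 2) = q powr (\<gamma> / 2 - 1) * q" using q by simp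
  have "(q powr (\<gamma> / 2 - 1))\<^sup>2 = q powr (\<gamma> - 2)" by (simp add: power2_eq_square powr_add[symmetric])
  then have "4 * s * (\<gamma> / 2 * q powr (\<gamma> / 2 - 1) * k + q powr (\<gamma> / 2) * k')\<^sup>2 = s * q powr (\<gamma> - 2) * (\<gamma> * k + 2 * q * k')\<^sup>2"
    unfolding p1 by (simp add: power2_eq_square field_simps)
  also have "\<dots> \<le> q * q powr (\<gamma> - 2) * (\<gamma> * k + 2 * q * k')\<^sup>2" using q by (intro mult_right_mono) auto
  also have "q * q powr (\<gamma> - 2) = q powr (\<gamma> - 1)"
  proof -
    have "q powr (\<gamma> - 1) = q powr 1 * q powr (\<gamma> - 2)" by (simp only: powr_add[symmetric]) simp
    then show ?thesis using q by simp
  qed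
  also have "q powr (\<gamma> - 1) * (\<gamma> * k + 2 * q * k')\<^sup>2 \<le> q powr (\<gamma> - 1) * (\<gamma>\<^sup>2 * k\<^sup>2 + q * (8 * \<bar>\<gamma>\<bar> + 32))"
  proof (rule mult_left_mono)
    have "\<bar>4 * \<gamma> * k * k'\<bar> \<le> 4 * \<bar>\<gamma>\<bar> * 1 * 2" unfolding abs_mult using k by (intro mult_mono) auto
    then have "4 * \<gamma> * k * k' \<le> 8 * \<bar>\<gamma>\<bar>" by linarith
    moreover have "\<bar>k'\<bar>\<^sup>2 \<le> 2\<^sup>2" using k(3) by (intro power_mono) auto
    then have "4 * (q * (k')\<^sup>2) \<le> 4 * (2 * 4)" using q by (intro mult_left_mono mult_mono) auto
    ultimately have "4 * \<gamma> * k * k' + 4 * (q * (k')\<^sup>2) \<le> 8 * \<bar>\<gamma>\<bar> + 32" by linarith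
    then have "q * (4 * \<gamma> * k * k' + 4 * (q * (k')\<^sup>2)) \<le> q * (8 * \<bar>\<gamma>\<bar> + 32)" using q by (intro mult_left_mono) auto
    then show "(\<gamma> * k + 2 * q * k')\<^sup>2 \<le> \<gamma>\<^sup>2 * k\<^sup>2 + q * (8 * \<bar>\<gamma>\<bar> + 32)" by (simp add: power2_eq_square algebra_simps)
  qed simp
  also have "q powr (\<gamma> - 1) * (\<gamma>\<^sup>2 * k\<^sup>2 + q * (8 * \<bar>\<gamma>\<bar> + 32)) = \<gamma>\<^sup>2 * (k\<^sup>2 * q powr (\<gamma> - 1)) + (8 * \<bar>\<gamma>\<bar> + 32) * (q powr (\<gamma> - 1) * q)"
    by (simp add: algebra_simps)
  also have "q powr (\<gamma> - 1) * q = q powr \<gamma>"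
  proof -
    have "q powr \<gamma> = q powr (\<gamma> - 1) * q powr 1" by (simp only: powr_add[symmetric]) simp
    then show ?thesis using q by simp
  qed
  finally show ?thesis using True by (simp add: q_def)
qed

text \<open>The majorant does not depend on \<open>e\<close>: for \<open>\<gamma> \<ge> 0\<close>
  the base is at most 2, and for negative \<gamma> omitting \<open>e\<close> increases the power,
  after which \<open>r \<le> 1\<close> allows the exponent \<open>2 * \<gamma>\<close> to be lowered
  to \<open>- \<delta>\<close>.\<close>

lemma shifted_powr_bound:
  fixes r e \<gamma> \<delta> :: real
  assumes r: "0 < r" "r \<le> 1" and e: "0 < e" "e \<le> 1" and d: "- 2 * \<gamma> < \<delta>"
  shows "(r\<^sup>2 + e) powr \<gamma> \<le> r powr (- \<delta>) + 2 powr \<bar>\<gamma>\<bar>"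
proof (cases "\<gamma> \<ge> 0")
  case True
  have "r\<^sup>2 \<le> 1" using r by (simp add: power_le_one)
  then have "(r\<^sup>2 + e) powr \<gamma> \<le> 2 powr \<gamma>" using e True by (intro powr_mono2) auto
  then show ?thesis using True by (simp add: add_increasing)
next
  case False
  have "(r\<^sup>2 + e) powr \<gamma> \<le> (r\<^sup>2) powr \<gamma>" using r e False by (intro powr_mono2') auto
  also have "\<dots> = r powr (2 * \<gamma>)" using r by (simp add: powr_powr[symmetric] powr_numeral)
  also have "\<dots> \<le> r powr (- \<delta>)" using r d by (intro powr_mono') auto
  finally show ?thesis by (simp add: add_increasing2)
qed

text \<open>The same function \<open>E e\<close> is the leading part of the squared gradient, with
  coefficient \<open>\<gamma>\<^sup>2\<close>, and a lower bound for
  \<open>\<phi>\<^sup>2 / |x|^2\<close>. For \<open>e > 0\<close> its weighted integral is finite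
  and can be subtracted, so \<open>c - \<gamma>\<^sup>2\<close> times this integral is bounded by
  lower order terms, uniformly in \<open>e\<close>.\<close>

lemma hardy_constant_le:
  fixes \<mu> :: "real ^ 'n \<Rightarrow> real"
  assumes \<mu>0: "\<And>x. \<mu> x \<ge> 0" and \<mu>L: "L1_loc lebesgue \<mu>"
    and ne: "loc_integrable_exponents \<mu> \<noteq> {}" and bdd: "bdd_above (loc_integrable_exponents \<mu>)"
    and hardy: "\<And>\<phi>. \<phi> \<in> H1_weighted \<mu> \<Longrightarrow> weighted_hardy \<mu> c C \<phi>"
  shows "c \<le> c0 (N0 \<mu>)"
proof (rule ccontr)
  assume "\<not> c \<le> c0 (N0 \<mu>)"
  define m where "m = N0 \<mu>"
  \<comment> \<open>Here \<open>A\<^sup>2 = c0 m\<close>, and \<open>2 - 2 * A\<close> is the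
    critical exponent \<open>m\<close> itself.\<close>
  define A where "A = 1 - m / 2"
  have c: "c > A\<^sup>2" using \<open>\<not> c \<le> c0 (N0 \<mu>)\<close> by (simp add: c0_def m_def A_def power2_eq_square field_simps)
  note \<mu>m = L1_loc_measurable[OF \<mu>L]
  have ex_iff: "\<delta> \<in> loc_integrable_exponents \<mu> \<longleftrightarrow> L1_loc lebesgue (\<lambda>x. \<mu> x * norm x powr (- \<delta>))" for \<delta>
    unfolding loc_integrable_exponents_def using L1_loc_weighted_iff[OF \<mu>m \<mu>0 norm_powr_measurable] by simp
  \<comment> \<open>Yields \<open>m \<ge> 0\<close> and with it \<open>\<gamma> < 1\<close>, so that
    \<open>|x| powr (2 * \<gamma> - 2)\<close> decreases away from the origin.\<close>
  have "0 \<in> loc_integrable_exponents \<mu>" unfolding ex_iff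
  proof (rule L1_loc_bound[OF \<mu>L])
    show "(\<lambda>x. \<mu> x * norm x powr - 0) \<in> borel_measurable lebesgue"
      by (intro borel_measurable_times \<mu>m norm_powr_measurable)
    show "AE x in lebesgue. norm (\<mu> x * norm x powr - 0) \<le> norm (\<mu> x)"
      by (intro AE_I2) (simp add: powr_def)
  qed
  then have m0: "m \<ge> 0" unfolding m_def N0_def using bdd by (intro cSup_upper) auto
  \<comment> \<open>The second entry forces
    \<open>\<gamma>\<^sup>2 \<le> A\<^sup>2 + (c - A\<^sup>2) / 2 < c\<close>, where
    \<open>\<tau> \<le> 1\<close> is used; the first also gives
    \<open>- 2 * \<gamma> = m - 2 + 2 * \<tau> < m\<close>.\<close>
  define \<tau> where "\<tau> = min (1 / 4) ((c - A\<^sup>2) / (2 * (1 + 2 * \<bar>A\<bar>)))"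
  have "0 < (c - A\<^sup>2) / (2 * (1 + 2 * \<bar>A\<bar>))" using c by (intro divide_pos_pos) auto
  then have "\<tau> > 0" by (simp add: \<tau>_def)
  moreover have "\<tau> \<le> 1 / 4" unfolding \<tau>_def by (rule min.cobounded1)
  ultimately have \<tau>: "\<tau> > 0" "\<tau> \<le> 1 / 4" by auto
  define \<gamma> where "\<gamma> = A - \<tau>"
  have \<gamma>c: "\<gamma>\<^sup>2 < c"
  proof -
    have "\<tau> * (2 * (1 + 2 * \<bar>A\<bar>)) \<le> c - A\<^sup>2"
    proof (rule pos_le_divide_eq[THEN iffD1])
      show "\<tau> \<le> (c - A\<^sup>2) / (2 * (1 + 2 * \<bar>A\<bar>))" unfolding \<tau>_def by (rule min.cobounded2)
    qed auto
    then have 1: "2 * (\<tau> * (1 + 2 * \<bar>A\<bar>)) \<le> c - A\<^sup>2" by (simp add: mult_ac)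
    have "\<tau> * (\<tau> - 2 * A) \<le> \<tau> * (1 + 2 * \<bar>A\<bar>)" using \<tau> by (intro mult_left_mono) auto
    moreover have "\<gamma>\<^sup>2 = A\<^sup>2 + \<tau> * (\<tau> - 2 * A)" by (simp add: \<gamma>_def power2_eq_square algebra_simps)
    ultimately show ?thesis using 1 c by linarith
  qed
  have c0: "c > 0" using \<gamma>c zero_le_power2[of \<gamma>] by linarith
  have "- 2 * \<gamma> < Sup (loc_integrable_exponents \<mu>)"
    using \<tau> by (simp add: \<gamma>_def A_def m_def N0_def)
  \<comment> \<open>With an admissible exponent above \<open>- 2 * \<gamma>\<close>, the function
    \<open>|x| powr (2 * \<gamma>)\<close> is integrable against the weight on the unit ball; this
    makes the lower order terms finite, and \<open>dd\<close> majorises them for all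
    \<open>e\<close>.\<close>
  then obtain \<delta> where \<delta>: "\<delta> \<in> loc_integrable_exponents \<mu>" "- 2 * \<gamma> < \<delta>"
    using less_cSup_iff[OF ne bdd] by blast
  define dd where "dd x = indicator (cball 0 1) x *\<^sub>R (\<mu> x * norm x powr (- \<delta>)) + 2 powr \<bar>\<gamma>\<bar> * (indicator (cball 0 1) x *\<^sub>R \<mu> x)" for x
  have idd: "integrable lebesgue dd" unfolding dd_def
    using \<delta>(1) unfolding ex_iff by (intro Bochner_Integration.integrable_add integrable_mult_right L1_loc_cball \<mu>L)
  define k :: "real \<Rightarrow> real" where "k s = (max 0 (1 - s))\<^sup>2" for s
  define k' :: "real \<Rightarrow> real" where "k' s = - (2 * max 0 (1 - s))" for s
  define MM where "MM = 8 * \<bar>\<gamma>\<bar> + 32"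
  define E where "E e x = (k ((norm x)\<^sup>2))\<^sup>2 * ((norm x)\<^sup>2 + e) powr (\<gamma> - 1)" for e and x :: "real ^ 'n"
  have k0: "k s = 0" if "s \<ge> 1" for s using that by (simp add: k_def)
  have k1: "0 \<le> k s" "s \<ge> 0 \<Longrightarrow> k s \<le> 1" for s by (auto simp: k_def power_le_one)
  define B0 where "B0 = (MM + \<bar>C\<bar>) * (\<integral>x. dd x \<partial>lebesgue)"
  have main: "integrable lebesgue (\<lambda>x. E e x * \<mu> x) \<and> (c - \<gamma>\<^sup>2) * (\<integral>x. E e x * \<mu> x \<partial>lebesgue) \<le> B0" if e: "0 < e" "e \<le> 1" for e
  proof -
    define a where "a s = (s + e) powr (\<gamma> / 2) * k s" for s
    define a' where "a' s = \<gamma> / 2 * (s + e) powr (\<gamma> / 2 - 1) * k s + (s + e) powr (\<gamma> / 2) * k' s" for s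
    have dk: "(k has_real_derivative k' s) (at s)" for s
    proof -
      have "((\<lambda>s. 1 - s) has_real_derivative - 1) (at s)" by (auto intro!: derivative_eq_intros)
      from DERIV_chain2[OF DERIV_max_sq this] show ?thesis unfolding k_def[abs_def] k'_def by simp
    qed
    have da: "(a has_real_derivative a' s) (at s)" if "s \<ge> 0" for s
    proof -
      have "((\<lambda>s. (s + e) powr (\<gamma> / 2)) has_real_derivative \<gamma> / 2 * (s + e) powr (\<gamma> / 2 - 1)) (at s)"
        using that e by (auto intro!: derivative_eq_intros)
      from DERIV_mult[OF this dk[of s]] show ?thesis unfolding a_def[abs_def] a'_def by (simp add: mult_ac add_ac)
    qed
    have ck: "continuous_on X k" "continuous_on X k'" for X unfolding k_def k'_def by (intro continuous_intros)+
    have ca': "continuous_on {0..} a'" unfolding a'_def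
      using e by (intro continuous_intros ck) auto
    define \<phi> where "\<phi> x = a ((norm x)\<^sup>2)" for x :: "real ^ 'n"
    define G where "G x = (2 * a' ((norm x)\<^sup>2)) *\<^sub>R x" for x :: "real ^ 'n"
    have C1: "C1_with \<phi> (\<lambda>i x. a' ((norm x)\<^sup>2) * (2 * x $ i))"
      unfolding \<phi>_def[abs_def] by (rule C1_with_compose[OF C1_with_norm_sq, where S = "{0..}"]) (use da ca' in auto)
    have wg: "has_weak_gradient \<phi> G"
    proof -
      have "G = (\<lambda>x. \<chi> i. a' ((norm x)\<^sup>2) * (2 * x $ i))" by (simp add: fun_eq_iff G_def vec_eq_iff)
      then show ?thesis using has_weak_gradient_C1[OF C1] by simp
    qed
    note mw = has_weak_gradient_L1_loc[OF wg]
    have out: "norm x > 1 \<Longrightarrow> \<phi> x = 0 \<and> G x = 0" for x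
    proof -
      assume "norm x > 1"
      then have "(norm x)\<^sup>2 \<ge> 1" by (simp add: one_le_power)
      then show "\<phi> x = 0 \<and> G x = 0" by (simp add: \<phi>_def G_def a_def a'_def k_def k'_def)
    qed
    have cE: "continuous_on UNIV (E e)" unfolding E_def
      using e by (intro continuous_intros continuous_on_compose2[OF ck(1)[of UNIV]]) (auto simp: add_nonneg_eq_0_iff)
    have sE: "E e x = 0" if "norm x > 1" for x
      using that k0[of "(norm x)\<^sup>2"] by (simp add: E_def one_le_power)
    have iE: "integrable lebesgue (\<lambda>x. E e x * \<mu> x)" by (rule L1_loc_mult_continuous[OF \<mu>L cE sE])
    have E0: "E e x \<ge> 0" for x by (simp add: E_def)
    have \<phi>2: "(\<phi> x)\<^sup>2 = ((norm x)\<^sup>2 + e) powr \<gamma> * (k ((norm x)\<^sup>2))\<^sup>2" for x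
      by (simp add: \<phi>_def a_def power_mult_distrib power2_eq_square powr_add[symmetric])
    have qdd: "(if (norm x)\<^sup>2 \<le> 1 then ((norm x)\<^sup>2 + e) powr \<gamma> else 0) * \<mu> x \<le> dd x" if "x \<noteq> 0" for x
    proof (cases "norm x \<le> 1")
      case True
      then have "((norm x)\<^sup>2 + e) powr \<gamma> \<le> norm x powr (- \<delta>) + 2 powr \<bar>\<gamma>\<bar>"
        using that e \<delta>(2) by (intro shifted_powr_bound) auto
      then have "((norm x)\<^sup>2 + e) powr \<gamma> * \<mu> x \<le> (norm x powr (- \<delta>) + 2 powr \<bar>\<gamma>\<bar>) * \<mu> x"
        using \<mu>0 by (rule mult_right_mono)
      then show ?thesis using True by (simp add: dd_def power_le_one algebra_simps)
    next
      case False
      then have "1 < (norm x)\<^sup>2" by (intro one_less_power) auto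
      then have "\<not> (norm x)\<^sup>2 \<le> 1" by linarith
      then show ?thesis unfolding if_not_P using False by (simp add: dd_def)
    qed
    have G2: "(norm (G x))\<^sup>2 \<le> \<gamma>\<^sup>2 * E e x + MM * (if (norm x)\<^sup>2 \<le> 1 then ((norm x)\<^sup>2 + e) powr \<gamma> else 0)" for x
    proof -
      have "(norm (G x))\<^sup>2 = 4 * (norm x)\<^sup>2 * (a' ((norm x)\<^sup>2))\<^sup>2" by (simp add: G_def power_mult_distrib)
      also have "\<dots> \<le> \<gamma>\<^sup>2 * E e x + MM * (if (norm x)\<^sup>2 \<le> 1 then ((norm x)\<^sup>2 + e) powr \<gamma> else 0)"
        unfolding a'_def E_def MM_def k_def k'_def by (rule test_profile_bound[OF _ e]) simp
      finally show ?thesis .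
    qed
    have p2: "(\<phi> x)\<^sup>2 \<le> (if (norm x)\<^sup>2 \<le> 1 then ((norm x)\<^sup>2 + e) powr \<gamma> else 0)" for x
    proof (cases "(norm x)\<^sup>2 \<le> 1")
      case True
      have "(k ((norm x)\<^sup>2))\<^sup>2 \<le> 1" using k1[of "(norm x)\<^sup>2"] by (simp add: power_le_one)
      then have "((norm x)\<^sup>2 + e) powr \<gamma> * (k ((norm x)\<^sup>2))\<^sup>2 \<le> ((norm x)\<^sup>2 + e) powr \<gamma> * 1" by (intro mult_left_mono) auto
      then show ?thesis using True by (simp add: \<phi>2)
    next
      case False
      then show ?thesis by (simp add: \<phi>2 k0)
    qed
    have cG: "continuous_on UNIV (\<lambda>x. (norm (G x))\<^sup>2)"
      unfolding G_def by (intro continuous_intros continuous_on_compose2[OF ca']) auto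
    have c\<phi>: "continuous_on UNIV (\<lambda>x. (\<phi> x)\<^sup>2)" using C1 unfolding C1_with_def by (intro continuous_intros) auto
    have iG: "integrable lebesgue (\<lambda>x. (norm (G x))\<^sup>2 * \<mu> x)" by (rule L1_loc_mult_continuous[OF \<mu>L cG, of 1]) (use out in auto)
    have i\<phi>: "integrable lebesgue (\<lambda>x. (\<phi> x)\<^sup>2 * \<mu> x)" by (rule L1_loc_mult_continuous[OF \<mu>L c\<phi>, of 1]) (use out in auto)
    have mG: "(\<lambda>x. (norm (G x))\<^sup>2) \<in> borel_measurable lebesgue" "(\<lambda>x. (\<phi> x)\<^sup>2) \<in> borel_measurable lebesgue"
      by (intro borel_measurable_lebesgue_continuous cG c\<phi>)+
    have "\<phi> \<in> H1_weighted \<mu>" unfolding H1_weighted_def L2_def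
      using wg iG i\<phi> mw integral_weighted(2)[OF \<mu>m \<mu>0 mG(1)] integral_weighted(2)[OF \<mu>m \<mu>0 mG(2)]
      by (auto simp: measurable_weighted)
    then have H: "ereal c * enn2ereal (\<integral>\<^sup>+x. ennreal ((\<phi> x)\<^sup>2 / (norm x)\<^sup>2) \<partial>weighted \<mu>)
       \<le> ereal ((\<integral>x. (norm (weak_gradient \<phi> x))\<^sup>2 \<partial>weighted \<mu>) + C * (\<integral>x. (\<phi> x)\<^sup>2 \<partial>weighted \<mu>))"
      using hardy by (simp add: weighted_hardy_def)
    have nx: "(\<lambda>x :: real ^ 'n. (norm x)\<^sup>2) \<in> borel_measurable lebesgue"
      by (intro borel_measurable_lebesgue_continuous continuous_intros)
    have gw: "(\<integral>x. (norm (weak_gradient \<phi> x))\<^sup>2 \<partial>weighted \<mu>) = (\<integral>x. (norm (G x))\<^sup>2 * \<mu> x \<partial>lebesgue)"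
    proof -
      note W = weak_gradient_unique[OF wg]
      have mW: "(\<lambda>x. (norm (weak_gradient \<phi> x))\<^sup>2) \<in> borel_measurable lebesgue"
        by (intro borel_measurable_power borel_measurable_norm_compose has_weak_gradient_L1_loc(5)[OF W(1)])
      have "(\<integral>x. (norm (weak_gradient \<phi> x))\<^sup>2 \<partial>weighted \<mu>) = (\<integral>x. (norm (weak_gradient \<phi> x))\<^sup>2 * \<mu> x \<partial>lebesgue)"
        by (rule integral_weighted(1)[OF \<mu>m \<mu>0 mW])
      also have "\<dots> = (\<integral>x. (norm (G x))\<^sup>2 * \<mu> x \<partial>lebesgue)"
        using W(2) by (intro integral_cong_AE borel_measurable_times mW mG \<mu>m) (auto elim: eventually_mono)
      finally show ?thesis .
    qed
    have \<phi>w: "(\<integral>x. (\<phi> x)\<^sup>2 \<partial>weighted \<mu>) = (\<integral>x. (\<phi> x)\<^sup>2 * \<mu> x \<partial>lebesgue)"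
      by (rule integral_weighted(1)[OF \<mu>m \<mu>0 mG(2)])
    have low: "ennreal (\<integral>x. E e x * \<mu> x \<partial>lebesgue) \<le> (\<integral>\<^sup>+x. ennreal ((\<phi> x)\<^sup>2 / (norm x)\<^sup>2) \<partial>weighted \<mu>)"
    proof -
      have "ennreal (\<integral>x. E e x * \<mu> x \<partial>lebesgue) = (\<integral>\<^sup>+x. ennreal (E e x * \<mu> x) \<partial>lebesgue)"
        using iE E0 \<mu>0 by (intro nn_integral_eq_integral[symmetric]) auto
      also have "\<dots> \<le> (\<integral>\<^sup>+x. ennreal (\<mu> x) * ennreal ((\<phi> x)\<^sup>2 / (norm x)\<^sup>2) \<partial>lebesgue)"
      proof (rule nn_integral_mono_AE)
        show "AE x in lebesgue. ennreal (E e x * \<mu> x) \<le> ennreal (\<mu> x) * ennreal ((\<phi> x)\<^sup>2 / (norm x)\<^sup>2)"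
          using AE_not_zero
        proof eventually_elim
          case (elim x)
          define q where "q = (norm x)\<^sup>2 + e"
          have q: "q > 0" "(norm x)\<^sup>2 > 0" "(norm x)\<^sup>2 \<le> q" using e elim by (auto simp: q_def add_nonneg_pos)
          have "q powr \<gamma> = q powr (\<gamma> - 1) * q powr 1" by (simp only: powr_add[symmetric]) simp
          then have "q powr (\<gamma> - 1) = q powr \<gamma> / q" using q by simp
          also have "\<dots> \<le> q powr \<gamma> / (norm x)\<^sup>2" by (rule divide_left_mono[OF q(3) _ mult_pos_pos[OF q(1,2)]]) simp
          finally have "(k ((norm x)\<^sup>2))\<^sup>2 * q powr (\<gamma> - 1) \<le> (k ((norm x)\<^sup>2))\<^sup>2 * (q powr \<gamma> / (norm x)\<^sup>2)"
            by (intro mult_left_mono) auto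
          then have "E e x \<le> (\<phi> x)\<^sup>2 / (norm x)\<^sup>2" unfolding E_def \<phi>2 q_def by (simp add: mult_ac)
          then have "E e x * \<mu> x \<le> (\<phi> x)\<^sup>2 / (norm x)\<^sup>2 * \<mu> x" using \<mu>0 by (rule mult_right_mono)
          then show ?case using \<mu>0[of x] by (simp add: ennreal_mult[symmetric] ennreal_leI mult.commute)
        qed
      qed
      also have "\<dots> = (\<integral>\<^sup>+x. ennreal ((\<phi> x)\<^sup>2 / (norm x)\<^sup>2) \<partial>weighted \<mu>)" unfolding weighted_def
        using \<mu>m borel_measurable_divide[OF mG(2) nx] by (intro nn_integral_density[symmetric]) auto
      finally show ?thesis .
    qed
    have Y0: "(\<integral>x. E e x * \<mu> x \<partial>lebesgue) \<ge> 0" using E0 \<mu>0 by simp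
    have "ereal (c * (\<integral>x. E e x * \<mu> x \<partial>lebesgue)) = ereal c * enn2ereal (ennreal (\<integral>x. E e x * \<mu> x \<partial>lebesgue))"
      using Y0 by (simp add: enn2ereal_ennreal)
    also have "\<dots> \<le> ereal c * enn2ereal (\<integral>\<^sup>+x. ennreal ((\<phi> x)\<^sup>2 / (norm x)\<^sup>2) \<partial>weighted \<mu>)"
      using c0 low by (intro ereal_mult_left_mono) (auto simp: less_eq_ennreal.rep_eq)
    also note H
    finally have H': "c * (\<integral>x. E e x * \<mu> x \<partial>lebesgue) \<le> (\<integral>x. (norm (G x))\<^sup>2 * \<mu> x \<partial>lebesgue) + C * (\<integral>x. (\<phi> x)\<^sup>2 * \<mu> x \<partial>lebesgue)"
      by (simp add: gw \<phi>w)
    have I1: "(\<integral>x. (norm (G x))\<^sup>2 * \<mu> x \<partial>lebesgue) \<le> (\<integral>x. \<gamma>\<^sup>2 * (E e x * \<mu> x) + MM * dd x \<partial>lebesgue)"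
    proof (rule integral_mono_AE[OF iG])
      show "integrable lebesgue (\<lambda>x. \<gamma>\<^sup>2 * (E e x * \<mu> x) + MM * dd x)"
        by (intro Bochner_Integration.integrable_add integrable_mult_right iE idd)
      show "AE x in lebesgue. (norm (G x))\<^sup>2 * \<mu> x \<le> \<gamma>\<^sup>2 * (E e x * \<mu> x) + MM * dd x"
        using AE_not_zero
      proof eventually_elim
        case (elim x)
        let ?i = "if (norm x)\<^sup>2 \<le> 1 then ((norm x)\<^sup>2 + e) powr \<gamma> else 0"
        have "(norm (G x))\<^sup>2 * \<mu> x \<le> (\<gamma>\<^sup>2 * E e x + MM * ?i) * \<mu> x" using G2 \<mu>0 by (rule mult_right_mono)
        also have "\<dots> = \<gamma>\<^sup>2 * (E e x * \<mu> x) + MM * (?i * \<mu> x)" by (simp add: algebra_simps)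
        also have "\<dots> \<le> \<gamma>\<^sup>2 * (E e x * \<mu> x) + MM * dd x"
          using qdd[OF elim] by (intro add_left_mono mult_left_mono) (auto simp: MM_def)
        finally show ?case .
      qed
    qed
    have I2: "(\<integral>x. (\<phi> x)\<^sup>2 * \<mu> x \<partial>lebesgue) \<le> (\<integral>x. dd x \<partial>lebesgue)"
    proof (rule integral_mono_AE[OF i\<phi> idd])
      show "AE x in lebesgue. (\<phi> x)\<^sup>2 * \<mu> x \<le> dd x"
        using AE_not_zero by eventually_elim (meson mult_right_mono[OF p2 \<mu>0] order_trans qdd)
    qed
    have I3: "(\<integral>x. \<gamma>\<^sup>2 * (E e x * \<mu> x) + MM * dd x \<partial>lebesgue) = \<gamma>\<^sup>2 * (\<integral>x. E e x * \<mu> x \<partial>lebesgue) + MM * (\<integral>x. dd x \<partial>lebesgue)"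
      using iE idd by simp
    have J0: "(\<integral>x. (\<phi> x)\<^sup>2 * \<mu> x \<partial>lebesgue) \<ge> 0" using \<mu>0 by simp
    have "C * (\<integral>x. (\<phi> x)\<^sup>2 * \<mu> x \<partial>lebesgue) \<le> \<bar>C\<bar> * (\<integral>x. (\<phi> x)\<^sup>2 * \<mu> x \<partial>lebesgue)" using J0 by (intro mult_right_mono) auto
    also have "\<dots> \<le> \<bar>C\<bar> * (\<integral>x. dd x \<partial>lebesgue)" using I2 by (intro mult_left_mono) auto
    finally show ?thesis using H' I1 iE unfolding I3 B0_def by (simp add: algebra_simps)
  qed
  define en where "en n = 1 / (real n + 1)" for n
  have en: "0 < en n" "en n \<le> 1" for n by (auto simp: en_def)
  have en0: "en \<longlonglongrightarrow> 0" using LIMSEQ_inverse_real_of_nat unfolding en_def by (simp add: inverse_eq_divide add.commute)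
  have E0: "E e x \<ge> 0" for e x by (simp add: E_def)
  have lim: "(\<lambda>n. E (en n) x * \<mu> x) \<longlonglongrightarrow> E 0 x * \<mu> x" if "x \<noteq> 0" for x
  proof -
    have "(\<lambda>n. E (en n) x * \<mu> x) \<longlonglongrightarrow> (k ((norm x)\<^sup>2))\<^sup>2 * ((norm x)\<^sup>2 + 0) powr (\<gamma> - 1) * \<mu> x"
      unfolding E_def by (intro tendsto_intros en0) (use that in auto)
    then show ?thesis by (simp add: E_def)
  qed
  have em: "(\<lambda>x. E (en n) x * \<mu> x) \<in> borel_measurable lebesgue" for n using main[OF en] by blast
  have e0m: "(\<lambda>x. E 0 x * \<mu> x) \<in> borel_measurable lebesgue"
  proof -
    have "E 0 \<in> borel_measurable borel" unfolding E_def k_def by measurable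
    then have "E 0 \<in> borel_measurable lebesgue" by (intro measurable_completion) simp
    then show ?thesis using \<mu>m by (rule borel_measurable_times)
  qed
  have "(\<integral>\<^sup>+x. ennreal (E 0 x * \<mu> x) \<partial>lebesgue) \<le> (\<integral>\<^sup>+x. liminf (\<lambda>n. ennreal (E (en n) x * \<mu> x)) \<partial>lebesgue)"
  proof (rule nn_integral_mono_AE)
    show "AE x in lebesgue. ennreal (E 0 x * \<mu> x) \<le> liminf (\<lambda>n. ennreal (E (en n) x * \<mu> x))"
      using AE_not_zero
    proof eventually_elim
      case (elim x)
      have "(\<lambda>n. ennreal (E (en n) x * \<mu> x)) \<longlonglongrightarrow> ennreal (E 0 x * \<mu> x)" by (intro tendsto_ennrealI lim elim)
      then show ?case using lim_imp_Liminf[OF trivial_limit_sequentially] by (metis order_refl)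
    qed
  qed
  also have "\<dots> \<le> liminf (\<lambda>n. \<integral>\<^sup>+x. ennreal (E (en n) x * \<mu> x) \<partial>lebesgue)"
    using em by (intro nn_integral_liminf) auto
  also have "\<dots> \<le> liminf (\<lambda>n :: nat. ennreal (B0 / (c - \<gamma>\<^sup>2)))"
  proof (intro Liminf_mono always_eventually allI)
    fix n
    have "(\<integral>\<^sup>+x. ennreal (E (en n) x * \<mu> x) \<partial>lebesgue) = ennreal (\<integral>x. E (en n) x * \<mu> x \<partial>lebesgue)"
      using main[OF en] E0 \<mu>0 by (intro nn_integral_eq_integral) auto
    also have "\<dots> \<le> ennreal (B0 / (c - \<gamma>\<^sup>2))"
      using main[OF en, of n] \<gamma>c by (intro ennreal_leI) (simp add: pos_le_divide_eq mult.commute)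
    finally show "(\<integral>\<^sup>+x. ennreal (E (en n) x * \<mu> x) \<partial>lebesgue) \<le> ennreal (B0 / (c - \<gamma>\<^sup>2))" .
  qed
  also have "\<dots> = ennreal (B0 / (c - \<gamma>\<^sup>2))" by (simp add: Liminf_const)
  finally have "(\<integral>\<^sup>+x. ennreal (norm (E 0 x * \<mu> x)) \<partial>lebesgue) < \<infinity>"
    using E0 \<mu>0 by (simp add: le_less_trans ennreal_less_top)
  then have iE0: "integrable lebesgue (\<lambda>x. E 0 x * \<mu> x)" by (intro integrableI_bounded e0m)
  \<comment> \<open>This exponent is \<open>m + 2 * \<tau>\<close>, beyond the supremum. For
    \<open>norm x \<le> 1 / 2\<close> the profile satisfies \<open>k \<ge> (3 / 4)\<^sup>2\<close>,
    hence \<open>k\<^sup>2 \<ge> 1 / 4\<close>, which explains the factor 4; farther out the power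
    is at most its value at 1/2.\<close>
  have "2 - 2 * \<gamma> \<in> loc_integrable_exponents \<mu>" unfolding ex_iff
  proof (rule L1_loc_bound)
    show "L1_loc lebesgue (\<lambda>x. 4 * (E 0 x * \<mu> x) + (1 / 2) powr (2 * \<gamma> - 2) * \<mu> x)"
      by (intro L1_loc_add L1_loc_cmult L1_loc_integrable iE0 \<mu>L)
    show "(\<lambda>x. \<mu> x * norm x powr (- (2 - 2 * \<gamma>))) \<in> borel_measurable lebesgue"
      by (intro borel_measurable_times \<mu>m norm_powr_measurable)
    have "norm x powr (- (2 - 2 * \<gamma>)) \<le> 4 * E 0 x + (1 / 2) powr (2 * \<gamma> - 2)" for x :: "real ^ 'n"
    proof (cases "norm x \<le> 1 / 2")
      case True
      have "(norm x)\<^sup>2 \<le> (1 / 2)\<^sup>2" using True by (intro power_mono) auto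
      then have s: "(norm x)\<^sup>2 \<le> 1 / 4" by (simp add: power2_eq_square)
      then have "(3 / 4)\<^sup>2 \<le> k ((norm x)\<^sup>2)" unfolding k_def by (intro power_mono) auto
      then have "((3 / 4)\<^sup>2)\<^sup>2 \<le> (k ((norm x)\<^sup>2))\<^sup>2" by (rule power_mono) simp
      then have k4: "1 / 4 \<le> (k ((norm x)\<^sup>2))\<^sup>2" by (simp add: power2_eq_square)
      have "norm x powr (- (2 - 2 * \<gamma>)) = ((norm x)\<^sup>2) powr (\<gamma> - 1)"
      \<comment> \<open>At the origin both sides are powers of 0, which \<open>powr\<close>
        evaluates to 0.\<close>
      proof (cases "x = 0")
        case False
        then have sq: "(norm x)\<^sup>2 = norm x powr 2" by (simp add: powr_numeral)
        show ?thesis unfolding sq powr_powr by (simp add: algebra_simps)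
      qed simp
      also have "\<dots> \<le> 4 * ((k ((norm x)\<^sup>2))\<^sup>2 * ((norm x)\<^sup>2) powr (\<gamma> - 1))"
        using mult_right_mono[OF k4, of "((norm x)\<^sup>2) powr (\<gamma> - 1)"] by simp
      also have "\<dots> = 4 * E 0 x" by (simp add: E_def)
      finally show ?thesis by (simp add: add_increasing2)
    next
      case False
      have "norm x powr (2 * \<gamma> - 2) \<le> (1 / 2) powr (2 * \<gamma> - 2)"
        using False m0 \<tau> by (intro powr_mono2') (auto simp: \<gamma>_def A_def)
      then show ?thesis using E0[of 0 x] by (simp add: add_increasing)
    qed
    then have "\<mu> x * norm x powr (- (2 - 2 * \<gamma>)) \<le> \<mu> x * (4 * E 0 x + (1 / 2) powr (2 * \<gamma> - 2))" for x
      using \<mu>0 by (rule mult_left_mono)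
    then show "AE x in lebesgue. norm (\<mu> x * norm x powr (- (2 - 2 * \<gamma>))) \<le> norm (4 * (E 0 x * \<mu> x) + (1 / 2) powr (2 * \<gamma> - 2) * \<mu> x)"
      using \<mu>0 E0 by (intro AE_I2) (simp add: algebra_simps)
  qed
  then have "2 - 2 * \<gamma> \<le> m" unfolding m_def N0_def using bdd by (intro cSup_upper) auto
  then show False using \<tau> by (simp add: \<gamma>_def A_def)
qed

theorem theorem1p2:
  fixes \<mu> :: "real ^ 'n \<Rightarrow> real" and c :: real
  assumes "CARD('n) \<ge> 3"
    and "\<And>x. \<mu> x \<ge> 0"
    and "(\<lambda>x. sqrt (\<mu> x)) \<in> H1_loc"
    and "\<exists>l. has_weak_laplacian \<mu> l"
    and "\<bar>c0_mu \<mu>\<bar> \<noteq> \<infinity>"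
    and "\<And>R. R > 0 \<Longrightarrow> \<exists>K. AE x in weighted \<mu>. x \<notin> ball 0 R \<longrightarrow> U_rem \<mu> x \<le> K"
    and "\<exists>R0>0. AE x in weighted \<mu>. x \<in> ball 0 R0 \<longrightarrow>
           (norm x)\<^sup>2 * U_rem \<mu> x \<le> 1/4 * (1 / \<bar>ln (norm x)\<bar>\<^sup>2)"
    and "L1_loc lebesgue \<mu>"
    and "loc_integrable_exponents \<mu> \<noteq> {}" and "bdd_above (loc_integrable_exponents \<mu>)"
    and "c0_mu \<mu> = ereal (c0 (N0 \<mu>))"
  shows "(\<exists>C. \<forall>\<phi>\<in>H1_weighted \<mu>. weighted_hardy \<mu> c C \<phi>) \<longleftrightarrow> c \<le> c0 (N0 \<mu>)"
proof
  assume "\<exists>C. \<forall>\<phi>\<in>H1_weighted \<mu>. weighted_hardy \<mu> c C \<phi>"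
  then show "c \<le> c0 (N0 \<mu>)" using hardy_constant_le[OF assms(2,8,9,10)] by blast
next
  assume cle: "c \<le> c0 (N0 \<mu>)"
  note N = assms(1) and \<mu>0 = assms(2)
  note \<mu>m = L1_loc_measurable[OF assms(8)]
  define v where "v x = sqrt (\<mu> x)" for x
  have v2: "(v x)\<^sup>2 = \<mu> x" for x using \<mu>0 by (simp add: v_def)
  obtain w where w: "has_weak_gradient v w" "L2_loc lebesgue w"
    using assms(3) unfolding H1_loc_def v_def[abs_def] by blast
  have v2L: "L1_loc lebesgue (\<lambda>x. (v x)\<^sup>2)" using assms(8) by (simp add: v2)
  have w2L: "L1_loc lebesgue (\<lambda>x. (norm (w x))\<^sup>2)" using w(2) by (simp add: L2_loc_def L1_loc_def)
  have gm: "has_weak_gradient \<mu> (\<lambda>x. (2 * v x) *\<^sub>R w x)"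
    using has_weak_gradient_square[OF w(1) v2L w2L] by (simp add: v2)
  define l where "l = weak_laplacian \<mu>"
  have l: "has_weak_laplacian \<mu> l" unfolding l_def weak_laplacian_def using assms(4) by (rule someI_ex)
  then have l': "has_weak_laplacian (\<lambda>x. (v x)\<^sup>2) l" by (simp add: v2)
  \<comment> \<open>By uniqueness of weak gradients \<open>grad \<mu> = 2 v w\<close>, so a quarter
    of \<open>|grad \<mu> / \<mu>|^2\<close> is \<open>|w|^2 / v^2\<close> wherever \<open>v\<close>
    does not vanish.\<close>
  have Ueq: "AE x in lebesgue. v x \<noteq> 0 \<longrightarrow> U_mu \<mu> x = ((norm (w x))\<^sup>2 - l x / 2) / (v x)\<^sup>2"
    using weak_gradient_unique(2)[OF gm]
  proof eventually_elim
    case (elim x)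
    show ?case
    proof
      assume v: "v x \<noteq> 0"
      have "(norm (weak_gradient \<mu> x /\<^sub>R \<mu> x))\<^sup>2 = (2 * v x / (v x)\<^sup>2)\<^sup>2 * (norm (w x))\<^sup>2"
        unfolding elim by (simp add: v2[symmetric] power_mult_distrib divide_inverse power2_abs mult_ac)
      also have "2 * v x / (v x)\<^sup>2 = 2 / v x" using v by (simp add: power2_eq_square)
      finally have "1/4 * (norm (weak_gradient \<mu> x /\<^sub>R \<mu> x))\<^sup>2 = (norm (w x))\<^sup>2 / (v x)\<^sup>2" by (simp add: power_divide)
      then show "U_mu \<mu> x = ((norm (w x))\<^sup>2 - l x / 2) / (v x)\<^sup>2"
        by (simp add: U_mu_def l_def v2 diff_divide_distrib)
    qed
  qed
  define n where "n = real CARD('n)"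
  define F where "F = ess_at_0 \<mu>"
  define h where "h x = (norm x)\<^sup>2 * U_mu \<mu> x" for x
  define L where "L = real_of_ereal (Limsup F (\<lambda>x. ereal (h x)))"
  \<comment> \<open>The limit inferior of a constant minus \<open>h\<close> is the constant minus
    the limit superior of \<open>h\<close>, provided the filter is nontrivial; a trivial one would
    make \<open>c0_mu \<mu>\<close> infinite. Thus the coefficient \<open>L\<close> split off in
    \<open>U_rem\<close> lowers \<open>b\<^sup>2\<close> exactly to
    \<open>c0 (N0 \<mu>)\<close>.\<close>
  have LL: "c0 n - L = c0 (N0 \<mu>)"
  proof -
    have e: "Liminf F (\<lambda>x. ereal (c0 n - h x)) = ereal (c0 (N0 \<mu>))"
      using assms(11) unfolding c0_mu_def F_def h_def n_def .
    have nb: "F \<noteq> bot"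
    proof
      assume "F = bot"
      then have "Liminf F (\<lambda>x. ereal (c0 n - h x)) = top" by (simp only: Liminf_bot)
      then show False using e by (simp add: top_ereal_def)
    qed
    have "Liminf F (\<lambda>x. ereal (c0 n) + - ereal (h x)) = ereal (c0 n) + Liminf F (\<lambda>x. - ereal (h x))"
      by (rule Liminf_add_ereal_left[OF nb]) simp
    also have "\<dots> = ereal (c0 n) - Limsup F (\<lambda>x. ereal (h x))"
      unfolding ereal_Liminf_uminus by (simp add: minus_ereal_def)
    finally have "ereal (c0 n) - Limsup F (\<lambda>x. ereal (h x)) = ereal (c0 (N0 \<mu>))" using e by simp
    then show ?thesis unfolding L_def by (cases "Limsup F (\<lambda>x. ereal (h x))") auto
  qed
  have Urem: "U_mu \<mu> x = U_rem \<mu> x + L / (norm x)\<^sup>2" for x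
    by (simp add: U_rem_def L_def F_def h_def)
  obtain R0 where R0: "R0 > 0" "AE x in weighted \<mu>. x \<in> ball 0 R0 \<longrightarrow> (norm x)\<^sup>2 * U_rem \<mu> x \<le> 1/4 * (1 / \<bar>ln (norm x)\<bar>\<^sup>2)"
    using assms(7) by blast
  \<comment> \<open>For \<open>(norm x)\<^sup>2 < s1\<close> both the assumed logarithmic bound and
    the logarithmic term of the drift are available; beyond it \<open>U_rem\<close> is bounded by
    assumption.\<close>
  define s1 where "s1 = min (R0\<^sup>2) (1 / 2)"
  have s1: "s1 > 0" "s1 \<le> R0\<^sup>2" "s1 \<le> 1 / 2" using R0 by (auto simp: s1_def)
  obtain K where K: "AE x in weighted \<mu>. x \<notin> ball 0 (sqrt s1) \<longrightarrow> U_rem \<mu> x \<le> K"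
    using assms(6)[of "sqrt s1"] s1 by auto
  have AEw: "(AE x in weighted \<mu>. P x) \<longleftrightarrow> (AE x in lebesgue. v x \<noteq> 0 \<longrightarrow> P x)" for P
  proof -
    have "(AE x in weighted \<mu>. P x) \<longleftrightarrow> (AE x in lebesgue. 0 < ennreal (\<mu> x) \<longrightarrow> P x)"
      unfolding weighted_def using \<mu>m by (intro AE_density) auto
    moreover have "0 < ennreal (\<mu> x) \<longleftrightarrow> v x \<noteq> 0" for x using \<mu>0[of x] by (simp add: v_def less_le)
    ultimately show ?thesis by simp
  qed
  \<comment> \<open>Nonnegativity lets the constant be added near the origin as well, and makes the
    final constant \<open>CC\<close> nonnegative.\<close>
  define K' where "K' = max K 0"
  have U: "AE x in lebesgue. v x \<noteq> 0 \<longrightarrow> ((norm (w x))\<^sup>2 - l x / 2) / (v x)\<^sup>2 \<le>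
       L / (norm x)\<^sup>2 + (if (norm x)\<^sup>2 < 1 / 2 then 1 / ((norm x)\<^sup>2 * (ln ((norm x)\<^sup>2))\<^sup>2) else 0) + K'"
    using Ueq R0(2)[unfolded AEw] K[unfolded AEw] AE_not_zero
  proof eventually_elim
    case (elim x)
    show ?case
    proof
      assume v: "v x \<noteq> 0"
      define i where "i = (if (norm x)\<^sup>2 < 1 / 2 then 1 / ((norm x)\<^sup>2 * (ln ((norm x)\<^sup>2))\<^sup>2) else 0)"
      have i0: "i \<ge> 0" by (simp add: i_def)
      have "U_rem \<mu> x \<le> i + K'"
      proof (cases "(norm x)\<^sup>2 < s1")
        case True
        then have "(norm x)\<^sup>2 < R0\<^sup>2" using s1 by linarith
        then have "x \<in> ball 0 R0" using R0(1) by (simp add: power_less_imp_less_base)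
        then have le: "(norm x)\<^sup>2 * U_rem \<mu> x \<le> 1/4 * (1 / \<bar>ln (norm x)\<bar>\<^sup>2)" using elim(2) v by blast
        have x: "norm x > 0" using elim(4) by simp
        \<comment> \<open>Doubling the logarithm absorbs the factor 1/4 of the assumption, which
          becomes the term \<open>1 / (s * (ln s)\<^sup>2)\<close> at
          \<open>s = (norm x)\<^sup>2\<close>.\<close>
        have "ln ((norm x)\<^sup>2) = 2 * ln (norm x)" using x by (simp add: ln_realpow)
        then have "1 / (ln ((norm x)\<^sup>2))\<^sup>2 = 1/4 * (1 / \<bar>ln (norm x)\<bar>\<^sup>2)" by (simp add: power_mult_distrib)
        then have "U_rem \<mu> x * (norm x)\<^sup>2 \<le> 1 / (ln ((norm x)\<^sup>2))\<^sup>2" using le by (simp add: mult.commute)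
        moreover have "0 < (norm x)\<^sup>2" using x by simp
        ultimately have "U_rem \<mu> x \<le> 1 / (ln ((norm x)\<^sup>2))\<^sup>2 / (norm x)\<^sup>2" by (simp only: pos_le_divide_eq)
        also have "\<dots> = i" using True s1 by (simp add: i_def mult.commute)
        finally show ?thesis by (simp add: K'_def)
      next
        case False
        have "x \<notin> ball 0 (sqrt s1)"
        proof
          assume "x \<in> ball 0 (sqrt s1)"
          then have "(norm x)\<^sup>2 < (sqrt s1)\<^sup>2" by (intro power_strict_mono) auto
          then show False using False s1 by simp
        qed
        then have "U_rem \<mu> x \<le> K" using elim(3) v by blast
        then show ?thesis using i0 by (simp add: K'_def)
      qed
      then have "U_mu \<mu> x \<le> L / (norm x)\<^sup>2 + i + K'" unfolding Urem by linarith
      then show "((norm (w x))\<^sup>2 - l x / 2) / (v x)\<^sup>2 \<le> L / (norm x)\<^sup>2 + (if (norm x)\<^sup>2 < 1 / 2 then 1 / ((norm x)\<^sup>2 * (ln ((norm x)\<^sup>2))\<^sup>2) else 0) + K'"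
        using elim(1) v unfolding i_def by simp
    qed
  qed
  define b where "b = (real CARD('n) - 2) / 2"
  have bL: "b\<^sup>2 - L = c0 (N0 \<mu>)" using LL by (simp add: b_def n_def c0_def)
  define CC where "CC = 4 * b\<^sup>2 + 8 * b + 32 + K'"
  have b0: "b \<ge> 0" using N by (simp add: b_def)
  have CC0: "CC \<ge> 0" using b0 by (simp add: CC_def K'_def)
  have c00: "c0 (N0 \<mu>) \<ge> 0" by (simp add: c0_def)
  have "weighted_hardy \<mu> c CC \<phi>" if \<phi>: "\<phi> \<in> H1_weighted \<mu>" for \<phi>
  proof -
    obtain g where g: "has_weak_gradient \<phi> g" "L2 (weighted \<mu>) g" and L2\<phi>: "L2 (weighted \<mu>) \<phi>"
      using \<phi> unfolding H1_weighted_def by blast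
    note mg = has_weak_gradient_L1_loc[OF g(1)]
    have m1: "(\<lambda>x. (norm (g x))\<^sup>2) \<in> borel_measurable lebesgue" "(\<lambda>x. (\<phi> x)\<^sup>2) \<in> borel_measurable lebesgue"
      by (intro borel_measurable_power borel_measurable_norm_compose mg)+
    have i1: "integrable lebesgue (\<lambda>x. (norm (g x))\<^sup>2 * (v x)\<^sup>2)"
      using g(2) integral_weighted(2)[OF \<mu>m \<mu>0 m1(1)] by (simp add: L2_def v2)
    have i2: "integrable lebesgue (\<lambda>x. (\<phi> x)\<^sup>2 * (v x)\<^sup>2)"
      using L2\<phi> integral_weighted(2)[OF \<mu>m \<mu>0 m1(2)] by (simp add: L2_def v2)
    note W = weak_gradient_unique[OF g(1)]
    have mW: "(\<lambda>x. (norm (weak_gradient \<phi> x))\<^sup>2) \<in> borel_measurable lebesgue"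
      by (intro borel_measurable_power borel_measurable_norm_compose has_weak_gradient_L1_loc(5)[OF W(1)])
    have e1: "(\<integral>x. (norm (weak_gradient \<phi> x))\<^sup>2 \<partial>weighted \<mu>) = (\<integral>x. (norm (g x))\<^sup>2 * (v x)\<^sup>2 \<partial>lebesgue)"
    proof -
      have "(\<integral>x. (norm (weak_gradient \<phi> x))\<^sup>2 \<partial>weighted \<mu>) = (\<integral>x. (norm (weak_gradient \<phi> x))\<^sup>2 * \<mu> x \<partial>lebesgue)"
        by (rule integral_weighted(1)[OF \<mu>m \<mu>0 mW])
      also have "\<dots> = (\<integral>x. (norm (g x))\<^sup>2 * \<mu> x \<partial>lebesgue)"
        using W(2) by (intro integral_cong_AE borel_measurable_times mW m1 \<mu>m) (auto elim: eventually_mono)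
      finally show ?thesis by (simp add: v2)
    qed
    have e2: "(\<integral>x. (\<phi> x)\<^sup>2 \<partial>weighted \<mu>) = (\<integral>x. (\<phi> x)\<^sup>2 * (v x)\<^sup>2 \<partial>lebesgue)"
      using integral_weighted(1)[OF \<mu>m \<mu>0 m1(2)] by (simp add: v2)
    define I where "I = (\<integral>\<^sup>+x. ennreal ((\<phi> x)\<^sup>2 / (norm x)\<^sup>2) \<partial>weighted \<mu>)"
    have nx: "(\<lambda>x :: real ^ 'n. (norm x)\<^sup>2) \<in> borel_measurable lebesgue"
      by (intro borel_measurable_lebesgue_continuous continuous_intros)
    have I: "I = (\<integral>\<^sup>+x. ennreal ((v x)\<^sup>2 * ((\<phi> x)\<^sup>2 / (norm x)\<^sup>2)) \<partial>lebesgue)"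
    proof -
      have "I = (\<integral>\<^sup>+x. ennreal (\<mu> x) * ennreal ((\<phi> x)\<^sup>2 / (norm x)\<^sup>2) \<partial>lebesgue)"
        unfolding I_def weighted_def using \<mu>m borel_measurable_divide[OF m1(2) nx]
        by (intro nn_integral_density) auto
      moreover have "ennreal (\<mu> x * ((\<phi> x)\<^sup>2 / (norm x)\<^sup>2)) = ennreal (\<mu> x) * ennreal ((\<phi> x)\<^sup>2 / (norm x)\<^sup>2)" for x
        using \<mu>0 by (intro ennreal_mult) auto
      ultimately show ?thesis unfolding v2 by (simp only:)
    qed
    define RHS where "RHS = (\<integral>x. (norm (g x))\<^sup>2 * (v x)\<^sup>2 \<partial>lebesgue) + CC * (\<integral>x. (\<phi> x)\<^sup>2 * (v x)\<^sup>2 \<partial>lebesgue)"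
    have RHS0: "RHS \<ge> 0" unfolding RHS_def using CC0 by (intro add_nonneg_nonneg mult_nonneg_nonneg) auto
    have bound: "ennreal (c0 (N0 \<mu>)) * I \<le> ennreal RHS"
      using hardy_weighted[OF N w(1) v2L w2L l' U g(1) i2 i1, folded b_def] c00
      unfolding I bL RHS_def CC_def by simp
    have "ereal c * enn2ereal I \<le> ereal RHS"
    \<comment> \<open>For \<open>c \<le> 0\<close> the left side is at most 0 even if the integral
      is infinite, and the right side is nonnegative. For positive \<open>c\<close> the left side is
      monotone in \<open>c\<close>, so the extremal constant suffices.\<close>
    proof (cases "c \<le> 0")
      case True
      then have "ereal c * enn2ereal I \<le> 0" by (simp add: ereal_mult_le_0_iff)
      also have "0 \<le> ereal RHS" using RHS0 by simp
      finally show ?thesis .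
    next
      case False
      have "ereal c * enn2ereal I \<le> ereal (c0 (N0 \<mu>)) * enn2ereal I"
        using cle by (intro ereal_mult_right_mono) auto
      also have "\<dots> = enn2ereal (ennreal (c0 (N0 \<mu>)) * I)"
        using c00 by (simp add: times_ennreal.rep_eq enn2ereal_ennreal)
      also have "\<dots> \<le> enn2ereal (ennreal RHS)" using bound by (simp add: less_eq_ennreal.rep_eq)
      also have "\<dots> = ereal RHS" using RHS0 by (simp add: enn2ereal_ennreal)
      finally show ?thesis .
    qed
    then show ?thesis unfolding weighted_hardy_def I_def RHS_def e1 e2 .
  qed
  then show "\<exists>C. \<forall>\<phi>\<in>H1_weighted \<mu>. weighted_hardy \<mu> c C \<phi>" by blast
qed

end
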